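(* Let $\Bbbk$ be a field of characteristic $p>0$ and let $G$ be a finite group of order divisible by $p$. Then the Kelly radical $\mathrm{Rad}_{\mathscr{C}}$ of the category $\mathscr{C}=\Bbbk G\text{-}\mathrm{stmod}$ is a $\otimes$-ideal if and only if $p^2$ does not divide the order of $G$.
   Context: $\Bbbk G\text{-}\mathrm{stmod}$ is the stable category of finite-dimensional $\Bbbk G$-modules: morphisms are $\mathrm{Hom}_{\Bbbk G}(M,N)$ modulo those homomorphisms that factor through a projective module. It is a tensor category with $\otimes=\otimes_{\Bbbk}$ and diagonal $G$-action. The Kelly radical of an additive category $\mathscr{C}$ is the ideal of morphisms $\mathrm{Rad}_{\mathscr{C}}(M,N)=\{f:M\to N\mid 1_M-gf\text{ is invertible for all }g:N\to M\}$. An ideal of morphisms $\mathcal{J}$ in a tensor category is a $\otimes$-ideal if $f\otimes g\in\mathcal{J}$ whenever $f\in\mathcal{J}$ and $g$ is any morphism; equivalently, if $f\otimes L\in\mathcal{J}(M\otimes L,N\otimes L)$ for every $f\in\mathcal{J}(M,N)$ and every object $L$. *)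

theory Defs
  imports
    "HOL-Algebra.Coset"
    "Jordan_Normal_Form.Matrix"
begin

section \<open>Kelly radical and tensor ideals\<close>

text \<open>
  The data of a category enriched in abelian groups and equipped with a tensor product.  The operations carry
  the objects as arguments because a morphism need not determine its source and target:
  \<open>Comp C M N L g f\<close> is the composite of \<open>f\<close> from \<open>M\<close> to \<open>N\<close> and \<open>g\<close> from \<open>N\<close> to \<open>L\<close>, and
  \<open>TMor C M N K L f g\<close> is the tensor product of \<open>f\<close> from \<open>M\<close> to \<open>N\<close> and \<open>g\<close> from \<open>K\<close> to \<open>L\<close>.
\<close>

record ('o, 'm) tensor_category =
  Obj :: "'o set"
  Mor :: "'o \<Rightarrow> 'o \<Rightarrow> 'm set"
  Ident :: "'o \<Rightarrow> 'm"
  Comp :: "'o \<Rightarrow> 'o \<Rightarrow> 'o \<Rightarrow> 'm \<Rightarrow> 'm \<Rightarrow> 'm"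
  Zero :: "'o \<Rightarrow> 'o \<Rightarrow> 'm"
  Add :: "'o \<Rightarrow> 'o \<Rightarrow> 'm \<Rightarrow> 'm \<Rightarrow> 'm"
  Neg :: "'o \<Rightarrow> 'o \<Rightarrow> 'm \<Rightarrow> 'm"
  TObj :: "'o \<Rightarrow> 'o \<Rightarrow> 'o"
  TMor :: "'o \<Rightarrow> 'o \<Rightarrow> 'o \<Rightarrow> 'o \<Rightarrow> 'm \<Rightarrow> 'm \<Rightarrow> 'm"

definition invertible_endo :: "('o, 'm, 'z) tensor_category_scheme \<Rightarrow> 'o \<Rightarrow> 'm \<Rightarrow> bool" where
  "invertible_endo C M u \<longleftrightarrow> u \<in> Mor C M M \<and>
     (\<exists>v\<in>Mor C M M. Comp C M M M u v = Ident C M \<and> Comp C M M M v u = Ident C M)"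

definition kelly_radical :: "('o, 'm, 'z) tensor_category_scheme \<Rightarrow> 'o \<Rightarrow> 'o \<Rightarrow> 'm set" where
  "kelly_radical C M N =
     {f \<in> Mor C M N. \<forall>g\<in>Mor C N M.
        invertible_endo C M (Add C M M (Ident C M) (Neg C M M (Comp C M N M g f)))}"

definition morphism_ideal ::
    "('o, 'm, 'z) tensor_category_scheme \<Rightarrow> ('o \<Rightarrow> 'o \<Rightarrow> 'm set) \<Rightarrow> bool" where
  "morphism_ideal C J \<longleftrightarrow>
     (\<forall>M\<in>Obj C. \<forall>N\<in>Obj C.
        J M N \<subseteq> Mor C M N \<and> Zero C M N \<in> J M N \<and>
        (\<forall>f\<in>J M N. Neg C M N f \<in> J M N \<and> (\<forall>f'\<in>J M N. Add C M N f f' \<in> J M N))) \<and>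
     (\<forall>K\<in>Obj C. \<forall>M\<in>Obj C. \<forall>N\<in>Obj C. \<forall>L\<in>Obj C.
        \<forall>h\<in>Mor C K M. \<forall>f\<in>J M N. \<forall>g\<in>Mor C N L.
          Comp C K M N f h \<in> J K N \<and> Comp C M N L g f \<in> J M L)"

definition tensor_ideal ::
    "('o, 'm, 'z) tensor_category_scheme \<Rightarrow> ('o \<Rightarrow> 'o \<Rightarrow> 'm set) \<Rightarrow> bool" where
  "tensor_ideal C J \<longleftrightarrow> morphism_ideal C J \<and>
     (\<forall>M\<in>Obj C. \<forall>N\<in>Obj C. \<forall>K\<in>Obj C. \<forall>L\<in>Obj C.
        \<forall>f\<in>J M N. \<forall>g\<in>Mor C K L. TMor C M N K L f g \<in> J (TObj C M K) (TObj C N L))"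


section \<open>Finite-dimensional modules over a group algebra\<close>

text \<open>
  A module over the group algebra of \<open>G\<close> of dimension \<open>n\<close> is given in a basis: the pair
  \<open>(n, \<rho>)\<close> stands for the space \<open>carrier_vec n\<close> on which \<open>g\<close> acts by the matrix \<open>\<rho> g\<close>.  The values
  of \<open>\<rho>\<close> outside \<open>carrier G\<close> are irrelevant.
\<close>

type_synonym ('g, 'k) rep = "nat \<times> ('g \<Rightarrow> 'k mat)"

definition is_rep :: "('g, 'z) monoid_scheme \<Rightarrow> ('g, 'k::field) rep \<Rightarrow> bool" where
  "is_rep G M \<longleftrightarrow>
     (\<forall>g\<in>carrier G. snd M g \<in> carrier_mat (fst M) (fst M)) \<and>
     snd M \<one>\<^bsub>G\<^esub> = 1\<^sub>m (fst M) \<and>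
     (\<forall>g\<in>carrier G. \<forall>h\<in>carrier G. snd M (g \<otimes>\<^bsub>G\<^esub> h) = snd M g * snd M h)"

text \<open>A linear map from \<open>carrier_vec m\<close> to \<open>carrier_vec n\<close> is an \<open>n \<times> m\<close> matrix.\<close>

definition rep_hom ::
    "('g, 'z) monoid_scheme \<Rightarrow> ('g, 'k::field) rep \<Rightarrow> ('g, 'k) rep \<Rightarrow> 'k mat set" where
  "rep_hom G M N =
     {A \<in> carrier_mat (fst N) (fst M). \<forall>g\<in>carrier G. A * snd M g = snd N g * A}"

definition rep_epi ::
    "('g, 'z) monoid_scheme \<Rightarrow> ('g, 'k::field) rep \<Rightarrow> ('g, 'k) rep \<Rightarrow> 'k mat set" where
  "rep_epi G M N =
     {A \<in> rep_hom G M N. \<forall>w\<in>carrier_vec (fst N). \<exists>v\<in>carrier_vec (fst M). A *\<^sub>v v = w}"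

text \<open>
  For a finite-dimensional module over a finite group it is enough to require the lifting property
  against surjections of finite-dimensional modules.
\<close>

definition projective_rep :: "('g, 'z) monoid_scheme \<Rightarrow> ('g, 'k::field) rep \<Rightarrow> bool" where
  "projective_rep G P \<longleftrightarrow> is_rep G P \<and>
     (\<forall>M N. is_rep G M \<longrightarrow> is_rep G N \<longrightarrow>
        (\<forall>e\<in>rep_epi G M N. \<forall>f\<in>rep_hom G P N. \<exists>h\<in>rep_hom G P M. e * h = f))"

definition projective_hom ::
    "('g, 'z) monoid_scheme \<Rightarrow> ('g, 'k::field) rep \<Rightarrow> ('g, 'k) rep \<Rightarrow> 'k mat set" where
  "projective_hom G M N =
     {v * u | u v P. projective_rep G P \<and> u \<in> rep_hom G M P \<and> v \<in> rep_hom G P N}"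

text \<open>
  The Kronecker product: with the basis vector \<open>e\<^sub>i \<otimes> e\<^sub>j\<close> of the tensor product of spaces of
  dimensions \<open>m\<close> and \<open>n\<close> placed at position \<open>i * n + j\<close>, it is the matrix of the tensor product of
  two linear maps.
\<close>

definition kronecker :: "'k::semiring_0 mat \<Rightarrow> 'k mat \<Rightarrow> 'k mat" where
  "kronecker A B =
     mat (dim_row A * dim_row B) (dim_col A * dim_col B)
       (\<lambda>(i, j). A $$ (i div dim_row B, j div dim_col B) * B $$ (i mod dim_row B, j mod dim_col B))"

definition rep_tensor :: "('g, 'k::field) rep \<Rightarrow> ('g, 'k) rep \<Rightarrow> ('g, 'k) rep" where
  "rep_tensor M N = (fst M * fst N, \<lambda>g. kronecker (snd M g) (snd N g))"


section \<open>The stable category\<close>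

definition stable_rel ::
    "('g, 'z) monoid_scheme \<Rightarrow> ('g, 'k::field) rep \<Rightarrow> ('g, 'k) rep \<Rightarrow> 'k mat rel" where
  "stable_rel G M N =
     {(a, b). a \<in> rep_hom G M N \<and> b \<in> rep_hom G M N \<and> a - b \<in> projective_hom G M N}"

text \<open>
  Morphisms are equivalence classes; every operation is the one on representatives, lifted to
  classes by taking a union of equal classes, as in \<^theory>\<open>HOL.Equiv_Relations\<close>.
\<close>

definition stmod ::
    "('g, 'z) monoid_scheme \<Rightarrow> 'k::field itself \<Rightarrow> (('g, 'k) rep, 'k mat set) tensor_category" where
  "stmod G (_ :: 'k itself) =
     \<lparr> Obj = {M. is_rep G M},
       Mor = (\<lambda>M N. rep_hom G M N // stable_rel G M N),
       Ident = (\<lambda>M. stable_rel G M M `` {1\<^sub>m (fst M)}),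
       Comp = (\<lambda>M N L Y X. \<Union>y\<in>Y. \<Union>x\<in>X. stable_rel G M L `` {y * x}),
       Zero = (\<lambda>M N. stable_rel G M N `` {0\<^sub>m (fst N) (fst M)}),
       Add = (\<lambda>M N X Y. \<Union>x\<in>X. \<Union>y\<in>Y. stable_rel G M N `` {x + y}),
       Neg = (\<lambda>M N X. \<Union>x\<in>X. stable_rel G M N `` {- x}),
       TObj = rep_tensor,
       TMor = (\<lambda>M N K L X Y. \<Union>x\<in>X. \<Union>y\<in>Y.
                 stable_rel G (rep_tensor M K) (rep_tensor N L) `` {kronecker x y}) \<rparr>"

end

theory Submission
  imports Defs "Jordan_Normal_Form.Determinant" "HOL-Algebra.Sylow" "HOL-Algebra.Multiplicative_Group"
begin

text \<open>
  A homomorphism is projective if and only if it is a trace \<open>\<Sum>\<^sub>g g h g\<inverse>\<close> of a linear map \<open>h\<close> (Higman), and so its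
  trace as a matrix is zero when the characteristic \<open>p\<close> divides the order of the group.  Hence the
  radical always consists of negligible homomorphisms, those \<open>f\<close> for which all \<open>g f\<close> have trace zero,
  and the negligible homomorphisms form a tensor ideal.

  If \<open>p\<^sup>2\<close> does not divide the order, the converse inclusion holds: negligibility and stable
  nilpotence can be tested on a Sylow subgroup of order \<open>p\<close>, where a module is a vector space with an operator
  \<open>x = \<sigma> - 1\<close> with \<open>x^p = 0\<close>.  A negligible endomorphism \<open>a\<close> maps \<open>ker x \<inter> im x^i\<close> into
  \<open>im x^(i+1)\<close> for \<open>i < p - 1\<close>, because Jordan blocks of size \<open>i + 1 < p\<close> have nonzero dimension in the
  field; so \<open>a^(p-1)\<close> maps the kernel of \<open>x\<close> into the image of \<open>x^(p-1) = \<Sum>\<^sub>i \<sigma>^i\<close>, which makes it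
  the sum of a projective and a nilpotent endomorphism.

  If \<open>p\<^sup>2\<close> divides the order, all endomorphisms of \<open>M = k[G/H]\<close> with \<open>|H| = p\<close> have trace zero, so the
  coevaluation \<open>k \<rightarrow> M \<otimes> M\<close> is in the radical; tensored with \<open>M\<close> it is a split
  monomorphism out of a module that is not projective.
\<close>

section \<open>Matrices over a field\<close>

text \<open>The order p of H balances two demands. The module k[G/H] is not projective, since a
  diagonal entry of a trace over G is a sum in which each diagonal entry of h occurs p times; its
  endomorphisms are traceless exactly when p divides the index [G:H]. Both hold if p^2 divides the
  order. Otherwise the index is invertible in k, and relative traces carry negligibility down to H
  and projectivity back up to G. The radical reaches traces through polynomials: for a = g f it
  makes 1 - a r(a) stably invertible for every r, and taking r from a polynomial that annihilates a
  forces a power of a to be projective. The obstacle is that modules come in bases, with no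
  subspaces or Jordan blocks at hand. Kernels and images are encoded by the idempotents 1 - q y and
  y q of a generalised inverse, y q y = y, and identities are tested by pairing with the trace. The
  exponent (p - 1) p of stable nilpotence has the factor p - 1 for the block sizes below p and the
  factor p for x^p = 0.\<close>

lemma mat_mult_assoc:
  "dim_col A = dim_row B \<Longrightarrow> dim_col B = dim_row C \<Longrightarrow> (A * B) * C = A * (B * (C :: 'a::semiring_0 mat))"
  by (rule assoc_mult_mat[of A "dim_row A" "dim_col A" B "dim_col B" C "dim_col C"]) auto

lemma mat_add_mult:
  "dim_row A = dim_row B \<Longrightarrow> dim_col A = dim_row C \<Longrightarrow> dim_col B = dim_row C \<Longrightarrow>
    (A + B) * C = A * C + B * (C :: 'a::semiring_0 mat)"
  by (rule add_mult_distrib_mat[of A "dim_row A" "dim_row C" B C "dim_col C"]) auto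

lemma mat_mult_add:
  "dim_col A = dim_row B \<Longrightarrow> dim_row B = dim_row C \<Longrightarrow> dim_col B = dim_col C \<Longrightarrow>
    A * (B + C) = A * B + A * (C :: 'a::semiring_0 mat)"
  by (rule mult_add_distrib_mat[of A "dim_row A" "dim_col A" B "dim_col B" C]) auto

lemma mat_minus_mult:
  "dim_row A = dim_row B \<Longrightarrow> dim_col A = dim_row C \<Longrightarrow> dim_col B = dim_row C \<Longrightarrow>
    (A - B) * C = A * C - B * (C :: 'a::ring mat)"
  by (rule minus_mult_distrib_mat[of A "dim_row A" "dim_row C" B C "dim_col C"]) auto

lemma mat_mult_minus:
  "dim_col A = dim_row B \<Longrightarrow> dim_row B = dim_row C \<Longrightarrow> dim_col B = dim_col C \<Longrightarrow>
    A * (B - C) = A * B - A * (C :: 'a::ring mat)"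
  by (rule mult_minus_distrib_mat[of A "dim_row A" "dim_col A" B "dim_col B" C]) auto

lemma mat_mult_smult:
  "dim_col A = dim_row B \<Longrightarrow> A * (c \<cdot>\<^sub>m B) = c \<cdot>\<^sub>m (A * (B :: 'a::comm_ring_1 mat))"
  by (rule mult_smult_distrib[of A "dim_row A" "dim_col A" B "dim_col B"]) auto

lemma mat_smult_mult:
  "dim_col A = dim_row B \<Longrightarrow> (c \<cdot>\<^sub>m A) * B = c \<cdot>\<^sub>m (A * (B :: 'a::comm_ring_1 mat))"
  by (rule mult_smult_assoc_mat[of A "dim_row A" "dim_col A" B "dim_col B"]) auto

lemma mat_mult_index:
  assumes "i < dim_row A" "j < dim_col B" "dim_col A = dim_row B"
  shows "(A * B) $$ (i, j) = (\<Sum>k<dim_row B. A $$ (i, k) * (B :: 'a::semiring_0 mat) $$ (k, j))"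
  using assms by (simp add: scalar_prod_def lessThan_atLeast0)

lemma mat_minus_self_eq_0_iff:
  "dim_row A = n \<Longrightarrow> dim_col A = m \<Longrightarrow> dim_row B = n \<Longrightarrow> dim_col B = m \<Longrightarrow>
    A - B = 0\<^sub>m n m \<longleftrightarrow> A = (B :: 'a::ab_group_add mat)"
  by (auto simp: mat_eq_iff)

lemma mat_pow_dims[simp]:
  "dim_row A = n \<Longrightarrow> dim_col A = n \<Longrightarrow> dim_row (A ^\<^sub>m k) = n"
  "dim_row A = n \<Longrightarrow> dim_col A = n \<Longrightarrow> dim_col (A ^\<^sub>m k) = n"
  by (induction k) auto

lemma mat_pow_Suc_left:
  assumes "dim_row A = n" "dim_col A = n"
  shows "A ^\<^sub>m Suc k = A * A ^\<^sub>m k"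
proof (induction k)
  case 0
  then show ?case using assms by simp
next
  case (Suc k)
  have "A ^\<^sub>m Suc (Suc k) = (A * A ^\<^sub>m k) * A" using Suc by simp
  also have "\<dots> = A * A ^\<^sub>m Suc k" using assms by (simp add: mat_mult_assoc)
  finally show ?case .
qed

lemma mat_pow_add:
  assumes "dim_row A = n" "dim_col A = n"
  shows "A ^\<^sub>m (j + k) = A ^\<^sub>m j * A ^\<^sub>m k"
  using assms by (induction k) (simp_all add: mat_mult_assoc)

text \<open>Gaussian elimination with one pivot at a time: subtracting A E A clears the row of the
  pivot and revives no zero row, so the number of nonzero rows drops. Such a B replaces bases of
  kernel and image: A B is a projection onto the image of A, and 1 - B A is one onto its
  kernel.\<close>

lemma ginverse_exists:
  fixes A :: "'k::field mat"
  shows "\<exists>B. dim_row B = dim_col A \<and> dim_col B = dim_row A \<and> A * (B * A) = A"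
proof (induction "card {i. i < dim_row A \<and> (\<exists>j<dim_col A. A $$ (i, j) \<noteq> 0)}"
    arbitrary: A rule: less_induct)
  case less
  define n m where nm: "n = dim_row A" "m = dim_col A"
  show ?case
  proof (cases "\<exists>i<n. \<exists>j<m. A $$ (i, j) \<noteq> 0")
    case False
    then have "A = 0\<^sub>m n m" by (auto simp: nm mat_eq_iff)
    then show ?thesis by (intro exI[of _ "0\<^sub>m m n"]) (simp add: nm)
  next
    case True
    then obtain i j where ij: "i < n" "j < m" "A $$ (i, j) \<noteq> 0" by blast
    \<comment> \<open>The inverse of the pivot in transposed position, so that E A E = E and A E A
      has rank one and the same row i as A.\<close>
    define E where "E = mat m n (\<lambda>(r, c). if r = j \<and> c = i then 1 / A $$ (i, j) else 0)"
    define A' where "A' = A - A * (E * A)"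
    have dE: "dim_row E = m" "dim_col E = n" by (auto simp: E_def)
    have dA': "dim_row A' = n" "dim_col A' = m" by (auto simp: A'_def nm dE)
    have EA: "(E * A) $$ (r, c) = (if r = j then A $$ (i, c) / A $$ (i, j) else 0)"
      if "r < m" "c < m" for r c
    proof -
      have "(E * A) $$ (r, c) = (\<Sum>k<n. E $$ (r, k) * A $$ (k, c))"
        using that by (subst mat_mult_index) (auto simp: dE nm)
      also have "\<dots> = (\<Sum>k<n. if k = i then (if r = j then A $$ (i, c) / A $$ (i, j) else 0) else 0)"
        by (rule sum.cong) (use that in \<open>auto simp: E_def\<close>)
      finally show ?thesis using ij by simp
    qed
    have AEA: "(A * (E * A)) $$ (r, c) = A $$ (r, j) * A $$ (i, c) / A $$ (i, j)"
      if "r < n" "c < m" for r c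
    proof -
      have "(A * (E * A)) $$ (r, c) = (\<Sum>k<m. A $$ (r, k) * (E * A) $$ (k, c))"
        using that by (subst mat_mult_index) (auto simp: dE nm simp del: index_mult_mat(1))
      also have "\<dots> = (\<Sum>k<m. if k = j then A $$ (r, j) * A $$ (i, c) / A $$ (i, j) else 0)"
        by (rule sum.cong) (use that in \<open>auto simp: EA simp del: index_mult_mat(1)\<close>)
      finally show ?thesis using ij by simp
    qed
    have A': "A' $$ (r, c) = A $$ (r, c) - A $$ (r, j) * A $$ (i, c) / A $$ (i, j)"
      if "r < n" "c < m" for r c
      using that by (simp add: A'_def nm dE AEA[unfolded nm] del: index_mult_mat(1))
    have "{r. r < n \<and> (\<exists>c<m. A' $$ (r, c) \<noteq> 0)} \<subset> {r. r < n \<and> (\<exists>c<m. A $$ (r, c) \<noteq> 0)}"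
    proof
      show "{r. r < n \<and> (\<exists>c<m. A' $$ (r, c) \<noteq> 0)} \<subseteq> {r. r < n \<and> (\<exists>c<m. A $$ (r, c) \<noteq> 0)}"
      proof
        fix r assume "r \<in> {r. r < n \<and> (\<exists>c<m. A' $$ (r, c) \<noteq> 0)}"
        then obtain c where rc: "r < n" "c < m" "A' $$ (r, c) \<noteq> 0" by blast
        then have "A $$ (r, c) \<noteq> 0 \<or> A $$ (r, j) \<noteq> 0" by (auto simp: A')
        then show "r \<in> {r. r < n \<and> (\<exists>c<m. A $$ (r, c) \<noteq> 0)}" using rc ij by blast
      qed
      have "i \<notin> {r. r < n \<and> (\<exists>c<m. A' $$ (r, c) \<noteq> 0)}" using ij by (auto simp: A')
      moreover have "i \<in> {r. r < n \<and> (\<exists>c<m. A $$ (r, c) \<noteq> 0)}" using ij by blast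
      ultimately show "{r. r < n \<and> (\<exists>c<m. A' $$ (r, c) \<noteq> 0)} \<noteq> {r. r < n \<and> (\<exists>c<m. A $$ (r, c) \<noteq> 0)}"
        by blast
    qed
    then have "card {r. r < dim_row A' \<and> (\<exists>c<dim_col A'. A' $$ (r, c) \<noteq> 0)}
        < card {r. r < dim_row A \<and> (\<exists>c<dim_col A. A $$ (r, c) \<noteq> 0)}"
      unfolding dA' nm[symmetric] by (intro psubset_card_mono) auto
    from less[OF this] obtain B where B: "dim_row B = m" "dim_col B = n" "A' * (B * A') = A'"
      using dA' by auto
    \<comment> \<open>Both A (1 - E A) and (1 - A E) A equal \<open>A'\<close>, so A C A is
      \<open>A' * (B * A')\<close> plus A E A, which is \<open>A'\<close> + A E A = A.\<close>
    define C where "C = (1\<^sub>m m - E * A) * (B * (1\<^sub>m n - A * E)) + E"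
    have 1: "A * (1\<^sub>m m - E * A) = A'"
      by (simp add: mat_mult_minus dE nm A'_def)
    have 2: "(1\<^sub>m n - A * E) * A = A'"
      by (simp add: mat_minus_mult dE nm A'_def mat_mult_assoc)
    have "A * ((1\<^sub>m m - E * A) * (B * (1\<^sub>m n - A * E))) * A
        = (A * (1\<^sub>m m - E * A)) * (B * ((1\<^sub>m n - A * E) * A))"
      by (simp add: mat_mult_assoc B dE nm[symmetric])
    then have 3: "A * ((1\<^sub>m m - E * A) * (B * (1\<^sub>m n - A * E))) * A = A'"
      by (simp only: 1 2 B)
    have "A * (C * A) = A * ((1\<^sub>m m - E * A) * (B * (1\<^sub>m n - A * E))) * A + A * (E * A)"
      by (simp add: C_def mat_mult_assoc mat_add_mult mat_mult_add B dE nm[symmetric])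
    also have "\<dots> = A' + A * (E * A)" by (simp only: 3)
    also have "\<dots> = A"
      by (rule eq_matI) (auto simp: A'_def dE nm)
    finally show ?thesis
      by (intro exI[of _ C]) (simp add: C_def B dE nm[symmetric])
  qed
qed

section \<open>Traces and finite sums of matrices\<close>

definition mtrace :: "'k::comm_ring_1 mat \<Rightarrow> 'k" where
  "mtrace A = (\<Sum>i<dim_row A. A $$ (i, i))"

lemma mtrace_add:
  "dim_row A = n \<Longrightarrow> dim_col A = n \<Longrightarrow> dim_row B = n \<Longrightarrow> dim_col B = n \<Longrightarrow>
    mtrace (A + B) = mtrace A + mtrace B"
  by (simp add: mtrace_def sum.distrib)

lemma mtrace_minus:
  "dim_row A = n \<Longrightarrow> dim_col A = n \<Longrightarrow> dim_row B = n \<Longrightarrow> dim_col B = n \<Longrightarrow>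
    mtrace (A - B) = mtrace A - mtrace B"
  by (simp add: mtrace_def sum_subtractf)

lemma mtrace_uminus: "dim_col A = dim_row A \<Longrightarrow> mtrace (- A) = - mtrace A"
  by (simp add: mtrace_def sum_negf)

lemma mtrace_zero[simp]: "mtrace (0\<^sub>m n n) = 0"
  by (simp add: mtrace_def)

lemma mtrace_comm:
  assumes "dim_row A = dim_col B" "dim_col A = dim_row B"
  shows "mtrace (A * B) = mtrace (B * A)"
proof -
  have "mtrace (A * B) = (\<Sum>i<dim_row A. \<Sum>k<dim_row B. A $$ (i, k) * B $$ (k, i))"
    unfolding mtrace_def using assms
    by (intro sum.cong) (auto simp: mat_mult_index simp del: index_mult_mat(1))
  also have "\<dots> = (\<Sum>k<dim_row B. \<Sum>i<dim_row A. B $$ (k, i) * A $$ (i, k))"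
    by (subst sum.swap) (simp add: mult.commute)
  also have "\<dots> = mtrace (B * A)"
    unfolding mtrace_def using assms
    by (intro sum.cong) (auto simp: mat_mult_index simp del: index_mult_mat(1))
  finally show ?thesis .
qed

text \<open>Pairing with a matrix unit reads off one entry. Below this turns matrix identities into
  trace identities, where factors may be moved around cyclically.\<close>

lemma mtrace_nondegenerate:
  fixes Z :: "'k::field mat"
  assumes Z: "dim_row Z = n" "dim_col Z = m"
    and tr: "\<And>W. dim_row W = m \<Longrightarrow> dim_col W = n \<Longrightarrow> mtrace (W * Z) = 0"
  shows "Z = 0\<^sub>m n m"
proof (rule eq_matI)
  fix i j assume "i < dim_row (0\<^sub>m n m)" "j < dim_col (0\<^sub>m n m)"
  then have ij: "i < n" "j < m" by auto
  define W where "W = mat m n (\<lambda>(r, c). if r = j \<and> c = i then 1 else 0 :: 'k)"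
  have "(W * Z) $$ (r, r) = (if r = j then Z $$ (i, j) else 0)" if "r < m" for r
  proof -
    have "(W * Z) $$ (r, r) = (\<Sum>k<n. W $$ (r, k) * Z $$ (k, r))"
      using that Z by (subst mat_mult_index) (auto simp: W_def)
    also have "\<dots> = (\<Sum>k<n. if k = i then (if r = j then Z $$ (i, j) else 0) else 0)"
      by (rule sum.cong) (use that in \<open>auto simp: W_def\<close>)
    finally show ?thesis using ij by simp
  qed
  then have "mtrace (W * Z) = (\<Sum>r<m. if r = j then Z $$ (i, j) else 0)"
    unfolding mtrace_def by (intro sum.cong) (auto simp: W_def simp del: index_mult_mat(1))
  also have "\<dots> = Z $$ (i, j)" using ij by simp
  finally show "Z $$ (i, j) = 0\<^sub>m n m $$ (i, j)"
    using tr[of W] ij by (simp add: W_def)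
qed (use Z in auto)

text \<open>With \<open>\<pi>\<^sub>i\<close> a projection onto the image of \<open>b^i\<close>, the traces of the \<open>b \<pi>\<^sub>i\<close> all agree.\<close>

lemma mtrace_nilpotent:
  fixes b :: "'k::field mat"
  assumes b: "dim_row b = n" "dim_col b = n" and nil: "b ^\<^sub>m k = 0\<^sub>m n n"
  shows "mtrace b = 0"
proof -
  define q where "q i = (SOME B. dim_row B = n \<and> dim_col B = n \<and> b ^\<^sub>m i * (B * b ^\<^sub>m i) = b ^\<^sub>m i)" for i
  have q: "dim_row (q i) = n \<and> dim_col (q i) = n \<and> b ^\<^sub>m i * (q i * b ^\<^sub>m i) = b ^\<^sub>m i" for i
    unfolding q_def by (rule someI_ex) (use ginverse_exists[of "b ^\<^sub>m i"] b mat_pow_dims[OF b, of i] in metis)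
  have d[simp]: "dim_row (q i) = n" "dim_col (q i) = n" "dim_row b = n" "dim_col b = n" for i
    using q b by auto
  \<comment> \<open>With \<open>\<pi>\<^sub>i\<close> = \<open>b ^\<^sub>m i * q i\<close>, fact 1
    is \<open>\<pi>\<^sub>i\<^sub>+\<^sub>1 b \<pi>\<^sub>i = b \<pi>\<^sub>i\<close>, because b
    takes the image of b^i into that of b^(i+1); fact 2 is \<open>\<pi>\<^sub>i
    \<pi>\<^sub>i\<^sub>+\<^sub>1 = \<pi>\<^sub>i\<^sub>+\<^sub>1\<close>, because the images
    decrease. Cyclicity of the trace leads from one to the other.\<close>
  have step: "mtrace (b * (b ^\<^sub>m i * q i)) = mtrace (b * (b ^\<^sub>m Suc i * q (Suc i)))" for i
  proof -
    let ?p = "b ^\<^sub>m i" and ?p' = "b ^\<^sub>m Suc i" and ?q = "q i" and ?q' = "q (Suc i)"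
    have bp: "b * ?p = ?p'" by (rule mat_pow_Suc_left[symmetric]) auto
    have 1: "(?p' * ?q') * (b * (?p * ?q)) = b * (?p * ?q)"
    proof -
      have "(?p' * ?q') * (b * (?p * ?q)) = (?p' * (?q' * (b * ?p))) * ?q"
        by (simp add: mat_mult_assoc)
      also have "\<dots> = (b * ?p) * ?q" unfolding bp using q by (simp only:)
      also have "\<dots> = b * (?p * ?q)" by (simp add: mat_mult_assoc)
      finally show ?thesis .
    qed
    have 2: "(?p * ?q) * (?p' * ?q') = ?p' * ?q'"
    proof -
      have "(?p * ?q) * (?p' * ?q') = (?p * (?q * ?p)) * (b * ?q')"
        by (simp add: mat_mult_assoc)
      also have "\<dots> = ?p * (b * ?q')" using q by (simp only:)
      also have "\<dots> = ?p' * ?q'" by (simp add: mat_mult_assoc)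
      finally show ?thesis .
    qed
    have "mtrace (b * (?p * ?q)) = mtrace (((?p' * ?q') * b) * (?p * ?q))"
      by (subst 1[symmetric]) (simp add: mat_mult_assoc)
    also have "\<dots> = mtrace ((?p * ?q) * ((?p' * ?q') * b))"
      by (rule mtrace_comm) auto
    also have "\<dots> = mtrace (((?p * ?q) * (?p' * ?q')) * b)" by (simp add: mat_mult_assoc)
    also have "\<dots> = mtrace (b * (?p' * ?q'))" unfolding 2 by (rule mtrace_comm) auto
    finally show ?thesis .
  qed
  have "mtrace (b * (b ^\<^sub>m 0 * q 0)) = mtrace (b * (b ^\<^sub>m i * q i))" for i
    by (induction i) (use step in simp_all)
  moreover have "b * (b ^\<^sub>m 0 * q 0) = b" using q[of 0] by simp
  moreover have "b * (b ^\<^sub>m k * q k) = 0\<^sub>m n n" by (simp add: nil)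
  ultimately show ?thesis by (metis mtrace_zero)
qed

text \<open>Matrices of all sizes form one type and have no common zero. The dimensions are
  therefore arguments, which also gives the empty sum a size.\<close>

definition msum :: "nat \<Rightarrow> nat \<Rightarrow> ('i \<Rightarrow> 'k::comm_ring_1 mat) \<Rightarrow> 'i set \<Rightarrow> 'k mat" where
  "msum n m f S = mat n m (\<lambda>ij. \<Sum>s\<in>S. f s $$ ij)"

lemma msum_dims[simp]: "dim_row (msum n m f S) = n" "dim_col (msum n m f S) = m"
  by (simp_all add: msum_def)

lemma msum_index[simp]: "i < n \<Longrightarrow> j < m \<Longrightarrow> msum n m f S $$ (i, j) = (\<Sum>s\<in>S. f s $$ (i, j))"
  by (simp add: msum_def)

lemma msum_cong: "S = T \<Longrightarrow> (\<And>s. s \<in> T \<Longrightarrow> f s = g s) \<Longrightarrow> msum n m f S = msum n m g T"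
  by (simp add: msum_def)

lemma mult_msum:
  assumes "dim_col A = n" "\<And>s. s \<in> S \<Longrightarrow> dim_row (f s) = n \<and> dim_col (f s) = m"
  shows "A * msum n m f S = msum (dim_row A) m (\<lambda>s. A * f s) S"
proof (rule eq_matI)
  fix i j assume "i < dim_row (msum (dim_row A) m (\<lambda>s. A * f s) S)"
    "j < dim_col (msum (dim_row A) m (\<lambda>s. A * f s) S)"
  then have ij: "i < dim_row A" "j < m" by auto
  have "(A * msum n m f S) $$ (i, j) = (\<Sum>k<n. \<Sum>s\<in>S. A $$ (i, k) * f s $$ (k, j))"
    using ij assms(1) by (subst mat_mult_index) (auto simp: sum_distrib_left)
  also have "\<dots> = (\<Sum>s\<in>S. \<Sum>k<n. A $$ (i, k) * f s $$ (k, j))" by (rule sum.swap)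
  also have "\<dots> = (\<Sum>s\<in>S. (A * f s) $$ (i, j))"
    using ij assms by (intro sum.cong refl) (subst mat_mult_index, auto)
  finally show "(A * msum n m f S) $$ (i, j) = msum (dim_row A) m (\<lambda>s. A * f s) S $$ (i, j)"
    using ij by simp
qed auto

lemma msum_mult:
  assumes "dim_row B = m" "\<And>s. s \<in> S \<Longrightarrow> dim_row (f s) = n \<and> dim_col (f s) = m"
  shows "msum n m f S * B = msum n (dim_col B) (\<lambda>s. f s * B) S"
proof (rule eq_matI)
  fix i j assume "i < dim_row (msum n (dim_col B) (\<lambda>s. f s * B) S)"
    "j < dim_col (msum n (dim_col B) (\<lambda>s. f s * B) S)"
  then have ij: "i < n" "j < dim_col B" by auto
  have "(msum n m f S * B) $$ (i, j) = (\<Sum>k<m. \<Sum>s\<in>S. f s $$ (i, k) * B $$ (k, j))"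
    using ij assms(1) by (subst mat_mult_index) (auto simp: sum_distrib_right)
  also have "\<dots> = (\<Sum>s\<in>S. \<Sum>k<m. f s $$ (i, k) * B $$ (k, j))" by (rule sum.swap)
  also have "\<dots> = (\<Sum>s\<in>S. (f s * B) $$ (i, j))"
    using ij assms by (intro sum.cong refl) (subst mat_mult_index, auto)
  finally show "(msum n m f S * B) $$ (i, j) = msum n (dim_col B) (\<lambda>s. f s * B) S $$ (i, j)"
    using ij by simp
qed auto

lemma msum_reindex:
  assumes "bij_betw h S T"
  shows "msum n m f T = msum n m (\<lambda>s. f (h s)) S"
  unfolding msum_def
  by (rule cong_mat) (auto intro: sum.reindex_bij_betw[OF assms, symmetric])

lemma mtrace_msum:
  assumes "\<And>s. s \<in> S \<Longrightarrow> dim_row (f s) = n"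
  shows "mtrace (msum n n f S) = (\<Sum>s\<in>S. mtrace (f s))"
proof -
  have "mtrace (msum n n f S) = (\<Sum>s\<in>S. \<Sum>i<n. f s $$ (i, i))"
    unfolding mtrace_def by (simp, rule sum.swap)
  then show ?thesis using assms by (simp add: mtrace_def)
qed

lemma msum_add:
  assumes "\<And>s. s \<in> S \<Longrightarrow> dim_row (f s) = n \<and> dim_col (f s) = m \<and> dim_row (g s) = n \<and> dim_col (g s) = m"
  shows "msum n m (\<lambda>s. f s + g s) S = msum n m f S + msum n m g S"
  by (rule eq_matI) (auto simp: sum.distrib[symmetric] assms intro!: sum.cong)

lemma msum_const:
  assumes "dim_row A = n" "dim_col A = m"
  shows "msum n m (\<lambda>s. A) S = of_nat (card S) \<cdot>\<^sub>m A"
  using assms by (intro eq_matI) auto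

section \<open>Polynomials in a matrix\<close>

text \<open>Horner evaluation. It is spelled out with the unit matrix of the size of a, because
  matrices of varying size do not form a ring in which \<open>poly\<close> could be
  evaluated.\<close>

definition peval :: "'k::field mat \<Rightarrow> 'k poly \<Rightarrow> 'k mat" where
  "peval a q = fold_coeffs (\<lambda>c X. c \<cdot>\<^sub>m 1\<^sub>m (dim_row a) + a * X) q (0\<^sub>m (dim_row a) (dim_row a))"

lemma peval_0[simp]: "peval a 0 = 0\<^sub>m (dim_row a) (dim_row a)"
  by (simp add: peval_def)

lemma peval_pCons:
  assumes "dim_col a = dim_row a"
  shows "peval a (pCons c q) = c \<cdot>\<^sub>m 1\<^sub>m (dim_row a) + a * peval a q"
proof (cases "c = 0 \<and> q = 0")
  case True
  then show ?thesis using assms by (auto simp: intro!: eq_matI)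
next
  case False
  then show ?thesis by (cases "c = 0") (simp_all add: peval_def)
qed

lemma peval_dims[simp]:
  assumes "dim_col a = dim_row a"
  shows "dim_row (peval a q) = dim_row a" "dim_col (peval a q) = dim_row a"
  by (induction q) (simp_all add: peval_pCons assms)

context
  fixes a :: "'k::field mat" and n
  assumes a: "dim_row a = n" "dim_col a = n"
begin

lemma peval_add: "peval a (q + r) = peval a q + peval a r"
proof (induction q r rule: poly_induct2)
  case 0
  then show ?case by (simp add: a)
next
  case (pCons c q d r)
  show ?case
    by (rule eq_matI) (auto simp: peval_pCons a pCons mat_mult_add add.assoc algebra_simps)
qed

lemma peval_smult: "peval a (Polynomial.smult c q) = c \<cdot>\<^sub>m peval a q"
proof (induction q)
  case 0
  then show ?case by (simp add: a)
next
  case (pCons d q)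
  have "a * (c \<cdot>\<^sub>m peval a q) = c \<cdot>\<^sub>m (a * peval a q)"
    by (simp add: mat_mult_smult a)
  then show ?case
    by (intro eq_matI) (auto simp: peval_pCons a pCons algebra_simps)
qed

lemma peval_mult: "peval a (q * r) = peval a q * peval a r"
proof (induction q)
  case 0
  then show ?case by (simp add: a)
next
  case (pCons c q)
  have "(c \<cdot>\<^sub>m 1\<^sub>m n) * peval a r = c \<cdot>\<^sub>m (1\<^sub>m n * peval a r)"
    by (simp add: mat_smult_mult a)
  moreover have "0 \<cdot>\<^sub>m 1\<^sub>m n + a * (peval a q * peval a r) = a * (peval a q * peval a r)"
    by (rule eq_matI) (auto simp: a)
  ultimately show ?case
    by (simp add: peval_pCons a pCons mat_add_mult mat_mult_assoc peval_add peval_smult)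
qed

lemma peval_1: "peval a 1 = 1\<^sub>m n"
  by (rule eq_matI) (auto simp: one_pCons peval_pCons a)

lemma peval_X: "peval a [:0, 1:] = a"
  by (rule eq_matI) (auto simp: peval_pCons a mat_mult_add)

lemma peval_diff: "peval a (q - r) = peval a q - peval a r"
proof -
  have "peval a (q - r) = peval a (q + Polynomial.smult (-1) r)" by simp
  also have "\<dots> = peval a q - peval a r"
    unfolding peval_add peval_smult by (rule eq_matI) (auto simp: a)
  finally show ?thesis .
qed

lemma peval_power: "peval a (q ^ k) = peval a q ^\<^sub>m k"
proof (induction k)
  case 0
  then show ?case by (simp add: peval_1 a)
next
  case (Suc k)
  have "peval a (q ^ Suc k) = peval a (q ^ k * q)" by (simp only: power_Suc2)
  then show ?case using Suc by (simp add: peval_mult)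
qed

lemma peval_index_sum_monom:
  assumes "finite S" "r < n" "c < n"
  shows "peval a (\<Sum>i\<in>S. Polynomial.monom (f i) i) $$ (r, c) = (\<Sum>i\<in>S. f i * (a ^\<^sub>m i) $$ (r, c))"
  using assms(1)
proof induction
  case empty
  then show ?case using assms by (simp add: a)
next
  case (insert x F)
  have "Polynomial.monom (f x) x = Polynomial.smult (f x) ([:0, 1:] ^ x)"
    by (rule monom_altdef)
  then have "peval a (Polynomial.monom (f x) x) = f x \<cdot>\<^sub>m (a ^\<^sub>m x)"
    by (simp only: peval_smult peval_power peval_X)
  then show ?case using insert assms by (simp add: peval_add a)
qed

text \<open>The n * n + 1 powers of a with exponents up to n * n are linearly dependent in a space
  of dimension n * n.\<close>

lemma annihilator_exists: "\<exists>\<mu>. \<mu> \<noteq> 0 \<and> peval a \<mu> = 0\<^sub>m n n"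
proof -
  define N where "N = n * n"
  \<comment> \<open>Column i lists the entries of a^i. The additional last row is zero: it makes the
    matrix square and singular, so a kernel vector supplies the coefficients of the
    relation.\<close>
  define X where "X = mat (Suc N) (Suc N)
     (\<lambda>(l, i). if l < N then (a ^\<^sub>m i) $$ (l div n, l mod n) else 0)"
  have X: "X \<in> carrier_mat (Suc N) (Suc N)" by (simp add: X_def)
  have "det X = 0"
    by (subst laplace_expansion_row[OF X, of N]) (simp_all add: X_def)
  then obtain v where v: "v \<in> carrier_vec (Suc N)" "v \<noteq> 0\<^sub>v (Suc N)" "X *\<^sub>v v = 0\<^sub>v (Suc N)"
    using det_0_iff_vec_prod_zero_field[OF X] by blast
  define \<mu> where "\<mu> = (\<Sum>i<Suc N. Polynomial.monom (v $ i) i)"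
  have coeff: "Polynomial.coeff \<mu> i = (if i < Suc N then v $ i else 0)" for i
    unfolding \<mu>_def coeff_sum coeff_monom by simp
  obtain i where "i < Suc N" "v $ i \<noteq> 0" using v(1,2)
    by (metis carrier_vecD eq_vecI index_zero_vec(1) index_zero_vec(2))
  then have "\<mu> \<noteq> 0" using coeff[of i] by auto
  moreover have "peval a \<mu> = 0\<^sub>m n n"
  proof (rule eq_matI)
    fix r c assume "r < dim_row (0\<^sub>m n n)" "c < dim_col (0\<^sub>m n n)"
    then have rc: "r < n" "c < n" by auto
    define l where "l = r * n + c"
    have "l < (r + 1) * n" using rc by (simp add: l_def)
    also have "\<dots> \<le> N" unfolding N_def using rc by (intro mult_right_mono) auto
    finally have l: "l < N" .
    have ll: "l div n = r" "l mod n = c" using rc by (auto simp: l_def)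
    have "0 = (X *\<^sub>v v) $ l" using v l by simp
    also have "\<dots> = (\<Sum>i<Suc N. X $$ (l, i) * v $ i)"
      using l v(1) X by (simp add: scalar_prod_def lessThan_atLeast0)
    also have "\<dots> = (\<Sum>i<Suc N. v $ i * (a ^\<^sub>m i) $$ (r, c))"
      by (rule sum.cong) (use l ll in \<open>auto simp: X_def\<close>)
    also have "\<dots> = peval a \<mu> $$ (r, c)"
      unfolding \<mu>_def by (rule peval_index_sum_monom[symmetric]) (use rc in auto)
    finally show "peval a \<mu> $$ (r, c) = 0\<^sub>m n n $$ (r, c)" using rc by simp
  qed (auto simp: a)
  ultimately show ?thesis by blast
qed

text \<open>Fitting decomposition in polynomial form. Splitting the highest power of X off an
  annihilating polynomial leaves a factor with nonzero constant term, and dividing by that constant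
  brings it into the form 1 - X r.\<close>

lemma power_stabilizes: "\<exists>m r. peval a ([:0, 1:] ^ m * (1 - [:0, 1:] * r)) = 0\<^sub>m n n"
proof -
  obtain \<mu> where \<mu>: "\<mu> \<noteq> 0" "peval a \<mu> = 0\<^sub>m n n" using annihilator_exists by blast
  obtain q where q: "\<mu> = [:-0, 1:] ^ order 0 \<mu> * q" "\<not> [:-0, 1:] dvd q"
    using order_decomp[OF \<mu>(1), of 0] by blast
  obtain c q' where cq: "q = pCons c q'" by (cases q)
  have "c \<noteq> 0" using q(2) cq by (auto simp: dvd_def)
  define r where "r = - Polynomial.smult (inverse c) q'"
  have "1 - [:0, 1:] * r = Polynomial.smult (inverse c) q"
    using \<open>c \<noteq> 0\<close> by (simp add: cq r_def one_pCons)
  then have "[:0, 1:] ^ order 0 \<mu> * (1 - [:0, 1:] * r) = Polynomial.smult (inverse c) \<mu>"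
    by (subst (2) q(1)) simp
  then have "peval a ([:0, 1:] ^ order 0 \<mu> * (1 - [:0, 1:] * r)) = 0\<^sub>m n n"
    using \<mu>(2) by (simp add: peval_smult)
  then show ?thesis by blast
qed

end

lemma peval_intertwine:
  assumes a: "dim_row a = n" "dim_col a = n" and b: "dim_row b = m" "dim_col b = m"
    and B: "dim_row B = m" "dim_col B = n" and eq: "B * a = b * B"
  shows "B * peval a q = peval b q * B"
proof (induction q)
  case 0
  then show ?case using a b B by simp
next
  case (pCons c q)
  have "B * (c \<cdot>\<^sub>m 1\<^sub>m n) = c \<cdot>\<^sub>m B" "(c \<cdot>\<^sub>m 1\<^sub>m m) * B = c \<cdot>\<^sub>m B"
    using B by (simp_all add: mat_mult_smult mat_smult_mult)
  moreover have "B * (a * peval a q) = b * (peval b q * B)"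
  proof -
    have "B * (a * peval a q) = (B * a) * peval a q" using a b B by (simp add: mat_mult_assoc)
    also have "\<dots> = b * (B * peval a q)" unfolding eq using a b B by (simp add: mat_mult_assoc)
    finally show ?thesis by (simp only: pCons)
  qed
  moreover have "B * peval a (pCons c q) = B * (c \<cdot>\<^sub>m 1\<^sub>m n) + B * (a * peval a q)"
    using a b B by (simp add: peval_pCons mat_mult_add)
  moreover have "peval b (pCons c q) * B = (c \<cdot>\<^sub>m 1\<^sub>m m) * B + b * (peval b q * B)"
    using a b B by (simp add: peval_pCons mat_add_mult mat_mult_assoc)
  ultimately show ?case by simp
qed

section \<open>Kronecker products\<close>

lemma sum_lessThan_times: "(\<Sum>l<a * b. f l) = (\<Sum>i<a. \<Sum>j<b. f (i * b + j))" for f :: "nat \<Rightarrow> 'a::comm_monoid_add"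
proof -
  have "(\<Sum>l<a * b. f l) = (\<Sum>i<a. sum f {i * b..<i * b + b})" by (rule sum.nat_group[symmetric])
  also have "\<dots> = (\<Sum>i<a. \<Sum>j<b. f (i * b + j))"
  proof (rule sum.cong[OF refl])
    show "sum f {i * b..<i * b + b} = (\<Sum>j<b. f (i * b + j))" for i
      using sum.shift_bounds_nat_ivl[of f 0 "i * b" b] by (simp add: lessThan_atLeast0 add.commute)
  qed
  finally show ?thesis .
qed

lemma block_index_less: "i < a \<Longrightarrow> j < b \<Longrightarrow> i * b + j < a * (b :: nat)"
proof -
  assume "i < a" "j < b"
  then have "i * b + j < Suc i * b" "Suc i * b \<le> a * b" by (simp_all only: mult_le_mono1 Suc_leI) simp
  then show ?thesis by simp
qed

lemma block_indexE:
  assumes "l < a * (b :: nat)"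
  obtains i j where "i < a" "j < b" "l = i * b + j"
proof
  have "b > 0" using assms by (cases b) auto
  then show "l mod b < b" by simp
  show "l div b < a" using assms by (simp add: less_mult_imp_div_less)
  show "l = l div b * b + l mod b" by simp
qed

lemma kronecker_dims[simp]:
  "dim_row (kronecker A B) = dim_row A * dim_row B"
  "dim_col (kronecker A B) = dim_col A * dim_col B"
  by (simp_all add: kronecker_def)

lemma kronecker_index:
  assumes "i < dim_row A" "j < dim_col A" "k < dim_row B" "l < dim_col B"
  shows "kronecker A B $$ (i * dim_row B + k, j * dim_col B + l) = A $$ (i, j) * B $$ (k, l)"
  using assms by (simp add: kronecker_def block_index_less)

lemma eq_blockI:
  assumes "dim_row X = a * b" "dim_row Y = a * b" "dim_col X = c * d" "dim_col Y = c * d"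
    and "\<And>i j k l. i < a \<Longrightarrow> j < c \<Longrightarrow> k < b \<Longrightarrow> l < d \<Longrightarrow> X $$ (i * b + k, j * d + l) = Y $$ (i * b + k, j * d + l)"
  shows "X = Y"
proof (rule eq_matI)
  fix r s assume "r < dim_row Y" "s < dim_col Y"
  then obtain i k j l where "i < a" "k < b" "r = i * b + k" "j < c" "l < d" "s = j * d + l"
    using assms by (metis block_indexE)
  then show "X $$ (r, s) = Y $$ (r, s)" using assms(5) by simp
qed (use assms in auto)

lemma kronecker_mult:
  fixes A B C D :: "'k::comm_ring_1 mat"
  assumes AC: "dim_col A = dim_row C" and BD: "dim_col B = dim_row D"
  shows "kronecker A B * kronecker C D = kronecker (A * C) (B * D)"
proof (rule eq_blockI[of _ "dim_row A" "dim_row B" _ "dim_col C" "dim_col D"])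
  fix i j k l
  assume ij: "i < dim_row A" "j < dim_col C" and kl: "k < dim_row B" "l < dim_col D"
  have "(kronecker A B * kronecker C D) $$ (i * dim_row B + k, j * dim_col D + l)
      = (\<Sum>t<dim_row C * dim_row D. kronecker A B $$ (i * dim_row B + k, t) * kronecker C D $$ (t, j * dim_col D + l))"
    using ij kl AC BD by (subst mat_mult_index) (auto simp: block_index_less)
  also have "\<dots> = (\<Sum>s<dim_row C. \<Sum>t<dim_row D. (A $$ (i, s) * C $$ (s, j)) * (B $$ (k, t) * D $$ (t, l)))"
    unfolding sum_lessThan_times
  proof (intro sum.cong refl)
    fix s t assume "s \<in> {..<dim_row C}" "t \<in> {..<dim_row D}"
    then show "kronecker A B $$ (i * dim_row B + k, s * dim_row D + t)
        * kronecker C D $$ (s * dim_row D + t, j * dim_col D + l)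
      = (A $$ (i, s) * C $$ (s, j)) * (B $$ (k, t) * D $$ (t, l))"
      using ij kl AC BD kronecker_index[of i A s k B t] kronecker_index[of s C j t D l]
      by (simp add: mult_ac)
  qed
  also have "\<dots> = (\<Sum>s<dim_row C. A $$ (i, s) * C $$ (s, j)) * (\<Sum>t<dim_row D. B $$ (k, t) * D $$ (t, l))"
    by (simp add: sum_product)
  also have "\<dots> = (A * C) $$ (i, j) * (B * D) $$ (k, l)"
    using ij kl AC BD by (simp add: mat_mult_index del: index_mult_mat(1))
  also have "\<dots> = kronecker (A * C) (B * D) $$ (i * dim_row B + k, j * dim_col D + l)"
    using ij kl kronecker_index[of i "A * C" j k "B * D" l] by simp
  finally show "(kronecker A B * kronecker C D) $$ (i * dim_row B + k, j * dim_col D + l)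
    = kronecker (A * C) (B * D) $$ (i * dim_row B + k, j * dim_col D + l)" .
qed auto

lemma kronecker_one: "kronecker (1\<^sub>m a) (1\<^sub>m b) = (1\<^sub>m (a * b) :: 'k::comm_ring_1 mat)"
proof (rule eq_blockI[of _ a b _ a b])
  fix i j k l assume b: "i < a" "j < a" "k < b" "l < b"
  have "i * b + k = j * b + l \<longleftrightarrow> i = j \<and> k = l"
  proof
    assume e: "i * b + k = j * b + l"
    from arg_cong[OF e, of "\<lambda>x. x div b"] arg_cong[OF e, of "\<lambda>x. x mod b"] show "i = j \<and> k = l"
      using b by simp
  qed simp
  then show "kronecker (1\<^sub>m a) (1\<^sub>m b) $$ (i * b + k, j * b + l) = (1\<^sub>m (a * b) :: 'k mat) $$ (i * b + k, j * b + l)"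
    using b kronecker_index[of i "1\<^sub>m a :: 'k mat" j k "1\<^sub>m b" l] by (simp add: block_index_less)
qed auto

lemma kronecker_one_left[simp]: "kronecker (1\<^sub>m (Suc 0)) A = (A :: 'k::comm_ring_1 mat)"
  by (rule eq_matI) (auto simp: kronecker_def)

lemma kronecker_minus_left:
  fixes A B C :: "'k::comm_ring_1 mat"
  assumes "dim_row A = dim_row B" "dim_col A = dim_col B"
  shows "kronecker (A - B) C = kronecker A C - kronecker B C"
  by (rule eq_matI) (auto simp: kronecker_def assms algebra_simps less_mult_imp_div_less)

lemma kronecker_minus_right:
  fixes A B C :: "'k::comm_ring_1 mat"
  assumes "dim_row B = dim_row C" "dim_col B = dim_col C"
  shows "kronecker A (B - C) = kronecker A B - kronecker A C"
proof -
  have "i mod dim_row C < dim_row C" if "i < n * dim_row C" for i n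
    using that by (cases "dim_row C = 0") auto
  moreover have "i mod dim_col C < dim_col C" if "i < n * dim_col C" for i n
    using that by (cases "dim_col C = 0") auto
  ultimately show ?thesis
    by (intro eq_matI) (auto simp: kronecker_def assms right_diff_distrib)
qed

lemma kronecker_msum_left:
  fixes f :: "'i \<Rightarrow> 'k::comm_ring_1 mat"
  assumes "\<And>s. s \<in> S \<Longrightarrow> dim_row (f s) = n \<and> dim_col (f s) = m"
  shows "kronecker (msum n m f S) B = msum (n * dim_row B) (m * dim_col B) (\<lambda>s. kronecker (f s) B) S"
proof (rule eq_blockI[of _ n "dim_row B" _ m "dim_col B"])
  fix i j k l assume b: "i < n" "j < m" "k < dim_row B" "l < dim_col B"
  show "kronecker (msum n m f S) B $$ (i * dim_row B + k, j * dim_col B + l) =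
    msum (n * dim_row B) (m * dim_col B) (\<lambda>s. kronecker (f s) B) S $$ (i * dim_row B + k, j * dim_col B + l)"
    using b assms
    by (simp add: kronecker_index block_index_less sum_distrib_right)
qed auto

lemma kronecker_msum_right:
  fixes f :: "'i \<Rightarrow> 'k::comm_ring_1 mat"
  assumes "\<And>s. s \<in> S \<Longrightarrow> dim_row (f s) = n \<and> dim_col (f s) = m"
  shows "kronecker A (msum n m f S) = msum (dim_row A * n) (dim_col A * m) (\<lambda>s. kronecker A (f s)) S"
proof (rule eq_blockI[of _ "dim_row A" n _ "dim_col A" m])
  fix i j k l assume b: "i < dim_row A" "j < dim_col A" "k < n" "l < m"
  have "kronecker A (msum n m f S) $$ (i * n + k, j * m + l) = (\<Sum>s\<in>S. A $$ (i, j) * f s $$ (k, l))"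
    using b kronecker_index[of i A j k "msum n m f S" l] by (simp add: sum_distrib_left)
  also have "\<dots> = (\<Sum>s\<in>S. kronecker A (f s) $$ (i * n + k, j * m + l))"
  proof (rule sum.cong[OF refl])
    fix s assume "s \<in> S"
    then show "A $$ (i, j) * f s $$ (k, l) = kronecker A (f s) $$ (i * n + k, j * m + l)"
      using b assms[of s] kronecker_index[of i A j k "f s" l] by simp
  qed
  finally show "kronecker A (msum n m f S) $$ (i * n + k, j * m + l) =
    msum (dim_row A * n) (dim_col A * m) (\<lambda>s. kronecker A (f s)) S $$ (i * n + k, j * m + l)"
    using b by (simp add: block_index_less)
qed auto

section \<open>Partial traces\<close>

definition partial_trace :: "nat \<Rightarrow> nat \<Rightarrow> nat \<Rightarrow> 'k::comm_ring_1 mat \<Rightarrow> 'k mat" where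
  "partial_trace m n k X = mat m n (\<lambda>(i, j). \<Sum>l<k. X $$ (i * k + l, j * k + l))"

lemma partial_trace_dims[simp]:
  "dim_row (partial_trace m n k X) = m" "dim_col (partial_trace m n k X) = n"
  by (simp_all add: partial_trace_def)

text \<open>For the trace pairing, the partial trace is adjoint to tensoring with an identity.
  Testing f \<otimes> 1 against X is thus testing f against the partial trace of X, which is the
  source of the tensor ideal property of negligible homomorphisms.\<close>

lemma mtrace_partial_trace:
  fixes X f :: "'k::comm_ring_1 mat"
  assumes X: "dim_row X = m * k" "dim_col X = n * k" and f: "dim_row f = n" "dim_col f = m"
  shows "mtrace (partial_trace m n k X * f) = mtrace (X * kronecker f (1\<^sub>m k))"
proof -
  have "(X * kronecker f (1\<^sub>m k)) $$ (i * k + l, i * k + l) = (\<Sum>j<n. X $$ (i * k + l, j * k + l) * f $$ (j, i))"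
    if il: "i < m" "l < k" for i l
  proof -
    have "(X * kronecker f (1\<^sub>m k)) $$ (i * k + l, i * k + l)
        = (\<Sum>t<n * k. X $$ (i * k + l, t) * kronecker f (1\<^sub>m k) $$ (t, i * k + l))"
      using il X f by (subst mat_mult_index) (auto simp: block_index_less)
    also have "\<dots> = (\<Sum>j<n. \<Sum>l'<k. if l' = l then X $$ (i * k + l, j * k + l) * f $$ (j, i) else 0)"
      unfolding sum_lessThan_times
    proof (intro sum.cong refl)
      fix j l' assume "j \<in> {..<n}" "l' \<in> {..<k}"
      then show "X $$ (i * k + l, j * k + l') * kronecker f (1\<^sub>m k) $$ (j * k + l', i * k + l)
        = (if l' = l then X $$ (i * k + l, j * k + l) * f $$ (j, i) else 0)"
        using il f kronecker_index[of j f i l' "1\<^sub>m k" l] by simp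
    qed
    finally show ?thesis using il by simp
  qed
  then have "mtrace (X * kronecker f (1\<^sub>m k)) = (\<Sum>i<m. \<Sum>l<k. \<Sum>j<n. X $$ (i * k + l, j * k + l) * f $$ (j, i))"
    unfolding mtrace_def using X by (simp add: sum_lessThan_times del: index_mult_mat(1))
  also have "\<dots> = (\<Sum>i<m. \<Sum>j<n. \<Sum>l<k. X $$ (i * k + l, j * k + l) * f $$ (j, i))"
    by (intro sum.cong refl sum.swap)
  also have "\<dots> = mtrace (partial_trace m n k X * f)"
    unfolding mtrace_def using f
    by (intro sum.cong) (auto simp: mat_mult_index partial_trace_def sum_distrib_right simp del: index_mult_mat(1))
  finally show ?thesis by simp
qed

text \<open>Paired with any W, both sides give the trace of X (C W B \<otimes> 1), by adjointness,
  cyclicity and V U = 1. With the matrices of a group element and its inverse for B, U and C, V this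
  shows that partial traces of homomorphisms are homomorphisms.\<close>

lemma partial_trace_conj:
  fixes X :: "'k::field mat"
  assumes X: "dim_row X = m * k" "dim_col X = n * k"
    and B: "dim_row B = m" "dim_col B = m" and C: "dim_row C = n" "dim_col C = n"
    and U: "dim_row U = k" "dim_col U = k" and V: "dim_row V = k" "dim_col V = k" and VU: "V * U = 1\<^sub>m k"
  shows "partial_trace m n k (kronecker B U * (X * kronecker C V)) = B * (partial_trace m n k X * C)"
    (is "?L = ?R")
proof -
  have "?L - ?R = 0\<^sub>m m n"
  proof (rule mtrace_nondegenerate)
    fix W :: "'k mat" assume W: "dim_row W = n" "dim_col W = m"
    have "mtrace (W * ?L) = mtrace (?L * W)" by (rule mtrace_comm) (use W in auto)
    also have "\<dots> = mtrace ((kronecker B U * (X * kronecker C V)) * kronecker W (1\<^sub>m k))"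
      by (rule mtrace_partial_trace) (use assms W in auto)
    also have "\<dots> = mtrace (kronecker B U * (X * kronecker C V * kronecker W (1\<^sub>m k)))"
      using assms W by (simp add: mat_mult_assoc)
    also have "\<dots> = mtrace ((X * kronecker C V * kronecker W (1\<^sub>m k)) * kronecker B U)"
      by (rule mtrace_comm) (use assms W in auto)
    also have "\<dots> = mtrace (X * (kronecker C V * kronecker W (1\<^sub>m k) * kronecker B U))"
      using assms W by (simp add: mat_mult_assoc)
    also have "kronecker C V * kronecker W (1\<^sub>m k) * kronecker B U = kronecker (C * W * B) (1\<^sub>m k)"
      using assms W by (simp add: kronecker_mult)
    also have "mtrace (X * kronecker (C * W * B) (1\<^sub>m k)) = mtrace (partial_trace m n k X * (C * W * B))"
      by (rule mtrace_partial_trace[symmetric]) (use assms W in auto)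
    also have "\<dots> = mtrace ((partial_trace m n k X * C * W) * B)"
      using assms W by (simp add: mat_mult_assoc)
    also have "\<dots> = mtrace (B * (partial_trace m n k X * C * W))"
      by (rule mtrace_comm) (use assms W in auto)
    also have "\<dots> = mtrace (?R * W)"
      using assms W by (simp add: mat_mult_assoc)
    also have "\<dots> = mtrace (W * ?R)" by (rule mtrace_comm) (use assms W in auto)
    finally have "mtrace (W * ?L) = mtrace (W * ?R)" .
    then show "mtrace (W * (?L - ?R)) = 0"
      using assms W by (simp add: mat_mult_minus mtrace_minus[of _ n])
  qed (use assms in auto)
  then show ?thesis
    by (subst (asm) mat_minus_self_eq_0_iff) (use assms in auto)
qed

section \<open>Trace maps and projective homomorphisms\<close>

lemma rep_homD:
  assumes "f \<in> rep_hom G M N"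
  shows "dim_row f = fst N" "dim_col f = fst M" "g \<in> carrier G \<Longrightarrow> f * snd M g = snd N g * f"
  using assms by (auto simp: rep_hom_def)

lemma rep_homI:
  assumes "dim_row f = fst N" "dim_col f = fst M" "\<And>g. g \<in> carrier G \<Longrightarrow> f * snd M g = snd N g * f"
  shows "f \<in> rep_hom G M N"
  using assms by (auto simp: rep_hom_def)

text \<open>The index set S is free so that one notion serves three purposes: the trace over G, the
  trace over a subgroup, and, with S a transversal, the relative trace from a subgroup to G.\<close>

definition trace_map ::
    "('g, 'z) monoid_scheme \<Rightarrow> 'g set \<Rightarrow> ('g, 'k::field) rep \<Rightarrow> ('g, 'k) rep \<Rightarrow> 'k mat \<Rightarrow> 'k mat" where
  "trace_map G S M N h = msum (fst N) (fst M) (\<lambda>g. snd N g * (h * snd M (inv\<^bsub>G\<^esub> g))) S"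

lemma trace_map_dims[simp]:
  "dim_row (trace_map G S M N h) = fst N" "dim_col (trace_map G S M N h) = fst M"
  by (simp_all add: trace_map_def)

context group
begin

lemma rep_dims[simp]:
  assumes "is_rep G M" "g \<in> carrier G"
  shows "dim_row (snd M g) = fst M" "dim_col (snd M g) = fst M"
  using assms by (auto simp: is_rep_def)

lemma rep_one: "is_rep G M \<Longrightarrow> snd M \<one> = 1\<^sub>m (fst M)"
  by (simp add: is_rep_def)

lemma rep_mult:
  "is_rep G M \<Longrightarrow> g \<in> carrier G \<Longrightarrow> h \<in> carrier G \<Longrightarrow> snd M (g \<otimes> h) = snd M g * snd M h"
  by (simp add: is_rep_def)

lemma rep_inv:
  assumes "is_rep G M" "g \<in> carrier G"
  shows "snd M g * snd M (inv g) = 1\<^sub>m (fst M)" "snd M (inv g) * snd M g = 1\<^sub>m (fst M)"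
  using assms rep_mult[of M g "inv g"] rep_mult[of M "inv g" g] rep_one[of M] by simp_all

lemma rep_hom_comp:
  assumes "is_rep G M" "is_rep G N" "is_rep G L" "f \<in> rep_hom G M N" "g \<in> rep_hom G N L"
  shows "g * f \<in> rep_hom G M L"
proof (rule rep_homI)
  fix x assume x: "x \<in> carrier G"
  note f = rep_homD[OF assms(4)] and g = rep_homD[OF assms(5)]
  have "g * f * snd M x = g * (f * snd M x)" using f(1,2) g(1,2) x assms by (simp add: mat_mult_assoc)
  also have "\<dots> = (g * snd N x) * f" unfolding f(3)[OF x] using f(1,2) g(1,2) x assms by (simp add: mat_mult_assoc)
  also have "\<dots> = snd L x * (g * f)" unfolding g(3)[OF x] using f(1,2) g(1,2) x assms by (simp add: mat_mult_assoc)
  finally show "g * f * snd M x = snd L x * (g * f)" .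
qed (use rep_homD[OF assms(4)] rep_homD[OF assms(5)] in auto)

lemma rep_hom_one: "is_rep G M \<Longrightarrow> 1\<^sub>m (fst M) \<in> rep_hom G M M"
  by (rule rep_homI) auto

lemma rep_hom_zero: "is_rep G M \<Longrightarrow> is_rep G N \<Longrightarrow> 0\<^sub>m (fst N) (fst M) \<in> rep_hom G M N"
  by (rule rep_homI) auto

lemma rep_hom_add:
  "is_rep G M \<Longrightarrow> is_rep G N \<Longrightarrow> f \<in> rep_hom G M N \<Longrightarrow> g \<in> rep_hom G M N \<Longrightarrow> f + g \<in> rep_hom G M N"
  by (rule rep_homI) (auto simp: rep_homD mat_add_mult mat_mult_add)

lemma rep_hom_minus:
  "is_rep G M \<Longrightarrow> is_rep G N \<Longrightarrow> f \<in> rep_hom G M N \<Longrightarrow> g \<in> rep_hom G M N \<Longrightarrow> f - g \<in> rep_hom G M N"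
  by (rule rep_homI) (auto simp: rep_homD mat_minus_mult mat_mult_minus)

lemma rep_hom_uminus:
  "is_rep G M \<Longrightarrow> is_rep G N \<Longrightarrow> f \<in> rep_hom G M N \<Longrightarrow> - f \<in> rep_hom G M N"
  by (rule rep_homI) (auto simp: rep_homD)

lemma rep_hom_peval:
  "is_rep G M \<Longrightarrow> a \<in> rep_hom G M M \<Longrightarrow> peval a q \<in> rep_hom G M M"
  by (rule rep_homI) (use rep_homD[of a G M M] in \<open>auto intro!: peval_intertwine[symmetric]\<close>)

text \<open>Moving x across the sum replaces the index g by x g. The permutation \<theta> brings x g
  back into S without changing the summand: for S the whole group it is multiplication by x, for a
  transversal it picks the representative of the coset of x g.\<close>

lemma trace_map_commute:
  assumes S: "S \<subseteq> carrier G" and x: "x \<in> carrier G" and M: "is_rep G M" and N: "is_rep G N"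
    and h: "dim_row h = fst N" "dim_col h = fst M"
    and \<theta>: "bij_betw \<theta> S S"
    and inv: "\<And>g. g \<in> S \<Longrightarrow> snd N (\<theta> g) * (h * snd M (inv (\<theta> g))) = snd N (x \<otimes> g) * (h * snd M (inv (x \<otimes> g)))"
  shows "trace_map G S M N h * snd M x = snd N x * trace_map G S M N h"
proof -
  have "trace_map G S M N h * snd M x = msum (fst N) (fst M) (\<lambda>g. snd N g * (h * snd M (inv g)) * snd M x) S"
    unfolding trace_map_def using S x M N h by (subst msum_mult) (auto simp: subset_iff)
  also have "\<dots> = msum (fst N) (fst M) (\<lambda>g. snd N (\<theta> g) * (h * snd M (inv (\<theta> g))) * snd M x) S"
    by (rule msum_reindex[OF \<theta>])
  also have "\<dots> = msum (fst N) (fst M) (\<lambda>g. snd N x * (snd N g * (h * snd M (inv g)))) S"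
  proof (rule msum_cong[OF refl])
    fix g assume gS: "g \<in> S"
    then have g: "g \<in> carrier G" using S by auto
    have "snd M (inv (x \<otimes> g)) * snd M x = snd M (inv (x \<otimes> g) \<otimes> x)"
      by (rule rep_mult[symmetric]) (use x g M in auto)
    also have "inv (x \<otimes> g) \<otimes> x = inv g" using x g by (simp add: inv_mult_group m_assoc)
    finally have e: "snd M (inv (x \<otimes> g)) * snd M x = snd M (inv g)" .
    have "snd N (x \<otimes> g) * (h * snd M (inv (x \<otimes> g))) * snd M x
        = snd N x * (snd N g * (h * (snd M (inv (x \<otimes> g)) * snd M x)))"
      using x g M N h by (simp add: mat_mult_assoc rep_mult[of N])
    then show "snd N (\<theta> g) * (h * snd M (inv (\<theta> g))) * snd M x = snd N x * (snd N g * (h * snd M (inv g)))"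
      unfolding inv[OF gS] by (simp only: e)
  qed
  also have "\<dots> = snd N x * trace_map G S M N h"
    unfolding trace_map_def using S x M N h by (subst mult_msum) (auto simp: subset_iff)
  finally show ?thesis .
qed

lemma trace_map_in_rep_hom:
  assumes fin: "finite (carrier G)" and M: "is_rep G M" and N: "is_rep G N"
    and h: "dim_row h = fst N" "dim_col h = fst M"
  shows "trace_map G (carrier G) M N h \<in> rep_hom G M N"
proof (rule rep_homI)
  fix x assume x: "x \<in> carrier G"
  have "bij_betw (\<lambda>g. x \<otimes> g) (carrier G) (carrier G)"
    using x by (intro bij_betwI[where g = "\<lambda>g. inv x \<otimes> g"]) (auto simp: m_assoc[symmetric])
  from trace_map_commute[OF subset_refl x M N h this]
  show "trace_map G (carrier G) M N h * snd M x = snd N x * trace_map G (carrier G) M N h" by simp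
qed auto

lemma rep_hom_mult_trace_map:
  assumes "is_rep G M" "is_rep G N" "is_rep G L" "S \<subseteq> carrier G" "a \<in> rep_hom G N L"
    "dim_row h = fst N" "dim_col h = fst M"
  shows "a * trace_map G S M N h = trace_map G S M L (a * h)"
proof -
  note a = rep_homD[OF assms(5)]
  have "a * trace_map G S M N h = msum (fst L) (fst M) (\<lambda>g. a * (snd N g * (h * snd M (inv g)))) S"
    unfolding trace_map_def using a assms by (subst mult_msum) (auto simp: subset_iff)
  also have "\<dots> = trace_map G S M L (a * h)"
    unfolding trace_map_def
  proof (rule msum_cong[OF refl])
    fix g assume "g \<in> S"
    then have g: "g \<in> carrier G" using assms by auto
    have "a * (snd N g * (h * snd M (inv g))) = (a * snd N g) * (h * snd M (inv g))"
      using a(1,2) assms g by (simp add: mat_mult_assoc)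
    also have "\<dots> = snd L g * (a * h * snd M (inv g))"
      unfolding a(3)[OF g] using a(1,2) assms g by (simp add: mat_mult_assoc)
    finally show "a * (snd N g * (h * snd M (inv g))) = snd L g * (a * h * snd M (inv g))" .
  qed
  finally show ?thesis .
qed

lemma trace_map_mult_rep_hom:
  assumes "is_rep G M" "is_rep G N" "is_rep G L" "S \<subseteq> carrier G" "a \<in> rep_hom G L M"
    "dim_row h = fst N" "dim_col h = fst M"
  shows "trace_map G S M N h * a = trace_map G S L N (h * a)"
proof -
  note a = rep_homD[OF assms(5)]
  have "trace_map G S M N h * a = msum (fst N) (fst L) (\<lambda>g. snd N g * (h * snd M (inv g)) * a) S"
    unfolding trace_map_def using a assms by (subst msum_mult) (auto simp: subset_iff)
  also have "\<dots> = trace_map G S L N (h * a)"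
    unfolding trace_map_def
  proof (rule msum_cong[OF refl])
    fix g assume "g \<in> S"
    then have g: "g \<in> carrier G" "inv g \<in> carrier G" using assms by auto
    have "snd N g * (h * snd M (inv g)) * a = snd N g * (h * (snd M (inv g) * a))"
      using a(1,2) assms g by (simp add: mat_mult_assoc)
    also have "\<dots> = snd N g * (h * a * snd L (inv g))"
      unfolding a(3)[OF g(2), symmetric] using a(1,2) assms g by (simp add: mat_mult_assoc)
    finally show "snd N g * (h * snd M (inv g)) * a = snd N g * (h * a * snd L (inv g))" .
  qed
  finally show ?thesis .
qed

lemma trace_map_add:
  assumes "is_rep G M" "is_rep G N" "S \<subseteq> carrier G"
    "dim_row h = fst N" "dim_col h = fst M" "dim_row h' = fst N" "dim_col h' = fst M"
  shows "trace_map G S M N (h + h') = trace_map G S M N h + trace_map G S M N h'"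
proof -
  have "trace_map G S M N (h + h') = msum (fst N) (fst M)
      (\<lambda>g. snd N g * (h * snd M (inv g)) + snd N g * (h' * snd M (inv g))) S"
    unfolding trace_map_def
  proof (rule msum_cong[OF refl])
    fix g assume "g \<in> S"
    then have "g \<in> carrier G" using assms by auto
    then show "snd N g * ((h + h') * snd M (inv g)) = snd N g * (h * snd M (inv g)) + snd N g * (h' * snd M (inv g))"
      using assms by (simp add: mat_add_mult mat_mult_add)
  qed
  also have "\<dots> = trace_map G S M N h + trace_map G S M N h'"
    unfolding trace_map_def using assms by (subst msum_add) (auto simp: subset_iff)
  finally show ?thesis .
qed

lemma trace_map_smult:
  assumes "is_rep G M" "is_rep G N" "S \<subseteq> carrier G" "dim_row h = fst N" "dim_col h = fst M"
  shows "trace_map G S M N (c \<cdot>\<^sub>m h) = c \<cdot>\<^sub>m trace_map G S M N h"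
proof (rule eq_matI)
  fix i j assume ij: "i < dim_row (c \<cdot>\<^sub>m trace_map G S M N h)" "j < dim_col (c \<cdot>\<^sub>m trace_map G S M N h)"
  have "snd N g * ((c \<cdot>\<^sub>m h) * snd M (inv g)) = c \<cdot>\<^sub>m (snd N g * (h * snd M (inv g)))" if "g \<in> S" for g
  proof -
    have "g \<in> carrier G" using that assms by auto
    then show ?thesis using assms by (simp add: mat_smult_mult mat_mult_smult)
  qed
  moreover have "dim_row (snd N g) = fst N" "dim_col (snd M (inv g)) = fst M" if "g \<in> S" for g
    using assms that by (auto simp: subset_iff)
  ultimately show "trace_map G S M N (c \<cdot>\<^sub>m h) $$ (i, j) = (c \<cdot>\<^sub>m trace_map G S M N h) $$ (i, j)"
    using ij by (simp add: trace_map_def sum_distrib_left del: index_mult_mat(1))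
qed auto

lemma mtrace_trace_map:
  assumes "is_rep G M" "S \<subseteq> carrier G" "dim_row h = fst M" "dim_col h = fst M"
  shows "mtrace (trace_map G S M M h) = of_nat (card S) * mtrace h"
proof -
  have "mtrace (trace_map G S M M h) = (\<Sum>g\<in>S. mtrace (snd M g * (h * snd M (inv g))))"
    unfolding trace_map_def using assms by (intro mtrace_msum) (auto simp: subset_iff)
  also have "\<dots> = (\<Sum>g\<in>S. mtrace h)"
  proof (rule sum.cong[OF refl])
    fix g assume "g \<in> S"
    then have g: "g \<in> carrier G" using assms by auto
    have "mtrace (snd M g * (h * snd M (inv g))) = mtrace (h * snd M (inv g) * snd M g)"
      by (rule mtrace_comm) (use assms g in auto)
    also have "h * snd M (inv g) * snd M g = h" using assms g by (simp add: mat_mult_assoc rep_inv)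
    finally show "mtrace (snd M g * (h * snd M (inv g))) = mtrace h" .
  qed
  finally show ?thesis by simp
qed

lemma trace_map_rep_hom:
  assumes "is_rep G M" "is_rep G N" "S \<subseteq> carrier G" "f \<in> rep_hom G M N"
  shows "trace_map G S M N f = of_nat (card S) \<cdot>\<^sub>m f"
proof -
  note f = rep_homD[OF assms(4)]
  have "trace_map G S M N f = msum (fst N) (fst M) (\<lambda>g. f) S"
    unfolding trace_map_def
  proof (rule msum_cong[OF refl])
    fix g assume "g \<in> S"
    then have g: "g \<in> carrier G" "inv g \<in> carrier G" using assms by auto
    have "snd N g * (f * snd M (inv g)) = (snd N g * f) * snd M (inv g)"
      using assms f(1,2) g by (simp add: mat_mult_assoc)
    also have "\<dots> = f * (snd M g * snd M (inv g))"
      unfolding f(3)[OF g(1), symmetric] using assms f(1,2) g by (simp add: mat_mult_assoc)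
    finally show "snd N g * (f * snd M (inv g)) = f" using assms f(1,2) g by (simp add: rep_inv)
  qed
  then show ?thesis using f by (simp add: msum_const)
qed

section \<open>Transversals and relative traces\<close>

lemma left_transversal_exists:
  assumes fin: "finite (carrier G)" and H: "subgroup H G"
  shows "\<exists>T\<subseteq>carrier G. card T * card H = Coset.order G \<and> bij_betw (\<lambda>(t, h). t \<otimes> h) (T \<times> H) (carrier G)"
proof -
  have Hs: "H \<subseteq> carrier G" "finite H" using H fin by (auto dest: subgroup.subset intro: finite_subset)
  \<comment> \<open>The choice sees only the coset, so all elements of a coset receive the same
    representative.\<close>
  define r where "r g = (SOME x. x \<in> g <# H)" for g
  define T where "T = r ` carrier G"
  have self: "g \<in> g <# H" if "g \<in> carrier G" for g
    using that subgroup.one_closed[OF H] by (force simp: l_coset_def)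
  have r: "r g \<in> g <# H" if "g \<in> carrier G" for g
    unfolding r_def by (rule someI[of "\<lambda>x. x \<in> g <# H"]) (rule self[OF that])
  have rc: "r g \<in> carrier G" "r g <# H = g <# H" if g: "g \<in> carrier G" for g
  proof -
    obtain h where h: "h \<in> H" "r g = g \<otimes> h" using r[OF g] by (auto simp: l_coset_def)
    then show "r g \<in> carrier G" using g Hs by auto
    show "r g <# H = g <# H" using l_repr_independence[OF r[OF g] g H] by simp
  qed
  have T: "T \<subseteq> carrier G" using rc by (auto simp: T_def)
  have Tr: "r t = t" if "t \<in> T" for t
    using that rc(2) by (auto simp: T_def r_def)
  have inj: "inj_on (\<lambda>(t, h). t \<otimes> h) (T \<times> H)"
  proof (rule inj_onI, clarsimp)
    fix t h t' h' assume a: "t \<in> T" "h \<in> H" "t' \<in> T" "h' \<in> H" "t \<otimes> h = t' \<otimes> h'"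
    have c: "t \<in> carrier G" "t' \<in> carrier G" "h \<in> carrier G" "h' \<in> carrier G" using a T Hs by auto
    have mem: "x \<otimes> y \<in> x <# H" if "y \<in> H" for x y using that by (auto simp: l_coset_def)
    have "t <# H = (t \<otimes> h) <# H" by (rule l_repr_independence[OF mem[OF a(2)] c(1) H])
    moreover have "t' <# H = (t' \<otimes> h') <# H" by (rule l_repr_independence[OF mem[OF a(4)] c(2) H])
    ultimately have "r t = r t'" using a by (simp add: r_def)
    then have "t = t'" using Tr a by simp
    then show "t = t' \<and> h = h'" using a c by simp
  qed
  have surj: "(\<lambda>(t, h). t \<otimes> h) ` (T \<times> H) = carrier G"
  proof
    show "(\<lambda>(t, h). t \<otimes> h) ` (T \<times> H) \<subseteq> carrier G" using T Hs by auto
    show "carrier G \<subseteq> (\<lambda>(t, h). t \<otimes> h) ` (T \<times> H)"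
    proof
      fix g assume g: "g \<in> carrier G"
      have "g \<in> r g <# H" using self[OF g] rc[OF g] by simp
      then obtain h where "h \<in> H" "g = r g \<otimes> h" by (auto simp: l_coset_def)
      then show "g \<in> (\<lambda>(t, h). t \<otimes> h) ` (T \<times> H)" using g by (force simp: T_def)
    qed
  qed
  have "card (T \<times> H) = Coset.order G" unfolding Coset.order_def surj[symmetric] using inj by (simp add: card_image)
  then show ?thesis using T inj surj by (auto simp: bij_betw_def card_cartesian_product)
qed

lemma trace_map_transitive:
  assumes fin: "finite (carrier G)" and H: "H \<subseteq> carrier G" and T: "T \<subseteq> carrier G"
    and bij: "bij_betw (\<lambda>(t, h). t \<otimes> h) (T \<times> H) (carrier G)"
    and M: "is_rep G M" and N: "is_rep G N" and f: "dim_row f = fst N" "dim_col f = fst M"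
  shows "trace_map G T M N (trace_map G H M N f) = trace_map G (carrier G) M N f"
proof -
  let ?s = "\<lambda>g. snd N g * (f * snd M (inv g))"
  have fT: "finite T" and fH: "finite H" using T H fin by (auto intro: finite_subset)
  have "trace_map G T M N (trace_map G H M N f)
      = msum (fst N) (fst M) (\<lambda>t. msum (fst N) (fst M) (\<lambda>h. ?s (t \<otimes> h)) H) T"
    unfolding trace_map_def[of G T]
  proof (rule msum_cong[OF refl])
    fix t assume "t \<in> T"
    then have t: "t \<in> carrier G" using T by auto
    have "trace_map G H M N f * snd M (inv t) = msum (fst N) (fst M) (\<lambda>h. ?s h * snd M (inv t)) H"
      unfolding trace_map_def using t M N f H by (subst msum_mult) (auto simp: subset_iff)
    then have "snd N t * (trace_map G H M N f * snd M (inv t))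
        = msum (fst N) (fst M) (\<lambda>h. snd N t * (?s h * snd M (inv t))) H"
      using t M N f H by (simp, subst mult_msum) (auto simp: subset_iff)
    also have "\<dots> = msum (fst N) (fst M) (\<lambda>h. ?s (t \<otimes> h)) H"
    proof (rule msum_cong[OF refl])
      fix h assume "h \<in> H"
      then have h: "h \<in> carrier G" using H by auto
      show "snd N t * (?s h * snd M (inv t)) = ?s (t \<otimes> h)"
        using t h M N f by (simp add: inv_mult_group rep_mult mat_mult_assoc)
    qed
    finally show "snd N t * (trace_map G H M N f * snd M (inv t)) = msum (fst N) (fst M) (\<lambda>h. ?s (t \<otimes> h)) H" .
  qed
  also have "\<dots> = msum (fst N) (fst M) (\<lambda>th. ?s (case th of (t, h) \<Rightarrow> t \<otimes> h)) (T \<times> H)"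
    by (rule eq_matI) (auto simp: sum.cartesian_product split_beta simp del: index_mult_mat(1))
  also have "\<dots> = trace_map G (carrier G) M N f"
    unfolding trace_map_def by (rule msum_reindex[OF bij, symmetric])
  finally show ?thesis .
qed

text \<open>As f commutes with H, the conjugate of f by t depends only on the coset t H, and
  multiplication by x permutes these cosets.\<close>

lemma relative_trace_in_rep_hom:
  assumes fin: "finite (carrier G)" and H: "subgroup H G" and T: "T \<subseteq> carrier G"
    and bij: "bij_betw (\<lambda>(t, h). t \<otimes> h) (T \<times> H) (carrier G)"
    and M: "is_rep G M" and N: "is_rep G N" and f: "dim_row f = fst N" "dim_col f = fst M"
    and comm: "\<And>h. h \<in> H \<Longrightarrow> f * snd M h = snd N h * f"
  shows "trace_map G T M N f \<in> rep_hom G M N"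
proof (rule rep_homI)
  fix x assume x: "x \<in> carrier G"
  have Hs: "H \<subseteq> carrier G" and finT: "finite T" using H T fin by (auto dest: subgroup.subset intro: finite_subset)
  have ex: "\<exists>t\<in>T. \<exists>h\<in>H. g = t \<otimes> h" if "g \<in> carrier G" for g
    using that bij unfolding bij_betw_def by (auto simp: image_iff set_eq_iff)
  have unique: "t = t'" if "t \<in> T" "t' \<in> T" "h \<in> H" "h' \<in> H" "t \<otimes> h = t' \<otimes> h'" for t t' h h'
    using that bij unfolding bij_betw_def inj_on_def by fastforce
  \<comment> \<open>The representative of the coset x g H; the factor h in x g = \<theta> g h later
    cancels against its inverse across f.\<close>
  define \<theta> where "\<theta> g = (SOME t. t \<in> T \<and> (\<exists>h\<in>H. x \<otimes> g = t \<otimes> h))" for g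
  have \<theta>: "\<theta> g \<in> T \<and> (\<exists>h\<in>H. x \<otimes> g = \<theta> g \<otimes> h)" if "g \<in> T" for g
    unfolding \<theta>_def by (rule someI_ex) (use ex[of "x \<otimes> g"] x that T in blast)
  have "inj_on \<theta> T"
  proof (rule inj_onI)
    fix t t' assume t: "t \<in> T" "t' \<in> T" "\<theta> t = \<theta> t'"
    obtain h h' where h: "h \<in> H" "h' \<in> H" "x \<otimes> t = \<theta> t \<otimes> h" "x \<otimes> t' = \<theta> t \<otimes> h'"
      using \<theta>[OF t(1)] \<theta>[OF t(2)] t(3) by auto
    have c: "t \<in> carrier G" "t' \<in> carrier G" "h \<in> carrier G" "h' \<in> carrier G" "\<theta> t \<in> carrier G"
      using t h T Hs \<theta> by auto
    \<comment> \<open>Cancelling x from the two equations puts t and t' into the same left coset of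
      H, and a transversal meets it once.\<close>
    have "x \<otimes> (t \<otimes> inv h) = \<theta> t" using c x by (simp add: m_assoc[symmetric] h(3)) (simp add: m_assoc)
    moreover have "x \<otimes> (t' \<otimes> inv h') = \<theta> t" using c x by (simp add: m_assoc[symmetric] h(4)) (simp add: m_assoc)
    ultimately have "t \<otimes> inv h = t' \<otimes> inv h'" using c x by (metis inv_closed Units_l_cancel Units_eq m_closed)
    then show "t = t'" using unique[OF t(1,2)] h subgroup.m_inv_closed[OF H] by blast
  qed
  then have bij\<theta>: "bij_betw \<theta> T T"
    using endo_inj_surj[OF finT _ \<open>inj_on \<theta> T\<close>] \<theta> by (auto simp: bij_betw_def)
  show "trace_map G T M N f * snd M x = snd N x * trace_map G T M N f"
  proof (rule trace_map_commute[OF T x M N f bij\<theta>])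
    fix g assume g: "g \<in> T"
    obtain h where h: "h \<in> H" "x \<otimes> g = \<theta> g \<otimes> h" using \<theta>[OF g] by blast
    have c: "h \<in> carrier G" "\<theta> g \<in> carrier G" using h g T Hs \<theta> by auto
    have "snd N (x \<otimes> g) * (f * snd M (inv (x \<otimes> g)))
        = snd N (\<theta> g) * ((snd N h * f) * (snd M (inv h) * snd M (inv (\<theta> g))))"
      unfolding h(2) using c M N f by (simp add: inv_mult_group rep_mult mat_mult_assoc)
    also have "\<dots> = snd N (\<theta> g) * (f * ((snd M h * snd M (inv h)) * snd M (inv (\<theta> g))))"
      unfolding comm[OF h(1), symmetric] using c M N f by (simp add: mat_mult_assoc)
    also have "\<dots> = snd N (\<theta> g) * (f * snd M (inv (\<theta> g)))"
      using c M by (simp add: rep_inv)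
    finally show "snd N (\<theta> g) * (f * snd M (inv (\<theta> g))) = snd N (x \<otimes> g) * (f * snd M (inv (x \<otimes> g)))" ..
  qed
qed auto

end

section \<open>Permutation modules and Higman's criterion\<close>

lemma mult_vec_assoc:
  "dim_col A = dim_row B \<Longrightarrow> dim_col B = dim_vec v \<Longrightarrow> (A * B) *\<^sub>v v = A *\<^sub>v (B *\<^sub>v (v :: 'a::comm_ring_1 vec))"
  by (rule assoc_mult_mat_vec[of A "dim_row A" "dim_col A" B "dim_col B"]) (auto intro: carrier_vecI)

lemma surjective_right_inverse:
  fixes e :: "'k::field mat"
  assumes "dim_row e = n" "dim_col e = m" "\<forall>w\<in>carrier_vec n. \<exists>v\<in>carrier_vec m. e *\<^sub>v v = w"
  obtains s where "dim_row s = m" "dim_col s = n" "e * s = 1\<^sub>m n"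
proof -
  define c where "c j = (SOME v. v \<in> carrier_vec m \<and> e *\<^sub>v v = unit_vec n j)" for j
  have c: "c j \<in> carrier_vec m \<and> e *\<^sub>v c j = unit_vec n j" for j
    unfolding c_def by (rule someI_ex) (use assms(3) in \<open>auto intro: unit_vec_carrier\<close>)
  define s where "s = mat m n (\<lambda>(i, j). c j $ i)"
  have "col s j = c j" if "j < n" for j
    using that c[of j] by (auto simp: s_def intro!: eq_vecI)
  then have "(e * s) $$ (i, j) = (e *\<^sub>v c j) $ i" if "i < n" "j < n" for i j
    using that assms by (simp add: s_def)
  then have "e * s = 1\<^sub>m n" using assms c by (intro eq_matI) (auto simp: s_def)
  then show ?thesis by (intro that[of s]) (auto simp: s_def)
qed

text \<open>The enumeration \<open>xs\<close> makes a set of any type index a basis, so that the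
  regular module (on group elements) and k[G/H] (on cosets) are instances.\<close>

definition perm_rep :: "nat \<Rightarrow> (nat \<Rightarrow> 'x) \<Rightarrow> ('g \<Rightarrow> 'x \<Rightarrow> 'x) \<Rightarrow> ('g, 'k::field) rep" where
  "perm_rep n xs act = (n, \<lambda>g. mat n n (\<lambda>(i, j). if xs i = act g (xs j) then 1 else 0))"

lemma perm_rep_dims[simp]:
  "fst (perm_rep n xs act) = n"
  "dim_row (snd (perm_rep n xs act) g) = n" "dim_col (snd (perm_rep n xs act) g) = n"
  by (simp_all add: perm_rep_def)

lemma mult_perm_rep_index:
  fixes A :: "'k::field mat"
  assumes "inj_on xs {..<n}" "dim_col A = n" "i < dim_row A" "j < n" "k < n" "xs k = act g (xs j)"
  shows "(A * snd (perm_rep n xs act) g) $$ (i, j) = A $$ (i, k)"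
proof -
  have "(A * snd (perm_rep n xs act) g) $$ (i, j)
      = (\<Sum>l<n. A $$ (i, l) * snd (perm_rep n xs act) g $$ (l, j))"
    using assms by (subst mat_mult_index) auto
  also have "\<dots> = (\<Sum>l<n. if l = k then A $$ (i, k) else 0)"
    by (rule sum.cong) (use assms in \<open>auto simp: perm_rep_def inj_on_def\<close>)
  finally show ?thesis using assms by simp
qed

lemma perm_rep_mult_index:
  fixes A :: "'k::field mat"
  assumes "inj_on xs {..<n}" "dim_row A = n" "j < dim_col A" "i < n" "k < n" "xs i = act g (xs k)"
    and "inj_on (act g) (xs ` {..<n})"
  shows "(snd (perm_rep n xs act) g * A) $$ (i, j) = A $$ (k, j)"
proof -
  have "(snd (perm_rep n xs act) g * A) $$ (i, j)
      = (\<Sum>l<n. snd (perm_rep n xs act) g $$ (i, l) * A $$ (l, j))"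
    using assms by (subst mat_mult_index) auto
  also have "\<dots> = (\<Sum>l<n. if l = k then A $$ (k, j) else 0)"
  proof (rule sum.cong[OF refl])
    fix l assume l: "l \<in> {..<n}"
    have "act g (xs k) = act g (xs l) \<longleftrightarrow> l = k"
      using assms l by (auto dest!: inj_onD[OF assms(7)] inj_onD[OF assms(1)])
    then show "snd (perm_rep n xs act) g $$ (i, l) * A $$ (l, j) = (if l = k then A $$ (k, j) else 0)"
      using assms l by (auto simp: perm_rep_def)
  qed
  finally show ?thesis using assms by simp
qed

lemma kronecker_hom:
  assumes "Group.group G" "is_rep G M" "is_rep G N" "is_rep G K" "is_rep G L"
    and f: "f \<in> rep_hom G M N" and g: "g \<in> rep_hom G K L"
  shows "kronecker f g \<in> rep_hom G (rep_tensor M K) (rep_tensor N L)"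
proof (rule rep_homI)
  fix x assume x: "x \<in> carrier G"
  interpret Group.group G by fact
  note f = rep_homD[OF f] and g = rep_homD[OF g]
  show "kronecker f g * snd (rep_tensor M K) x = snd (rep_tensor N L) x * kronecker f g"
    using assms(2-5) x f(1,2) g(1,2)
    by (simp add: rep_tensor_def kronecker_mult f(3)[OF x] g(3)[OF x])
qed (use rep_homD[OF f] rep_homD[OF g] in \<open>auto simp: rep_tensor_def\<close>)

definition trivial_rep :: "('g, 'k::field) rep" where
  "trivial_rep = (1, \<lambda>_. 1\<^sub>m 1)"

lemma trivial_rep_tensor: "rep_tensor trivial_rep M = M"
  by (cases M) (simp add: rep_tensor_def trivial_rep_def)

context group
begin

lemma is_rep_perm_rep:
  assumes bij: "bij_betw xs {..<n} X"
    and cl: "\<And>g x. g \<in> carrier G \<Longrightarrow> x \<in> X \<Longrightarrow> act g x \<in> X"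
    and one: "\<And>x. x \<in> X \<Longrightarrow> act \<one> x = x"
    and mult: "\<And>g h x. g \<in> carrier G \<Longrightarrow> h \<in> carrier G \<Longrightarrow> x \<in> X \<Longrightarrow> act (g \<otimes> h) x = act g (act h x)"
  shows "is_rep G (perm_rep n xs act :: ('a, 'k::field) rep)"
proof -
  have inj: "inj_on xs {..<n}" and xsX: "\<And>i. i < n \<Longrightarrow> xs i \<in> X" using bij by (auto simp: bij_betw_def)
  have ex: "\<exists>k<n. xs k = x" if "x \<in> X" for x using that bij by (metis bij_betw_imp_surj_on imageE lessThan_iff)
  have "snd (perm_rep n xs act) (g \<otimes> h) = (snd (perm_rep n xs act) g * snd (perm_rep n xs act) h :: 'k mat)"
    if g: "g \<in> carrier G" and h: "h \<in> carrier G" for g h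
  proof (rule eq_matI)
    fix i j assume "i < dim_row (snd (perm_rep n xs act) g * snd (perm_rep n xs act) h :: 'k mat)"
      "j < dim_col (snd (perm_rep n xs act) g * snd (perm_rep n xs act) h :: 'k mat)"
    then have ij: "i < n" "j < n" by auto
    obtain k where k: "k < n" "xs k = act h (xs j)" using ex[OF cl[OF h xsX[OF ij(2)]]] by blast
    have "(snd (perm_rep n xs act) g * snd (perm_rep n xs act) h :: 'k mat) $$ (i, j) = snd (perm_rep n xs act) g $$ (i, k)"
      by (rule mult_perm_rep_index[OF inj]) (use ij k in auto)
    also have "\<dots> = snd (perm_rep n xs act) (g \<otimes> h) $$ (i, j)"
      using ij k g h xsX by (simp add: perm_rep_def mult)
    finally show "snd (perm_rep n xs act) (g \<otimes> h) $$ (i, j) = (snd (perm_rep n xs act) g * snd (perm_rep n xs act) h :: 'k mat) $$ (i, j)" ..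
  qed auto
  moreover have "snd (perm_rep n xs act) \<one> = (1\<^sub>m n :: 'k mat)"
    by (rule eq_matI) (use inj one xsX in \<open>auto simp: perm_rep_def inj_on_def\<close>)
  ultimately show ?thesis by (auto simp: is_rep_def)
qed

lemma is_rep_trivial: "is_rep G trivial_rep"
  by (simp add: is_rep_def trivial_rep_def)

lemma is_rep_tensor: "is_rep G M \<Longrightarrow> is_rep G N \<Longrightarrow> is_rep G (rep_tensor M N)"
  unfolding is_rep_def[of G "rep_tensor M N"]
  by (auto simp: rep_tensor_def rep_one kronecker_one rep_mult kronecker_mult intro!: carrier_matI)

text \<open>Averaging a linear lift. With a linear section s of e, the trace of s f h is a
  homomorphism, and e carries it to the trace of f h, which is f times the trace of h, that is
  f.\<close>

lemma projective_if_id_trace: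
  fixes P :: "('a, 'k::field) rep"
  assumes fin: "finite (carrier G)" and P: "is_rep G P"
    and h: "dim_row h = fst P" "dim_col h = fst P" "trace_map G (carrier G) P P h = 1\<^sub>m (fst P)"
  shows "projective_rep G P"
  unfolding projective_rep_def
proof (intro conjI allI impI ballI)
  fix M N :: "('a, 'k) rep" and e f
  assume M: "is_rep G M" and N: "is_rep G N" and e: "e \<in> rep_epi G M N" and f: "f \<in> rep_hom G P N"
  have eh: "e \<in> rep_hom G M N" using e by (simp add: rep_epi_def)
  note e' = rep_homD(1,2)[OF eh] and f' = rep_homD(1,2)[OF f]
  obtain s where s: "dim_row s = fst M" "dim_col s = fst N" "e * s = 1\<^sub>m (fst N)"
    using surjective_right_inverse[OF e'] e by (auto simp: rep_epi_def)
  let ?k = "trace_map G (carrier G) P M (s * (f * h))"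
  have "?k \<in> rep_hom G P M" using fin P M s h f' by (intro trace_map_in_rep_hom) auto
  moreover have "e * ?k = f"
  proof -
    have "e * ?k = trace_map G (carrier G) P N (e * (s * (f * h)))"
      by (rule rep_hom_mult_trace_map) (use P M N eh s h f' in auto)
    also have "e * (s * (f * h)) = (e * s) * (f * h)" using e' f' s(1,2) h(1,2) by (simp add: mat_mult_assoc)
    also have "\<dots> = f * h" using s f' by simp
    also have "trace_map G (carrier G) P N (f * h) = f * trace_map G (carrier G) P P h"
      by (rule rep_hom_mult_trace_map[symmetric]) (use P N f h in auto)
    also have "\<dots> = f" using h f' by simp
    finally show ?thesis .
  qed
  ultimately show "\<exists>k\<in>rep_hom G P M. e * k = f" by blast
qed (rule P)

definition regular_rep :: "('a, 'k::field) rep" where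
  "regular_rep = perm_rep (Coset.order G) (SOME xs. bij_betw xs {..<Coset.order G} (carrier G)) (\<otimes>)"

text \<open>The vectors \<open>\<epsilon>\<close> and \<open>\<eta>\<close> are the augmentation of the group algebra and its unit.\<close>

lemma regular_rep_augmentation:
  assumes fin: "finite (carrier G)"
  obtains \<epsilon> \<eta> E :: "'k::field mat" where
    "is_rep G (regular_rep :: ('a, 'k) rep)"
    "\<epsilon> \<in> rep_hom G regular_rep trivial_rep"
    "dim_row \<eta> = fst (regular_rep :: ('a, 'k) rep)" "dim_col \<eta> = 1" "\<epsilon> * \<eta> = 1\<^sub>m 1"
    "dim_row E = fst (regular_rep :: ('a, 'k) rep)" "dim_col E = fst (regular_rep :: ('a, 'k) rep)"
    "trace_map G (carrier G) regular_rep regular_rep E = 1\<^sub>m (fst (regular_rep :: ('a, 'k) rep))"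
proof -
  let ?R = "regular_rep :: ('a, 'k) rep"
  define n where "n = Coset.order G"
  define xs where "xs = (SOME xs. bij_betw xs {..<n} (carrier G))"
  have "\<exists>xs. bij_betw xs {..<n} (carrier G)"
    using ex_bij_betw_nat_finite[OF fin] unfolding n_def Coset.order_def lessThan_atLeast0 .
  then have bij: "bij_betw xs {..<n} (carrier G)" unfolding xs_def by (rule someI_ex)
  have R: "?R = perm_rep n xs (\<otimes>)" by (simp add: regular_rep_def n_def xs_def)
  have fstR: "fst ?R = n" by (simp add: R)
  have inj: "inj_on xs {..<n}" and xsG: "\<And>i. i < n \<Longrightarrow> xs i \<in> carrier G" using bij by (auto simp: bij_betw_def)
  have ex: "\<exists>k<n. xs k = x" if "x \<in> carrier G" for x using that bij by (metis bij_betw_imp_surj_on imageE lessThan_iff)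
  have rep: "is_rep G ?R" unfolding R by (rule is_rep_perm_rep[OF bij]) (auto simp: m_assoc)
  obtain e where e: "e < n" "xs e = \<one>" using ex[OF one_closed] by blast
  define \<epsilon> :: "'k mat" where "\<epsilon> = mat 1 n (\<lambda>_. 1)"
  define \<eta> :: "'k mat" where "\<eta> = mat n 1 (\<lambda>(i, _). if i = e then 1 else 0)"
  \<comment> \<open>The projection onto the basis vector of the group unit. Its conjugates by the
    group elements are the projections onto all the basis vectors, and they add up to the
    identity.\<close>
  define E :: "'k mat" where "E = mat n n (\<lambda>(i, j). if i = e \<and> j = e then 1 else 0)"
  have \<epsilon>: "\<epsilon> \<in> rep_hom G ?R trivial_rep"
  proof (rule rep_homI)
    fix g assume g: "g \<in> carrier G"
    have "\<epsilon> * snd ?R g = \<epsilon>"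
    proof (rule eq_matI)
      fix i j assume "i < dim_row \<epsilon>" "j < dim_col \<epsilon>"
      then have ij: "i < 1" "j < n" by (auto simp: \<epsilon>_def)
      obtain k where k: "k < n" "xs k = g \<otimes> xs j" using ex[OF m_closed[OF g xsG[OF ij(2)]]] by blast
      then show "(\<epsilon> * snd ?R g) $$ (i, j) = \<epsilon> $$ (i, j)"
        unfolding R using ij k by (subst mult_perm_rep_index[OF inj, of _ _ _ k]) (auto simp: \<epsilon>_def)
    qed (auto simp: R \<epsilon>_def)
    then show "\<epsilon> * snd ?R g = snd trivial_rep g * \<epsilon>" by (simp add: trivial_rep_def \<epsilon>_def)
  qed (auto simp: R \<epsilon>_def trivial_rep_def)
  have \<epsilon>\<eta>: "\<epsilon> * \<eta> = 1\<^sub>m 1"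
  proof (rule eq_matI)
    fix i j assume "i < dim_row (1\<^sub>m 1 :: 'k mat)" "j < dim_col (1\<^sub>m 1 :: 'k mat)"
    then show "(\<epsilon> * \<eta>) $$ (i, j) = (1\<^sub>m 1 :: 'k mat) $$ (i, j)"
      using e by (subst mat_mult_index) (auto simp: \<epsilon>_def \<eta>_def)
  qed (auto simp: \<epsilon>_def \<eta>_def)
  have trE: "trace_map G (carrier G) ?R ?R E = 1\<^sub>m n"
  proof (rule eq_matI)
    fix i j assume "i < dim_row (1\<^sub>m n :: 'k mat)" "j < dim_col (1\<^sub>m n :: 'k mat)"
    then have ij: "i < n" "j < n" by auto
    have "(snd ?R g * (E * snd ?R (inv g))) $$ (i, j) = (if g = xs i \<and> i = j then 1 else 0)"
      if g: "g \<in> carrier G" for g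
    proof -
      obtain l where l: "l < n" "xs l = inv g \<otimes> xs i" using ex[OF m_closed[OF inv_closed[OF g] xsG[OF ij(1)]]] by blast
      obtain k where k: "k < n" "xs k = inv g \<otimes> xs j" using ex[OF m_closed[OF inv_closed[OF g] xsG[OF ij(2)]]] by blast
      have "(snd ?R g * (E * snd ?R (inv g))) $$ (i, j) = (E * snd ?R (inv g)) $$ (l, j)"
        unfolding R
        by (rule perm_rep_mult_index[OF inj])
          (use ij l g xsG in \<open>auto simp: E_def m_assoc[symmetric] inj_on_def\<close>)
      also have "\<dots> = E $$ (l, k)"
        unfolding R by (rule mult_perm_rep_index[OF inj]) (use ij l k in \<open>auto simp: E_def\<close>)
      also have "\<dots> = (if g = xs i \<and> i = j then 1 else 0)"
      proof -
        have one_iff: "inv g \<otimes> x = \<one> \<longleftrightarrow> g = x" if "x \<in> carrier G" for x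
          using g that inv_solve_left'[of \<one> g x] by (metis inv_closed inv_equality inv_inv l_inv)
        have "l = e \<longleftrightarrow> xs l = \<one>" "k = e \<longleftrightarrow> xs k = \<one>"
          using inj l k e by (auto simp: inj_on_def)
        then have "l = e \<and> k = e \<longleftrightarrow> g = xs i \<and> g = xs j"
          using l k one_iff xsG ij by simp
        also have "\<dots> \<longleftrightarrow> g = xs i \<and> i = j" using inj ij by (auto simp: inj_on_def)
        finally show ?thesis using l k by (simp add: E_def)
      qed
      finally show ?thesis .
    qed
    then have "trace_map G (carrier G) ?R ?R E $$ (i, j) = (\<Sum>g\<in>carrier G. if g = xs i \<and> i = j then 1 else 0)"
      using ij by (simp add: trace_map_def fstR del: index_mult_mat(1))
    also have "\<dots> = (\<Sum>g\<in>carrier G. if g = xs i then (if i = j then 1 else 0) else 0)"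
      by (rule sum.cong) auto
    also have "\<dots> = (1\<^sub>m n :: 'k mat) $$ (i, j)" using ij xsG fin by simp
    finally show "trace_map G (carrier G) ?R ?R E $$ (i, j) = (1\<^sub>m n :: 'k mat) $$ (i, j)" .
  qed (auto simp: fstR)
  show ?thesis
    by (rule that[of \<epsilon> \<eta> E]) (use rep \<epsilon> \<epsilon>\<eta> trE in \<open>auto simp: fstR \<eta>_def E_def\<close>)
qed

text \<open>Conjugation by g fixes the homomorphism f, so in each summand only the factor h is
  conjugated. Consequently projective homomorphisms absorb tensor products, and the tensor product
  of stable classes is well defined.\<close>

lemma trace_map_kronecker_left:
  assumes "is_rep G M" "is_rep G N" "is_rep G K" "is_rep G L" "S \<subseteq> carrier G"
    and h: "dim_row h = fst N" "dim_col h = fst M" and f: "f \<in> rep_hom G K L"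
  shows "kronecker (trace_map G S M N h) f = trace_map G S (rep_tensor M K) (rep_tensor N L) (kronecker h f)"
proof -
  note f = rep_homD[OF f]
  have "kronecker (trace_map G S M N h) f
      = msum (fst N * fst L) (fst M * fst K) (\<lambda>g. kronecker (snd N g * (h * snd M (inv g))) f) S"
    unfolding trace_map_def using assms f(1,2) by (subst kronecker_msum_left) (auto simp: subset_iff)
  also have "\<dots> = trace_map G S (rep_tensor M K) (rep_tensor N L) (kronecker h f)"
    unfolding trace_map_def rep_tensor_def fst_conv snd_conv
  proof (rule msum_cong[OF refl])
    fix g assume "g \<in> S"
    then have g: "g \<in> carrier G" "inv g \<in> carrier G" using assms by auto
    have "snd L g * (f * snd K (inv g)) = (snd L g * snd L (inv g)) * f"
      unfolding f(3)[OF g(2)] using assms f(1,2) g by (simp add: mat_mult_assoc)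
    also have "\<dots> = f" using assms f(1,2) g by (simp add: rep_inv)
    finally have e: "snd L g * (f * snd K (inv g)) = f" .
    show "kronecker (snd N g * (h * snd M (inv g))) f
      = kronecker (snd N g) (snd L g) * (kronecker h f * kronecker (snd M (inv g)) (snd K (inv g)))"
      using assms f(1,2) g by (simp add: kronecker_mult e)
  qed
  finally show ?thesis .
qed

lemma trace_map_kronecker_right:
  assumes "is_rep G M" "is_rep G N" "is_rep G K" "is_rep G L" "S \<subseteq> carrier G"
    and h: "dim_row h = fst N" "dim_col h = fst M" and f: "f \<in> rep_hom G K L"
  shows "kronecker f (trace_map G S M N h) = trace_map G S (rep_tensor K M) (rep_tensor L N) (kronecker f h)"
proof -
  note f = rep_homD[OF f]
  have "kronecker f (trace_map G S M N h)
      = msum (fst L * fst N) (fst K * fst M) (\<lambda>g. kronecker f (snd N g * (h * snd M (inv g)))) S"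
    unfolding trace_map_def using assms f(1,2) by (subst kronecker_msum_right) (auto simp: subset_iff)
  also have "\<dots> = trace_map G S (rep_tensor K M) (rep_tensor L N) (kronecker f h)"
    unfolding trace_map_def rep_tensor_def fst_conv snd_conv
  proof (rule msum_cong[OF refl])
    fix g assume "g \<in> S"
    then have g: "g \<in> carrier G" "inv g \<in> carrier G" using assms by auto
    have "snd L g * (f * snd K (inv g)) = (snd L g * snd L (inv g)) * f"
      unfolding f(3)[OF g(2)] using assms f(1,2) g by (simp add: mat_mult_assoc)
    also have "\<dots> = f" using assms f(1,2) g by (simp add: rep_inv)
    finally have e: "snd L g * (f * snd K (inv g)) = f" .
    show "kronecker f (snd N g * (h * snd M (inv g)))
      = kronecker (snd L g) (snd N g) * (kronecker f h * kronecker (snd K (inv g)) (snd M (inv g)))"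
      using assms f(1,2) g by (simp add: kronecker_mult e)
  qed
  finally show ?thesis .
qed

text \<open>Every module L is a quotient of kG \<otimes> L by the augmentation \<epsilon> \<otimes>
  1, which has the linear section \<eta> \<otimes> 1. The identity of kG \<otimes> L is a trace, and
  traces are closed under composition with homomorphisms on either side.\<close>

theorem projective_hom_eq_trace_maps:
  fixes M N :: "('a, 'k::field) rep"
  assumes fin: "finite (carrier G)" and M: "is_rep G M" and N: "is_rep G N"
  shows "projective_hom G M N = {trace_map G (carrier G) M N h | h. dim_row h = fst N \<and> dim_col h = fst M}"
proof -
  let ?tr = "trace_map G (carrier G)"
  obtain \<epsilon> \<eta> E :: "'k mat" where R:
    "is_rep G (regular_rep :: ('a, 'k) rep)"
    "\<epsilon> \<in> rep_hom G regular_rep trivial_rep"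
    "dim_row \<eta> = fst (regular_rep :: ('a, 'k) rep)" "dim_col \<eta> = 1" "\<epsilon> * \<eta> = 1\<^sub>m 1"
    "dim_row E = fst (regular_rep :: ('a, 'k) rep)" "dim_col E = fst (regular_rep :: ('a, 'k) rep)"
    "?tr regular_rep regular_rep E = 1\<^sub>m (fst (regular_rep :: ('a, 'k) rep))"
    by (rule regular_rep_augmentation[OF fin])
  let ?R = "regular_rep :: ('a, 'k) rep"
  have \<epsilon>: "dim_row \<epsilon> = 1" "dim_col \<epsilon> = fst ?R" using rep_homD[OF R(2)] by (auto simp: trivial_rep_def)
  \<comment> \<open>The diagonal action suits the purpose: the identity of kG is the trace of E, and
    tensoring this equation with the identity of L stays within traces.\<close>
  define F where "F L = rep_tensor ?R L" for L :: "('a, 'k) rep"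
  have F: "is_rep G (F L)" if "is_rep G L" for L
    unfolding F_def using R(1) that by (rule is_rep_tensor)
  have fstF: "fst (F L) = fst ?R * fst L" for L by (simp add: F_def rep_tensor_def)
  have idF: "?tr (F L) (F L) (kronecker E (1\<^sub>m (fst L))) = 1\<^sub>m (fst (F L))" if L: "is_rep G L" for L
    unfolding F_def using R L rep_hom_one[OF L]
    by (subst trace_map_kronecker_left[symmetric]) (auto simp: kronecker_one rep_tensor_def)
  define v where "v L = kronecker \<epsilon> (1\<^sub>m (fst L))" for L :: "('a, 'k) rep"
  have v: "v L \<in> rep_hom G (F L) L" if L: "is_rep G L" for L
    using kronecker_hom[OF is_group R(1) is_rep_trivial L L R(2) rep_hom_one[OF L]]
    by (simp add: v_def F_def trivial_rep_tensor)
  have v\<eta>: "v L * kronecker \<eta> h = h" if "dim_row h = fst L" for L h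
    using R \<epsilon> that by (simp add: v_def kronecker_mult)
  show ?thesis
  proof (intro equalityI subsetI)
    fix f assume "f \<in> projective_hom G M N"
    then obtain u w P where P: "projective_rep G P" and u: "u \<in> rep_hom G M P" and w: "w \<in> rep_hom G P N"
      and f: "f = w * u" by (auto simp: projective_hom_def)
    have Pr: "is_rep G P" using P by (simp add: projective_rep_def)
    note u' = rep_homD(1,2)[OF u] and w' = rep_homD(1,2)[OF w] and v' = rep_homD(1,2)[OF v[OF Pr]]
    have "v P \<in> rep_epi G (F P) P"
      unfolding rep_epi_def
    proof (intro CollectI conjI ballI v[OF Pr])
      fix x :: "'k vec" assume x: "x \<in> carrier_vec (fst P)"
      have "v P *\<^sub>v (kronecker \<eta> (1\<^sub>m (fst P)) *\<^sub>v x) = (v P * kronecker \<eta> (1\<^sub>m (fst P))) *\<^sub>v x"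
        by (rule mult_vec_assoc[symmetric]) (use x R v' fstF in auto)
      also have "\<dots> = x" using x by (simp add: v\<eta>)
      finally show "\<exists>y\<in>carrier_vec (fst (F P)). v P *\<^sub>v y = x"
        using R(3) fstF by (intro bexI[of _ "kronecker \<eta> (1\<^sub>m (fst P)) *\<^sub>v x"] carrier_vecI) simp_all
    qed
    moreover have "1\<^sub>m (fst P) \<in> rep_hom G P P" by (rule rep_hom_one[OF Pr])
    ultimately obtain s where s: "s \<in> rep_hom G P (F P)" "v P * s = 1\<^sub>m (fst P)"
      using P F[OF Pr] Pr unfolding projective_rep_def by blast
    note s' = rep_homD(1,2)[OF s(1)]
    let ?E = "kronecker E (1\<^sub>m (fst P))"
    have E: "dim_row ?E = fst (F P)" "dim_col ?E = fst (F P)" using R fstF by auto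
    \<comment> \<open>The identity of P is v s, and between v and s the identity of the cover is
      inserted as a trace. The next steps draw s, v, u and w into it.\<close>
    have "f = w * ((v P * (?tr (F P) (F P) ?E * s)) * u)"
      using s s' u' by (simp add: idF[OF Pr] f)
    also have "?tr (F P) (F P) ?E * s = ?tr P (F P) (?E * s)"
      by (rule trace_map_mult_rep_hom) (use F Pr s s' E in auto)
    also have "v P * \<dots> = ?tr P P (v P * (?E * s))"
      by (rule rep_hom_mult_trace_map) (use F Pr s' E v in auto)
    also have "\<dots> * u = ?tr M P (v P * (?E * s) * u)"
      by (rule trace_map_mult_rep_hom) (use M Pr s' E v' u in auto)
    also have "w * \<dots> = ?tr M N (w * (v P * (?E * s) * u))"
      by (rule rep_hom_mult_trace_map) (use M N Pr s' E v' u' w in auto)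
    finally show "f \<in> {?tr M N h | h. dim_row h = fst N \<and> dim_col h = fst M}"
      using w' u' by (intro CollectI exI[of _ "w * (v P * (?E * s) * u)"] conjI) simp_all
  next
    fix f assume "f \<in> {?tr M N h | h. dim_row h = fst N \<and> dim_col h = fst M}"
    then obtain h where f: "f = ?tr M N h" and h: "dim_row h = fst N" "dim_col h = fst M" by auto
    have "projective_rep G (F N)"
      by (rule projective_if_id_trace[OF fin F[OF N] _ _ idF[OF N]]) (use R fstF in auto)
    moreover have "?tr M (F N) (kronecker \<eta> h) \<in> rep_hom G M (F N)"
      by (rule trace_map_in_rep_hom) (use fin M N F R h fstF in auto)
    \<comment> \<open>The linear map h is first lifted along the section \<eta> \<otimes> 1; since v
      is a homomorphism, the trace of the lift factors the trace of h through the cover.\<close>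
    moreover have "f = v N * ?tr M (F N) (kronecker \<eta> h)"
    proof -
      have "v N * ?tr M (F N) (kronecker \<eta> h) = ?tr M N (v N * kronecker \<eta> h)"
        by (rule rep_hom_mult_trace_map) (use M N F R h fstF v in auto)
      then show ?thesis using v\<eta>[OF h(1)] f by simp
    qed
    ultimately show "f \<in> projective_hom G M N"
      using v[OF N] unfolding projective_hom_def by blast
  qed
qed

end

section \<open>The stable category on representatives\<close>

context group
begin

context
  assumes fin: "finite (carrier G)"
begin

lemma trace_map_in_projective_hom:
  assumes "is_rep G M" "is_rep G N" "dim_row h = fst N" "dim_col h = fst M"
  shows "trace_map G (carrier G) M N h \<in> projective_hom G M N"
  using assms by (auto simp: projective_hom_eq_trace_maps[OF fin])

lemma projective_homE:
  assumes "f \<in> projective_hom G M N" "is_rep G M" "is_rep G N"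
  obtains h where "dim_row h = fst N" "dim_col h = fst M" "f = trace_map G (carrier G) M N h"
  using assms by (auto simp: projective_hom_eq_trace_maps[OF fin])

lemma projective_hom_subset: "is_rep G M \<Longrightarrow> is_rep G N \<Longrightarrow> projective_hom G M N \<subseteq> rep_hom G M N"
  by (auto elim!: projective_homE intro!: trace_map_in_rep_hom fin)

lemma projective_hom_zero:
  assumes "is_rep G M" "is_rep G N"
  shows "0\<^sub>m (fst N) (fst M) \<in> projective_hom G M N"
proof -
  have "trace_map G (carrier G) M N (0 \<cdot>\<^sub>m 0\<^sub>m (fst N) (fst M)) = 0 \<cdot>\<^sub>m trace_map G (carrier G) M N (0\<^sub>m (fst N) (fst M))"
    by (rule trace_map_smult) (use assms in auto)
  also have "\<dots> = 0\<^sub>m (fst N) (fst M)" by (rule eq_matI) auto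
  finally show ?thesis using trace_map_in_projective_hom[OF assms, of "0 \<cdot>\<^sub>m 0\<^sub>m (fst N) (fst M)"] by simp
qed

lemma projective_hom_add:
  assumes "is_rep G M" "is_rep G N" "f \<in> projective_hom G M N" "g \<in> projective_hom G M N"
  shows "f + g \<in> projective_hom G M N"
proof -
  obtain h where h: "dim_row h = fst N" "dim_col h = fst M" "f = trace_map G (carrier G) M N h"
    using assms by (auto elim: projective_homE)
  obtain k where k: "dim_row k = fst N" "dim_col k = fst M" "g = trace_map G (carrier G) M N k"
    using assms by (auto elim: projective_homE)
  have "f + g = trace_map G (carrier G) M N (h + k)"
    unfolding h k by (rule trace_map_add[symmetric]) (use assms h k in auto)
  then show ?thesis using trace_map_in_projective_hom[OF assms(1,2), of "h + k"] h k by simp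
qed

lemma projective_hom_smult:
  assumes "is_rep G M" "is_rep G N" "f \<in> projective_hom G M N"
  shows "c \<cdot>\<^sub>m f \<in> projective_hom G M N"
proof -
  obtain h where h: "dim_row h = fst N" "dim_col h = fst M" "f = trace_map G (carrier G) M N h"
    using assms by (auto elim: projective_homE)
  have "c \<cdot>\<^sub>m f = trace_map G (carrier G) M N (c \<cdot>\<^sub>m h)"
    unfolding h by (rule trace_map_smult[symmetric]) (use assms h in auto)
  then show ?thesis using trace_map_in_projective_hom[OF assms(1,2), of "c \<cdot>\<^sub>m h"] h by simp
qed

lemma projective_hom_uminus:
  assumes "is_rep G M" "is_rep G N" "f \<in> projective_hom G M N"
  shows "- f \<in> projective_hom G M N"
proof -
  have "- f = (-1) \<cdot>\<^sub>m f" by (rule eq_matI) auto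
  then show ?thesis using projective_hom_smult[OF assms, of "-1"] by simp
qed

lemma projective_hom_comp_left:
  assumes "is_rep G M" "is_rep G N" "is_rep G L" "f \<in> projective_hom G M N" "a \<in> rep_hom G N L"
  shows "a * f \<in> projective_hom G M L"
proof -
  obtain h where h: "dim_row h = fst N" "dim_col h = fst M" "f = trace_map G (carrier G) M N h"
    using assms by (auto elim: projective_homE)
  have "a * f = trace_map G (carrier G) M L (a * h)"
    unfolding h by (rule rep_hom_mult_trace_map) (use assms h in auto)
  then show ?thesis
    using trace_map_in_projective_hom[OF assms(1,3), of "a * h"] h rep_homD(1,2)[OF assms(5)] by simp
qed

lemma projective_hom_comp_right:
  assumes "is_rep G M" "is_rep G N" "is_rep G L" "f \<in> projective_hom G M N" "a \<in> rep_hom G L M"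
  shows "f * a \<in> projective_hom G L N"
proof -
  obtain h where h: "dim_row h = fst N" "dim_col h = fst M" "f = trace_map G (carrier G) M N h"
    using assms by (auto elim: projective_homE)
  have "f * a = trace_map G (carrier G) L N (h * a)"
    unfolding h by (rule trace_map_mult_rep_hom) (use assms h in auto)
  then show ?thesis
    using trace_map_in_projective_hom[OF assms(3,2), of "h * a"] h rep_homD(1,2)[OF assms(5)] by simp
qed

lemma projective_hom_kronecker_left:
  assumes "is_rep G M" "is_rep G N" "is_rep G K" "is_rep G L" "f \<in> projective_hom G M N" "a \<in> rep_hom G K L"
  shows "kronecker f a \<in> projective_hom G (rep_tensor M K) (rep_tensor N L)"
proof -
  obtain h where h: "dim_row h = fst N" "dim_col h = fst M" "f = trace_map G (carrier G) M N h"
    using assms by (auto elim: projective_homE)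
  have "kronecker f a = trace_map G (carrier G) (rep_tensor M K) (rep_tensor N L) (kronecker h a)"
    unfolding h by (rule trace_map_kronecker_left) (use assms h in auto)
  moreover have "trace_map G (carrier G) (rep_tensor M K) (rep_tensor N L) (kronecker h a)
      \<in> projective_hom G (rep_tensor M K) (rep_tensor N L)"
    using assms h rep_homD(1,2)[OF assms(6)]
    by (intro trace_map_in_projective_hom is_rep_tensor) (auto simp: rep_tensor_def)
  ultimately show ?thesis by simp
qed

lemma projective_hom_kronecker_right:
  assumes "is_rep G M" "is_rep G N" "is_rep G K" "is_rep G L" "f \<in> projective_hom G M N" "a \<in> rep_hom G K L"
  shows "kronecker a f \<in> projective_hom G (rep_tensor K M) (rep_tensor L N)"
proof -
  obtain h where h: "dim_row h = fst N" "dim_col h = fst M" "f = trace_map G (carrier G) M N h"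
    using assms by (auto elim: projective_homE)
  have "kronecker a f = trace_map G (carrier G) (rep_tensor K M) (rep_tensor L N) (kronecker a h)"
    unfolding h by (rule trace_map_kronecker_right) (use assms h in auto)
  moreover have "trace_map G (carrier G) (rep_tensor K M) (rep_tensor L N) (kronecker a h)
      \<in> projective_hom G (rep_tensor K M) (rep_tensor L N)"
    using assms h rep_homD(1,2)[OF assms(6)]
    by (intro trace_map_in_projective_hom is_rep_tensor) (auto simp: rep_tensor_def)
  ultimately show ?thesis by simp
qed

lemma stable_relD:
  assumes "(a, b) \<in> stable_rel G M N"
  shows "a \<in> rep_hom G M N" "b \<in> rep_hom G M N" "a - b \<in> projective_hom G M N"
  using assms by (auto simp: stable_rel_def)

lemma equiv_stable_rel:
  assumes M: "is_rep G M" and N: "is_rep G N"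
  shows "equiv (rep_hom G M N) (stable_rel G M N)"
proof (rule equivI)
  show "stable_rel G M N \<subseteq> rep_hom G M N \<times> rep_hom G M N" by (auto simp: stable_rel_def)
  show "refl_on (rep_hom G M N) (stable_rel G M N)"
  proof (rule refl_onI)
    fix a assume a: "a \<in> rep_hom G M N"
    have "a - a = 0\<^sub>m (fst N) (fst M)" by (rule eq_matI) (use rep_homD(1,2)[OF a] in auto)
    then show "(a, a) \<in> stable_rel G M N" using a projective_hom_zero[OF M N] by (simp add: stable_rel_def)
  qed
  show "sym (stable_rel G M N)"
  proof (rule symI)
    fix a b assume ab: "(a, b) \<in> stable_rel G M N"
    note d = rep_homD(1,2)[OF stable_relD(1)[OF ab]] rep_homD(1,2)[OF stable_relD(2)[OF ab]]
    have "b - a = - (a - b)" by (rule eq_matI) (use d in auto)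
    then show "(b, a) \<in> stable_rel G M N"
      using stable_relD[OF ab] projective_hom_uminus[OF M N] by (simp add: stable_rel_def)
  qed
  show "trans (stable_rel G M N)"
  proof (rule transI)
    fix a b c assume ab: "(a, b) \<in> stable_rel G M N" and bc: "(b, c) \<in> stable_rel G M N"
    note d = rep_homD(1,2)[OF stable_relD(1)[OF ab]] rep_homD(1,2)[OF stable_relD(2)[OF ab]]
      rep_homD(1,2)[OF stable_relD(2)[OF bc]]
    have "a - c = (a - b) + (b - c)" by (rule eq_matI) (use d in auto)
    then show "(a, c) \<in> stable_rel G M N"
      using stable_relD[OF ab] stable_relD[OF bc] projective_hom_add[OF M N] by (simp add: stable_rel_def)
  qed
qed

lemma stable_class_eq_iff:
  assumes "is_rep G M" "is_rep G N" "f \<in> rep_hom G M N" "g \<in> rep_hom G M N"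
  shows "stable_rel G M N `` {f} = stable_rel G M N `` {g} \<longleftrightarrow> f - g \<in> projective_hom G M N"
  using eq_equiv_class_iff[OF equiv_stable_rel[OF assms(1,2)] assms(3,4)] assms(3,4)
  by (simp add: stable_rel_def)

context
  fixes C :: "(('a, 'k::field) rep, 'k mat set) tensor_category"
  defines "C \<equiv> stmod G TYPE('k)"
begin

lemma stmod_Obj: "M \<in> Obj C \<longleftrightarrow> is_rep G M"
  by (simp add: C_def stmod_def)

lemma stmod_MorE:
  assumes "X \<in> Mor C M N"
  obtains f where "f \<in> rep_hom G M N" "X = stable_rel G M N `` {f}"
  using assms by (auto simp: C_def stmod_def elim: quotientE)

lemma stmod_MorI: "f \<in> rep_hom G M N \<Longrightarrow> stable_rel G M N `` {f} \<in> Mor C M N"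
  by (simp add: C_def stmod_def quotientI)

lemma stmod_Ident: "Ident C M = stable_rel G M M `` {1\<^sub>m (fst M)}"
  by (simp add: C_def stmod_def)

lemma stmod_Zero: "Zero C M N = stable_rel G M N `` {0\<^sub>m (fst N) (fst M)}"
  by (simp add: C_def stmod_def)

lemma stmod_TObj: "TObj C = rep_tensor"
  by (simp add: C_def stmod_def)

lemma stmod_Comp:
  assumes M: "is_rep G M" and N: "is_rep G N" and L: "is_rep G L"
    and f: "f \<in> rep_hom G M N" and g: "g \<in> rep_hom G N L"
  shows "Comp C M N L (stable_rel G N L `` {g}) (stable_rel G M N `` {f}) = stable_rel G M L `` {g * f}"
proof -
  have "congruent2 (stable_rel G N L) (stable_rel G M N) (\<lambda>y x. stable_rel G M L `` {y * x})"
  proof (rule congruent2I')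
    fix y y' x x' assume y: "(y, y') \<in> stable_rel G N L" and x: "(x, x') \<in> stable_rel G M N"
    note y = stable_relD[OF y] and x = stable_relD[OF x]
    note d = rep_homD(1,2)[OF y(1)] rep_homD(1,2)[OF y(2)] rep_homD(1,2)[OF x(1)] rep_homD(1,2)[OF x(2)]
    have "y * x - y' * x' = (y - y') * x + y' * (x - x')"
      using d by (intro eq_matI) (simp_all add: mat_minus_mult mat_mult_minus del: index_mult_mat(1))
    moreover have "(y - y') * x \<in> projective_hom G M L" by (rule projective_hom_comp_right[OF N L M y(3) x(1)])
    moreover have "y' * (x - x') \<in> projective_hom G M L" by (rule projective_hom_comp_left[OF M N L x(3) y(2)])
    ultimately have "y * x - y' * x' \<in> projective_hom G M L" using projective_hom_add[OF M L] by simp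
    then show "stable_rel G M L `` {y * x} = stable_rel G M L `` {y' * x'}"
      using stable_class_eq_iff[OF M L] rep_hom_comp[OF M N L x(1) y(1)] rep_hom_comp[OF M N L x(2) y(2)] by blast
  qed
  from UN_equiv_class2[OF equiv_stable_rel[OF N L] equiv_stable_rel[OF M N] this g f]
  show ?thesis by (simp add: C_def stmod_def)
qed

lemma stmod_Add:
  assumes M: "is_rep G M" and N: "is_rep G N" and f: "f \<in> rep_hom G M N" and g: "g \<in> rep_hom G M N"
  shows "Add C M N (stable_rel G M N `` {f}) (stable_rel G M N `` {g}) = stable_rel G M N `` {f + g}"
proof -
  have "congruent2 (stable_rel G M N) (stable_rel G M N) (\<lambda>y x. stable_rel G M N `` {y + x})"
  proof (rule congruent2I')
    fix y y' x x' assume y: "(y, y') \<in> stable_rel G M N" and x: "(x, x') \<in> stable_rel G M N"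
    note y = stable_relD[OF y] and x = stable_relD[OF x]
    note d = rep_homD(1,2)[OF y(1)] rep_homD(1,2)[OF y(2)] rep_homD(1,2)[OF x(1)] rep_homD(1,2)[OF x(2)]
    have "y + x - (y' + x') = (y - y') + (x - x')" by (rule eq_matI) (use d in auto)
    then have "y + x - (y' + x') \<in> projective_hom G M N" using projective_hom_add[OF M N y(3) x(3)] by simp
    then show "stable_rel G M N `` {y + x} = stable_rel G M N `` {y' + x'}"
      using stable_class_eq_iff[OF M N] rep_hom_add[OF M N y(1) x(1)] rep_hom_add[OF M N y(2) x(2)] by blast
  qed
  from UN_equiv_class2[OF equiv_stable_rel[OF M N] equiv_stable_rel[OF M N] this f g]
  show ?thesis by (simp add: C_def stmod_def)
qed

lemma stmod_Neg:
  assumes M: "is_rep G M" and N: "is_rep G N" and f: "f \<in> rep_hom G M N"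
  shows "Neg C M N (stable_rel G M N `` {f}) = stable_rel G M N `` {- f}"
proof -
  have "congruent (stable_rel G M N) (\<lambda>x. stable_rel G M N `` {- x})"
  proof (rule congruentI)
    fix x x' assume x: "(x, x') \<in> stable_rel G M N"
    note x = stable_relD[OF x]
    note d = rep_homD(1,2)[OF x(1)] rep_homD(1,2)[OF x(2)]
    have "- x - (- x') = - (x - x')" by (rule eq_matI) (use d in auto)
    then have "- x - (- x') \<in> projective_hom G M N" using projective_hom_uminus[OF M N x(3)] by simp
    then show "stable_rel G M N `` {- x} = stable_rel G M N `` {- x'}"
      using stable_class_eq_iff[OF M N] rep_hom_uminus[OF M N x(1)] rep_hom_uminus[OF M N x(2)] by blast
  qed
  from UN_equiv_class[OF equiv_stable_rel[OF M N] this f]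
  show ?thesis by (simp add: C_def stmod_def)
qed

lemma stmod_TMor:
  assumes M: "is_rep G M" and N: "is_rep G N" and K: "is_rep G K" and L: "is_rep G L"
    and f: "f \<in> rep_hom G M N" and g: "g \<in> rep_hom G K L"
  shows "TMor C M N K L (stable_rel G M N `` {f}) (stable_rel G K L `` {g})
    = stable_rel G (rep_tensor M K) (rep_tensor N L) `` {kronecker f g}"
proof -
  note MK = is_rep_tensor[OF M K] and NL = is_rep_tensor[OF N L]
  have "congruent2 (stable_rel G M N) (stable_rel G K L)
    (\<lambda>x y. stable_rel G (rep_tensor M K) (rep_tensor N L) `` {kronecker x y})"
  proof (rule congruent2I')
    fix x x' y y' assume x: "(x, x') \<in> stable_rel G M N" and y: "(y, y') \<in> stable_rel G K L"
    note y = stable_relD[OF y] and x = stable_relD[OF x]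
    note d = rep_homD(1,2)[OF y(1)] rep_homD(1,2)[OF y(2)] rep_homD(1,2)[OF x(1)] rep_homD(1,2)[OF x(2)]
    have "kronecker x y - kronecker x' y' = kronecker (x - x') y + kronecker x' (y - y')"
      using d by (intro eq_matI) (simp_all add: kronecker_minus_left kronecker_minus_right)
    moreover note projective_hom_kronecker_left[OF M N K L x(3) y(1)]
    moreover note projective_hom_kronecker_right[OF K L M N y(3) x(2)]
    ultimately have "kronecker x y - kronecker x' y' \<in> projective_hom G (rep_tensor M K) (rep_tensor N L)"
      using projective_hom_add[OF MK NL] by simp
    then show "stable_rel G (rep_tensor M K) (rep_tensor N L) `` {kronecker x y}
        = stable_rel G (rep_tensor M K) (rep_tensor N L) `` {kronecker x' y'}"
      using stable_class_eq_iff[OF MK NL] kronecker_hom[OF is_group M N K L x(1) y(1)]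
        kronecker_hom[OF is_group M N K L x(2) y(2)] by blast
  qed
  from UN_equiv_class2[OF equiv_stable_rel[OF M N] equiv_stable_rel[OF K L] this f g]
  show ?thesis by (simp add: C_def stmod_def)
qed

lemma kelly_radical_stmod_iff:
  assumes M: "is_rep G M" and N: "is_rep G N" and f: "f \<in> rep_hom G M N"
  shows "stable_rel G M N `` {f} \<in> kelly_radical C M N \<longleftrightarrow>
    (\<forall>g\<in>rep_hom G N M. \<exists>v\<in>rep_hom G M M.
       (1\<^sub>m (fst M) - g * f) * v - 1\<^sub>m (fst M) \<in> projective_hom G M M \<and>
       v * (1\<^sub>m (fst M) - g * f) - 1\<^sub>m (fst M) \<in> projective_hom G M M)"
proof -
  let ?c = "\<lambda>f. stable_rel G M M `` {f}"
  note one = rep_hom_one[OF M]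
  have inv: "invertible_endo C M (Add C M M (Ident C M) (Neg C M M (Comp C M N M (stable_rel G N M `` {g}) (stable_rel G M N `` {f}))))
    \<longleftrightarrow> (\<exists>v\<in>rep_hom G M M.
       (1\<^sub>m (fst M) - g * f) * v - 1\<^sub>m (fst M) \<in> projective_hom G M M \<and>
       v * (1\<^sub>m (fst M) - g * f) - 1\<^sub>m (fst M) \<in> projective_hom G M M)"
    if g: "g \<in> rep_hom G N M" for g
  proof -
    note gf = rep_hom_comp[OF M N M f g]
    let ?u = "1\<^sub>m (fst M) - g * f"
    have u: "?u \<in> rep_hom G M M" by (rule rep_hom_minus[OF M M one gf])
    have "1\<^sub>m (fst M) + - (g * f) = ?u"
      by (rule eq_matI) (use rep_homD(1,2)[OF gf] in auto)
    then have 1: "Add C M M (Ident C M) (Neg C M M (Comp C M N M (stable_rel G N M `` {g}) (stable_rel G M N `` {f}))) = ?c ?u"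
      by (simp add: stmod_Comp[OF M N M f g] stmod_Neg[OF M M gf] stmod_Ident
          stmod_Add[OF M M one rep_hom_uminus[OF M M gf]])
    have 2: "Comp C M M M (?c ?u) (?c v) = Ident C M \<longleftrightarrow> ?u * v - 1\<^sub>m (fst M) \<in> projective_hom G M M"
      "Comp C M M M (?c v) (?c ?u) = Ident C M \<longleftrightarrow> v * ?u - 1\<^sub>m (fst M) \<in> projective_hom G M M"
      if v: "v \<in> rep_hom G M M" for v
      by (simp_all add: stmod_Comp[OF M M M u v] stmod_Comp[OF M M M v u] stmod_Ident
          stable_class_eq_iff[OF M M rep_hom_comp[OF M M M u v] one]
          stable_class_eq_iff[OF M M rep_hom_comp[OF M M M v u] one])
    show ?thesis unfolding 1 invertible_endo_def
    proof
      assume "?c ?u \<in> Mor C M M \<and> (\<exists>V\<in>Mor C M M. Comp C M M M (?c ?u) V = Ident C M \<and> Comp C M M M V (?c ?u) = Ident C M)"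
      then obtain V where V: "V \<in> Mor C M M" "Comp C M M M (?c ?u) V = Ident C M" "Comp C M M M V (?c ?u) = Ident C M"
        by blast
      obtain v where "v \<in> rep_hom G M M" "V = ?c v" using stmod_MorE[OF V(1)] by metis
      then show "\<exists>v\<in>rep_hom G M M. ?u * v - 1\<^sub>m (fst M) \<in> projective_hom G M M \<and> v * ?u - 1\<^sub>m (fst M) \<in> projective_hom G M M"
        using V 2 by blast
    next
      assume "\<exists>v\<in>rep_hom G M M. ?u * v - 1\<^sub>m (fst M) \<in> projective_hom G M M \<and> v * ?u - 1\<^sub>m (fst M) \<in> projective_hom G M M"
      then show "?c ?u \<in> Mor C M M \<and> (\<exists>V\<in>Mor C M M. Comp C M M M (?c ?u) V = Ident C M \<and> Comp C M M M V (?c ?u) = Ident C M)"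
        using 2 stmod_MorI[OF u] stmod_MorI by blast
    qed
  qed
  have "stable_rel G M N `` {f} \<in> kelly_radical C M N \<longleftrightarrow> (\<forall>X\<in>Mor C N M.
     invertible_endo C M (Add C M M (Ident C M) (Neg C M M (Comp C M N M X (stable_rel G M N `` {f})))))"
    using stmod_MorI[OF f] by (simp add: kelly_radical_def)
  also have "\<dots> \<longleftrightarrow> (\<forall>g\<in>rep_hom G N M. invertible_endo C M (Add C M M (Ident C M)
      (Neg C M M (Comp C M N M (stable_rel G N M `` {g}) (stable_rel G M N `` {f})))))"
    using stmod_MorI by (metis stmod_MorE)
  finally show ?thesis using inv by simp
qed

end

end

end

section \<open>Endomorphisms of negligible trace over a truncated polynomial ring\<close>

lemma mat_pow_commute:
  assumes "dim_row A = n" "dim_col A = n" "dim_row B = n" "dim_col B = n" "A * B = B * A"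
  shows "A ^\<^sub>m i * B ^\<^sub>m j = B ^\<^sub>m j * A ^\<^sub>m i"
proof -
  have 1: "A * B ^\<^sub>m j = B ^\<^sub>m j * A" for j
  proof (induction j)
    case (Suc j)
    have "A * B ^\<^sub>m Suc j = (A * B ^\<^sub>m j) * B" using assms(1-4) by (simp add: mat_mult_assoc)
    also have "\<dots> = B ^\<^sub>m j * (A * B)" unfolding Suc using assms(1-4) by (simp add: mat_mult_assoc)
    also have "\<dots> = B ^\<^sub>m Suc j * A" unfolding assms(5) using assms(1-4) by (simp add: mat_mult_assoc)
    finally show ?case .
  qed (use assms in simp)
  show ?thesis
  proof (induction i)
    case (Suc i)
    have "A ^\<^sub>m Suc i * B ^\<^sub>m j = A ^\<^sub>m i * (A * B ^\<^sub>m j)" using assms(1-4) by (simp add: mat_mult_assoc)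
    also have "\<dots> = (A ^\<^sub>m i * B ^\<^sub>m j) * A" unfolding 1 using assms(1-4) by (simp add: mat_mult_assoc)
    also have "\<dots> = B ^\<^sub>m j * A ^\<^sub>m Suc i" unfolding Suc using assms(1-4) by (simp add: mat_mult_assoc)
    finally show ?case .
  qed (use assms in simp)
qed

text \<open>In the application x = \<sigma> - 1 for a generator \<sigma> of a group of order p. The
  matrices that commute with x are then the module endomorphisms, and \<open>neg\<close> says that a
  is negligible.\<close>

context
  fixes x a :: "'k::field mat" and n :: nat
  assumes x: "dim_row x = n" "dim_col x = n" and a: "dim_row a = n" "dim_col a = n"
    and comm: "a * x = x * a"
    and neg: "\<And>c. dim_row c = n \<Longrightarrow> dim_col c = n \<Longrightarrow> c * x = x * c \<Longrightarrow> mtrace (c * a) = 0"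
begin

text \<open>
  Where \<open>\<Phi> x^k = 0\<close> and \<open>x^k U = 0\<close>, the sum \<open>C\<close> of the \<open>x^i U W \<Phi> x^(k-1-i)\<close> commutes with \<open>x\<close>, and
  the trace of \<open>C a\<close> is \<open>k\<close> times that of \<open>W \<Phi> x^(k-1) a U\<close>.
\<close>

lemma negligible_kernel_step:
  assumes k: "of_nat (Suc j) \<noteq> (0 :: 'k)" and V: "dim_row V = n" "dim_col V = m"
    and xV: "x ^\<^sub>m Suc j * V = 0\<^sub>m n m"
  shows "\<exists>V'. dim_row V' = n \<and> dim_col V' = m \<and> x ^\<^sub>m j * (a * V) = x ^\<^sub>m Suc j * V'"
proof -
  let ?y = "x ^\<^sub>m Suc j"
  note [simp] = x a V
  obtain q where q[simp]: "dim_row q = n" "dim_col q = n" and yqy: "?y * (q * ?y) = ?y"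
    using ginverse_exists[of ?y] by auto
  \<comment> \<open>For y = x^(j+1), U is a projection onto the kernel of y, and the kernel of
    \<Phi> is the image of y.\<close>
  define U where "U = 1\<^sub>m n - q * ?y"
  define \<Phi> where "\<Phi> = 1\<^sub>m n - ?y * q"
  have [simp]: "dim_row U = n" "dim_col U = n" "dim_row \<Phi> = n" "dim_col \<Phi> = n"
    by (simp_all add: U_def \<Phi>_def)
  have yU: "?y * U = 0\<^sub>m n n"
    unfolding U_def by (simp add: mat_mult_minus yqy del: pow_mat.simps) (rule eq_matI, auto)
  have \<Phi>y: "\<Phi> * ?y = 0\<^sub>m n n"
    unfolding \<Phi>_def by (simp add: mat_minus_mult mat_mult_assoc yqy del: pow_mat.simps) (rule eq_matI, auto)
  have UV: "U * V = V"
  proof -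
    have "U * V = V - q * (?y * V)" unfolding U_def by (simp add: mat_minus_mult mat_mult_assoc del: pow_mat.simps)
    then show ?thesis unfolding xV by (simp add: mat_eq_iff)
  qed
  \<comment> \<open>Vanishing of Z says that x^j a maps the kernel of x^(j+1) into its
    image.\<close>
  define Z where "Z = \<Phi> * (x ^\<^sub>m j * (a * U))"
  have Z[simp]: "dim_row Z = n" "dim_col Z = n" by (simp_all add: Z_def)
  have "Z = 0\<^sub>m n n"
  proof (rule mtrace_nondegenerate[OF Z])
    fix W :: "'k mat" assume W[simp]: "dim_row W = n" "dim_col W = n"
    define E where "E = U * (W * \<Phi>)"
    have E[simp]: "dim_row E = n" "dim_col E = n" by (simp_all add: E_def)
    have yE: "?y * E = 0\<^sub>m n n"
    proof -
      have "?y * E = (?y * U) * (W * \<Phi>)" unfolding E_def by (simp add: mat_mult_assoc del: pow_mat.simps)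
      then show ?thesis unfolding yU by simp
    qed
    have Ey: "E * ?y = 0\<^sub>m n n"
    proof -
      have "E * ?y = U * (W * (\<Phi> * ?y))" unfolding E_def by (simp add: mat_mult_assoc del: pow_mat.simps)
      then show ?thesis unfolding \<Phi>y by simp
    qed
    define t where "t i = x ^\<^sub>m i * (E * x ^\<^sub>m (Suc j - i))" for i
    define s where "s i = x ^\<^sub>m i * (E * x ^\<^sub>m (j - i))" for i
    have [simp]: "dim_row (t i) = n" "dim_col (t i) = n" "dim_row (s i) = n" "dim_col (s i) = n" for i
      by (simp_all add: t_def s_def)
    define C where "C = msum n n s {..<Suc j}"
    have C[simp]: "dim_row C = n" "dim_col C = n" by (simp_all add: C_def)
    have sx: "s i * x = t i" if "i < Suc j" for i
    proof -
      have "Suc j - i = Suc (j - i)" using that by simp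
      then show ?thesis by (simp add: s_def t_def mat_mult_assoc)
    qed
    have xs: "x * s i = t (Suc i)" for i
    proof -
      have "x * s i = (x * x ^\<^sub>m i) * (E * x ^\<^sub>m (j - i))" by (simp add: s_def mat_mult_assoc)
      also have "x * x ^\<^sub>m i = x ^\<^sub>m Suc i" by (rule mat_pow_Suc_left[symmetric]) simp_all
      finally show ?thesis by (simp add: t_def del: pow_mat.simps)
    qed
    have t0: "t 0 = 0\<^sub>m n n" and tS: "t (Suc j) = 0\<^sub>m n n"
      using yE Ey by (simp_all add: t_def del: pow_mat.simps(2))
    \<comment> \<open>The difference telescopes to \<open>t (Suc j)\<close> minus
      \<open>t 0\<close>, and these are y E and E y, both zero.\<close>
    have "C * x = x * C"
    proof (rule eq_matI)
      fix r c assume "r < dim_row (x * C)" "c < dim_col (x * C)"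
      then have rc: "r < n" "c < n" by auto
      have "(C * x) $$ (r, c) = (\<Sum>i<Suc j. t i $$ (r, c))"
        using rc unfolding C_def by (subst msum_mult) (auto simp: sx simp del: sum.lessThan_Suc)
      moreover have "(x * C) $$ (r, c) = (\<Sum>i<Suc j. t (Suc i) $$ (r, c))"
        using rc unfolding C_def by (subst mult_msum) (auto simp: xs simp del: sum.lessThan_Suc)
      moreover have "(\<Sum>i<Suc j. t (Suc i) $$ (r, c) - t i $$ (r, c)) = 0"
        using sum_lessThan_telescope[of "\<lambda>i. t i $$ (r, c)" "Suc j"] rc by (simp add: t0 tS del: sum.lessThan_Suc)
      ultimately show "(C * x) $$ (r, c) = (x * C) $$ (r, c)"
        by (simp add: sum_subtractf del: sum.lessThan_Suc)
    qed simp_all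
    then have "mtrace (C * a) = 0" by (rule neg[OF C])
    \<comment> \<open>As a commutes with x, cyclicity collects all powers of x into x^j. The j + 1
      summands of C contribute equally, and their number, the size of the Jordan block, is
      invertible in k.\<close>
    moreover have "mtrace (s i * a) = mtrace (W * Z)" if i: "i < Suc j" for i
    proof -
      have "mtrace (s i * a) = mtrace (x ^\<^sub>m i * (E * (x ^\<^sub>m (j - i) * a)))" by (simp add: s_def mat_mult_assoc)
      also have "\<dots> = mtrace ((E * (x ^\<^sub>m (j - i) * a)) * x ^\<^sub>m i)" by (rule mtrace_comm) simp_all
      also have "\<dots> = mtrace (E * (x ^\<^sub>m (j - i) * (a ^\<^sub>m 1 * x ^\<^sub>m i)))" by (simp add: mat_mult_assoc)
      also have "a ^\<^sub>m 1 * x ^\<^sub>m i = x ^\<^sub>m i * a ^\<^sub>m 1" by (rule mat_pow_commute) (use comm in simp_all)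
      also have "E * (x ^\<^sub>m (j - i) * (x ^\<^sub>m i * a ^\<^sub>m 1)) = E * ((x ^\<^sub>m (j - i) * x ^\<^sub>m i) * a)"
        by (simp add: mat_mult_assoc)
      also have "x ^\<^sub>m (j - i) * x ^\<^sub>m i = x ^\<^sub>m j"
        using i by (subst mat_pow_add[symmetric, of _ n]) simp_all
      also have "mtrace (E * (x ^\<^sub>m j * a)) = mtrace (U * (W * (\<Phi> * (x ^\<^sub>m j * a))))"
        by (simp add: E_def mat_mult_assoc)
      also have "\<dots> = mtrace ((W * (\<Phi> * (x ^\<^sub>m j * a))) * U)" by (rule mtrace_comm) simp_all
      also have "\<dots> = mtrace (W * Z)" by (simp add: Z_def mat_mult_assoc)
      finally show ?thesis .
    qed
    then have "mtrace (C * a) = of_nat (Suc j) * mtrace (W * Z)"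
      unfolding C_def by (subst msum_mult) (simp_all add: mtrace_msum del: sum.lessThan_Suc of_nat_Suc)
    ultimately show "mtrace (W * Z) = 0" using k by simp
  qed
  moreover have "Z * V = x ^\<^sub>m j * (a * V) - ?y * (q * (x ^\<^sub>m j * (a * V)))"
  proof -
    have "Z * V = \<Phi> * (x ^\<^sub>m j * (a * (U * V)))" by (simp add: Z_def mat_mult_assoc)
    then show ?thesis unfolding UV by (simp add: \<Phi>_def mat_minus_mult mat_mult_assoc del: pow_mat.simps)
  qed
  ultimately have "x ^\<^sub>m j * (a * V) - ?y * (q * (x ^\<^sub>m j * (a * V))) = 0\<^sub>m n m" by simp
  then have "x ^\<^sub>m j * (a * V) = ?y * (q * (x ^\<^sub>m j * (a * V)))"
    by (subst (asm) mat_minus_self_eq_0_iff) (simp_all del: pow_mat.simps)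
  then show ?thesis by (intro exI[of _ "q * (x ^\<^sub>m j * (a * V))"]) simp
qed

text \<open>The induction carries V rather than a^j U, because the step applies to columns in the
  kernel of x^(j+1). The new columns lie in the next kernel since x^(j+2) V' = x a^(j+1) U = a^(j+1)
  x U = 0.\<close>

lemma negligible_power_kernel:
  assumes U: "dim_row U = n" "dim_col U = m" "x * U = 0\<^sub>m n m"
    and k: "\<And>i. 0 < i \<Longrightarrow> i \<le> j \<Longrightarrow> of_nat i \<noteq> (0 :: 'k)"
  shows "\<exists>V. dim_row V = n \<and> dim_col V = m \<and> a ^\<^sub>m j * U = x ^\<^sub>m j * V \<and> x ^\<^sub>m Suc j * V = 0\<^sub>m n m"
  using k
proof (induction j)
  case 0
  then show ?case using U x a by (intro exI[of _ U]) simp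
next
  case (Suc j)
  note [simp] = x a U(1,2)
  obtain V where V[simp]: "dim_row V = n" "dim_col V = m" and aU: "a ^\<^sub>m j * U = x ^\<^sub>m j * V"
    and xV: "x ^\<^sub>m Suc j * V = 0\<^sub>m n m"
    using Suc by auto
  have "of_nat (Suc j) \<noteq> (0 :: 'k)" using Suc.prems[of "Suc j"] by blast
  from negligible_kernel_step[OF this V xV] obtain V'
    where V'[simp]: "dim_row V' = n" "dim_col V' = m" and e: "x ^\<^sub>m j * (a * V) = x ^\<^sub>m Suc j * V'" by blast
  have "a ^\<^sub>m Suc j * U = a ^\<^sub>m 1 * (a ^\<^sub>m j * U)"
    by (subst mat_pow_Suc_left[of _ n]) (simp_all add: mat_mult_assoc)
  also have "\<dots> = (a ^\<^sub>m 1 * x ^\<^sub>m j) * V" unfolding aU by (simp add: mat_mult_assoc)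
  also have "a ^\<^sub>m 1 * x ^\<^sub>m j = x ^\<^sub>m j * a ^\<^sub>m 1" by (rule mat_pow_commute) (use comm in simp_all)
  also have "\<dots> * V = x ^\<^sub>m Suc j * V'" unfolding e[symmetric] by (simp add: mat_mult_assoc)
  finally have 1: "a ^\<^sub>m Suc j * U = x ^\<^sub>m Suc j * V'" .
  have "x ^\<^sub>m Suc (Suc j) * V' = x ^\<^sub>m 1 * (x ^\<^sub>m Suc j * V')"
    by (subst mat_pow_Suc_left[of _ n]) (simp_all add: mat_mult_assoc)
  also have "\<dots> = (x ^\<^sub>m 1 * a ^\<^sub>m Suc j) * U" unfolding 1[symmetric] by (simp add: mat_mult_assoc)
  also have "x ^\<^sub>m 1 * a ^\<^sub>m Suc j = a ^\<^sub>m Suc j * x ^\<^sub>m 1" by (rule mat_pow_commute) (use comm in simp_all)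
  also have "\<dots> * U = a ^\<^sub>m Suc j * (x * U)" by (simp add: mat_mult_assoc)
  also have "\<dots> = 0\<^sub>m n m" unfolding U(3) by simp
  finally show ?case using 1 by (intro exI[of _ V']) simp
qed

end

text \<open>The condition \<open>kill\<close> says c = D x with D = c q. Since c commutes with x,
  induction gives c^j = D^j x^j.\<close>

lemma nilpotent_if_kills_kernel:
  fixes x c :: "'k::field mat"
  assumes x: "dim_row x = n" "dim_col x = n" and c: "dim_row c = n" "dim_col c = n"
    and q: "dim_row q = n" "dim_col q = n"
    and comm: "c * x = x * c" and kill: "c * (1\<^sub>m n - q * x) = 0\<^sub>m n n" and nil: "x ^\<^sub>m p = 0\<^sub>m n n"
  shows "c ^\<^sub>m p = 0\<^sub>m n n"
proof -
  note [simp] = x c q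
  define D where "D = c * q"
  have [simp]: "dim_row D = n" "dim_col D = n" by (simp_all add: D_def)
  have "c - D * x = 0\<^sub>m n n" using kill by (simp add: D_def mat_mult_minus mat_mult_assoc)
  then have cD: "c = D * x" by (subst (asm) mat_minus_self_eq_0_iff) simp_all
  have "c ^\<^sub>m j = D ^\<^sub>m j * x ^\<^sub>m j" for j
  proof (induction j)
    case (Suc j)
    have "c ^\<^sub>m Suc j = D ^\<^sub>m j * (x ^\<^sub>m j * c ^\<^sub>m 1)" by (simp add: Suc mat_mult_assoc)
    also have "x ^\<^sub>m j * c ^\<^sub>m 1 = c ^\<^sub>m 1 * x ^\<^sub>m j" by (rule mat_pow_commute) (use comm in simp_all)
    also have "\<dots> = c * x ^\<^sub>m j" by simp
    also have "\<dots> = D * (x * x ^\<^sub>m j)" by (subst cD) (simp add: mat_mult_assoc)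
    also have "x * x ^\<^sub>m j = x ^\<^sub>m Suc j" by (rule mat_pow_Suc_left[symmetric]) simp_all
    finally show ?case by (simp add: mat_mult_assoc)
  qed simp
  then show ?thesis by (simp add: nil)
qed

text \<open>Frobenius gives (X - 1)^p = X^p - 1, and one factor X - 1 can be cancelled. Evaluated at
  \<sigma>, the identities say that x = \<sigma> - 1 has x^p = 0 and that x^(p-1) is the sum of all
  group elements.\<close>

lemma sum_powers_prime_char:
  assumes "prime p" "CHAR('k::field) = p"
  shows "([:-1, 1:] :: 'k poly) ^ (p - 1) = (\<Sum>i<p. [:0, 1:] ^ i)"
    and "([:-1, 1:] :: 'k poly) ^ p = [:0, 1:] ^ p - 1"
proof -
  let ?X = "[:0, 1:] :: 'k poly"
  have p: "p > 0" using assms(1) by (simp add: prime_gt_0_nat)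
  have X: "[:-1, 1:] = ?X - 1" by (simp add: one_pCons)
  have "(?X - 1 + 1) ^ p = (?X - 1) ^ p + 1 ^ p"
    by (rule freshmans_dream) (use assms in simp_all)
  then have *: "(?X - 1) ^ p = ?X ^ p - 1" by (simp add: algebra_simps)
  then show "([:-1, 1:] :: 'k poly) ^ p = ?X ^ p - 1" by (simp only: X)
  have "(?X - 1) * (?X - 1) ^ (p - 1) = (?X - 1) ^ p"
    using p by (metis Suc_diff_1 power_Suc)
  also have "\<dots> = (?X - 1) * (\<Sum>i<p. ?X ^ i)" unfolding * by (rule power_diff_1_eq)
  finally have "(?X - 1) * (?X - 1) ^ (p - 1) = (?X - 1) * (\<Sum>i<p. ?X ^ i)" .
  moreover have "?X - 1 \<noteq> 0" by (simp add: one_pCons)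
  ultimately have "(?X - 1) ^ (p - 1) = (\<Sum>i<p. ?X ^ i)" by (metis mult_left_cancel)
  then show "([:-1, 1:] :: 'k poly) ^ (p - 1) = (\<Sum>i<p. ?X ^ i)" by (simp only: X)
qed

section \<open>Negligible homomorphisms\<close>

text \<open>The kernel of the trace pairing of Hom(M, N) with Hom(N, M).\<close>

definition negligible_hom ::
    "('g, 'z) monoid_scheme \<Rightarrow> ('g, 'k::field) rep \<Rightarrow> ('g, 'k) rep \<Rightarrow> 'k mat set" where
  "negligible_hom G M N = {f \<in> rep_hom G M N. \<forall>g\<in>rep_hom G N M. mtrace (g * f) = 0}"

lemma negligible_homD:
  assumes "f \<in> negligible_hom G M N"
  shows "f \<in> rep_hom G M N" "g \<in> rep_hom G N M \<Longrightarrow> mtrace (g * f) = 0"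
  using assms by (auto simp: negligible_hom_def)

context group
begin

lemma prime_order_powers:
  assumes "Coset.order G = p" "prime p"
  obtains \<sigma> where "\<sigma> \<in> carrier G" "bij_betw (\<lambda>i::nat. \<sigma> [^] i) {..<p} (carrier G)" "\<sigma> [^] p = \<one>"
proof -
  have card: "card (carrier G) = p" using assms by (simp add: Coset.order_def)
  have p: "p > 1" by (rule prime_gt_1_nat[OF assms(2)])
  then have fin: "finite (carrier G)" using card by (metis card.infinite not_less_zero)
  have "carrier G \<noteq> {\<one>}" using card p by auto
  then obtain \<sigma> where \<sigma>: "\<sigma> \<in> carrier G" "\<sigma> \<noteq> \<one>" using one_closed by blast
  have "ord \<sigma> dvd p" using ord_dvd_group_order[OF \<sigma>(1)] assms(1) by simp
  moreover have "ord \<sigma> \<noteq> 1" using ord_eq_1[OF \<sigma>(1)] \<sigma>(2) by blast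
  ultimately have ord: "ord \<sigma> = p" using assms(2) by (metis prime_nat_iff)
  have "{0..ord \<sigma> - 1} = {..<p}" using p ord by auto
  then have inj: "inj_on (\<lambda>i::nat. \<sigma> [^] i) {..<p}" using ord_inj[OF \<sigma>(1)] by simp
  have "(\<lambda>i::nat. \<sigma> [^] i) ` {..<p} = carrier G"
    by (rule card_subset_eq[OF fin]) (use \<sigma> inj card in \<open>auto simp: card_image\<close>)
  moreover have "\<sigma> [^] p = \<one>" using pow_ord_eq_1[OF \<sigma>(1)] ord by simp
  ultimately show ?thesis using that \<sigma>(1) inj by (auto simp: bij_betw_def)
qed

lemma rep_pow: "is_rep G M \<Longrightarrow> g \<in> carrier G \<Longrightarrow> snd M (g [^] (i :: nat)) = snd M g ^\<^sub>m i"
  by (induction i) (simp_all add: rep_one rep_mult)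

lemma mtrace_projective_hom:
  fixes M :: "('a, 'k::field) rep"
  assumes "finite (carrier G)" "is_rep G M" "f \<in> projective_hom G M M" "CHAR('k) dvd Coset.order G"
  shows "mtrace f = 0"
proof -
  obtain h where h: "dim_row h = fst M" "dim_col h = fst M" "f = trace_map G (carrier G) M M h"
    using projective_homE[OF assms(1,3,2,2)] by metis
  have "mtrace f = of_nat (Coset.order G) * mtrace h"
    unfolding h Coset.order_def by (rule mtrace_trace_map) (use assms h in auto)
  also have "of_nat (Coset.order G) = (0 :: 'k)" using assms(4) by (simp add: of_nat_eq_0_iff_char_dvd)
  finally show ?thesis by simp
qed

text \<open>
  Writing a relation \<open>a^m (1 - a r(a)) = 0\<close>, invertibility of \<open>1 - a r(a)\<close> makes \<open>a^m\<close> projective, and \<open>a\<close> is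
  the sum of the nilpotent \<open>a (1 - e^m)\<close> and the projective \<open>a e^m\<close> for \<open>e = a r(a)\<close>.
\<close>

lemma radical_imp_negligible:
  fixes M N :: "('a, 'k::field) rep"
  assumes fin: "finite (carrier G)" and M: "is_rep G M" and N: "is_rep G N"
    and dvd: "CHAR('k) dvd Coset.order G"
    and f: "f \<in> rep_hom G M N"
    and rad: "\<forall>g\<in>rep_hom G N M. \<exists>v\<in>rep_hom G M M. (1\<^sub>m (fst M) - g * f) * v - 1\<^sub>m (fst M) \<in> projective_hom G M M"
  shows "f \<in> negligible_hom G M N"
  unfolding negligible_hom_def
proof (intro CollectI conjI ballI f)
  fix g assume g: "g \<in> rep_hom G N M"
  define n where "n = fst M"
  define a where "a = g * f"
  have a: "a \<in> rep_hom G M M" unfolding a_def by (rule rep_hom_comp[OF M N M f g])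
  then have [simp]: "dim_row a = n" "dim_col a = n" using rep_homD(1,2)[OF a] by (auto simp: n_def)
  define X where "X = [:0, 1 :: 'k:]"
  note pe = peval_mult[of a n] peval_diff[of a n] peval_1[of a n] peval_X[of a n, folded X_def]
  note hom = rep_hom_peval[OF M a]
  obtain m r where mr: "peval a (X ^ m * (1 - X * r)) = 0\<^sub>m n n" using power_stabilizes[of a n] by (auto simp: X_def)
  define z where "z = peval a (X ^ m)"
  define u where "u = peval a (1 - X * r)"
  have [simp]: "dim_row z = n" "dim_col z = n" "dim_row u = n" "dim_col u = n" by (simp_all add: z_def u_def)
  have zu: "z * u = 0\<^sub>m n n" using mr by (simp add: peval_mult[of a n] z_def u_def)
  \<comment> \<open>The radical condition is tested on r(a) g instead of g, since composing it with
    f produces a r(a), the polynomial in the relation for a.\<close>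
  have "peval a r * g \<in> rep_hom G N M" by (rule rep_hom_comp[OF N M M g hom])
  then obtain v where v: "v \<in> rep_hom G M M" "(1\<^sub>m n - (peval a r * g) * f) * v - 1\<^sub>m n \<in> projective_hom G M M"
    using rad unfolding n_def by blast
  have [simp]: "dim_row v = n" "dim_col v = n" using rep_homD(1,2)[OF v(1)] by (auto simp: n_def)
  have "1\<^sub>m n - (peval a r * g) * f = u"
  proof -
    have "(peval a r * g) * f = peval a r * a"
      unfolding a_def using rep_homD(1,2)[OF f] rep_homD(1,2)[OF g] by (simp add: mat_mult_assoc)
    also have "\<dots> = peval a (X * r)" by (subst mult.commute) (simp only: pe \<open>dim_row a = n\<close> \<open>dim_col a = n\<close>)
    finally show ?thesis unfolding u_def by (simp add: peval_diff[of a n] peval_1[of a n])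
  qed
  with v have uv: "u * v - 1\<^sub>m n \<in> projective_hom G M M" by simp
  have z: "z \<in> rep_hom G M M" unfolding z_def by (rule hom)
  \<comment> \<open>Stably u is invertible while z u = 0, so z = a^m is stably zero.\<close>
  have "z * (u * v - 1\<^sub>m n) = (z * u) * v - z" by (simp add: mat_mult_minus mat_mult_assoc)
  also have "\<dots> = - z" unfolding zu by (rule eq_matI) simp_all
  finally have "- z \<in> projective_hom G M M" using projective_hom_comp_left[OF fin M M M uv z] by simp
  then have zP: "z \<in> projective_hom G M M" using projective_hom_uminus[OF fin M M] by fastforce
  define e where "e = X * r"
  have "peval a (X * e ^ m) = z * peval a (X * r ^ m)"
    unfolding z_def by (subst peval_mult[of a n, symmetric]) (simp_all add: e_def power_mult_distrib mult_ac)
  then have "peval a (X * e ^ m) \<in> projective_hom G M M"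
    using projective_hom_comp_right[OF fin M M M zP hom] by simp
  then have tr1: "mtrace (peval a (X * e ^ m)) = 0" by (rule mtrace_projective_hom[OF fin M _ dvd])
  \<comment> \<open>The polynomial 1 - e divides 1 - e^m, so the power of exponent m + 1 is a
    multiple of X^m (1 - e), which annihilates a.\<close>
  have tr2: "mtrace (peval a (X * (1 - e ^ m))) = 0"
  proof (rule mtrace_nilpotent[of _ n])
    have "(X * (1 - e ^ m)) ^ Suc m = X ^ m * ((1 - e) * (\<Sum>i<m. e ^ (m - Suc i))) * (X * (1 - e ^ m) ^ m)"
      by (subst one_diff_power_eq'[symmetric]) (simp add: power_mult_distrib mult_ac)
    also have "\<dots> = (X ^ m * (1 - e)) * ((\<Sum>i<m. e ^ (m - Suc i)) * (X * (1 - e ^ m) ^ m))"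
      by (simp only: mult.assoc)
    finally show "peval a (X * (1 - e ^ m)) ^\<^sub>m Suc m = 0\<^sub>m n n"
      by (subst peval_power[of a n, symmetric]) (simp_all add: peval_mult[of a n] mr[folded e_def, unfolded peval_mult[OF \<open>dim_row a = n\<close> \<open>dim_col a = n\<close>]] del: power_Suc)
  qed simp_all
  have "peval a (X * (1 - e ^ m) + X * e ^ m) = peval a X" by (simp add: algebra_simps)
  then have "a = peval a (X * (1 - e ^ m)) + peval a (X * e ^ m)"
    by (simp only: peval_add[of a n] pe \<open>dim_row a = n\<close> \<open>dim_col a = n\<close>)
  then have "mtrace a = mtrace (peval a (X * (1 - e ^ m))) + mtrace (peval a (X * e ^ m))"
    by (metis mtrace_add peval_dims \<open>dim_row a = n\<close> \<open>dim_col a = n\<close>)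
  then show "mtrace (g * f) = 0" using tr1 tr2 by (simp add: a_def)
qed

text \<open>Modulo projectives a^(p-1) equals an endomorphism c that kills the kernel of x. Then c
  is a multiple of x, so c^p = 0 because x^p = 0, and this costs the second factor p of the
  exponent.\<close>

lemma prime_order_negligible_nilpotent:
  fixes M :: "('a, 'k::field) rep"
  assumes ord: "Coset.order G = p" and p: "prime p" "CHAR('k) = p" and M: "is_rep G M"
    and a: "a \<in> negligible_hom G M M"
  shows "a ^\<^sub>m ((p - 1) * p) \<in> projective_hom G M M"
proof -
  define n where "n = fst M"
  obtain \<sigma> where \<sigma>: "\<sigma> \<in> carrier G" "bij_betw (\<lambda>i::nat. \<sigma> [^] i) {..<p} (carrier G)" "\<sigma> [^] p = \<one>"
    using prime_order_powers[OF ord p(1)] by blast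
  have fin: "finite (carrier G)" using \<sigma>(2) bij_betw_finite by blast
  define S where "S = snd M \<sigma>"
  have S[simp]: "dim_row S = n" "dim_col S = n" using M \<sigma> by (simp_all add: S_def n_def)
  have ah: "a \<in> rep_hom G M M" by (rule negligible_homD(1)[OF a])
  have [simp]: "dim_row a = n" "dim_col a = n" using rep_homD(1,2)[OF ah] by (auto simp: n_def)
  \<comment> \<open>Every group element is a power of \<sigma>, so commuting with \<sigma> is
    enough.\<close>
  have homI: "c \<in> rep_hom G M M" if c: "dim_row c = n" "dim_col c = n" "c * S = S * c" for c
  proof (rule rep_homI)
    fix g assume "g \<in> carrier G"
    then obtain i where "g = \<sigma> [^] (i :: nat)" using \<sigma>(2) by (auto simp: bij_betw_def)
    then have g: "snd M g = S ^\<^sub>m i" using rep_pow[OF M \<sigma>(1)] by (simp add: S_def)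
    have "c ^\<^sub>m 1 * S ^\<^sub>m i = S ^\<^sub>m i * c ^\<^sub>m 1" by (rule mat_pow_commute) (use c in simp_all)
    then show "c * snd M g = snd M g * c" using c by (simp add: g)
  qed (use c in \<open>simp_all add: n_def\<close>)
  define x where "x = peval S [:-1, 1:]"
  have x_eq: "x = S - 1\<^sub>m n"
  proof -
    have "[:-1, 1:] = [:0, 1:] - (1 :: 'k poly)" by (simp add: one_pCons)
    then show ?thesis unfolding x_def by (simp only: peval_diff[OF S] peval_X[OF S] peval_1[OF S])
  qed
  have [simp]: "dim_row x = n" "dim_col x = n" by (simp_all add: x_eq)
  have comm_x_iff: "c * x = x * c \<longleftrightarrow> c * S = S * c" if [simp]: "dim_row c = n" "dim_col c = n" for c
  proof -
    have "c * x = c * S - c" "x * c = S * c - c"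
      unfolding x_eq by (simp_all add: mat_mult_minus mat_minus_mult)
    moreover have "A = B" if "A - c = B - c" "dim_row A = n" "dim_col A = n" "dim_row B = n" "dim_col B = n" for A B
    proof (rule eq_matI)
      fix i j assume ij: "i < dim_row B" "j < dim_col B"
      have "(A - c) $$ (i, j) = (B - c) $$ (i, j)" by (simp only: that(1))
      then show "A $$ (i, j) = B $$ (i, j)" using ij that(2-) \<open>dim_row c = n\<close> \<open>dim_col c = n\<close> by simp
    qed (use that in simp_all)
    ultimately show ?thesis by (metis S that index_mult_mat(2,3))
  qed
  have xp: "x ^\<^sub>m p = 0\<^sub>m n n"
  proof -
    have "x ^\<^sub>m p = peval S ([:-1, 1:] ^ p)" unfolding x_def by (rule peval_power[OF S, symmetric])
    also have "\<dots> = S ^\<^sub>m p - 1\<^sub>m n"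
      unfolding sum_powers_prime_char(2)[OF p] by (simp add: peval_diff[OF S] peval_power[OF S] peval_X[OF S] peval_1[OF S])
    also have "S ^\<^sub>m p = 1\<^sub>m n" using rep_pow[OF M \<sigma>(1), of p] \<sigma>(3) rep_one[OF M] by (simp add: S_def n_def)
    finally show ?thesis by (simp add: mat_eq_iff)
  qed
  have xp1: "(x ^\<^sub>m (p - 1)) $$ (i, j) = (\<Sum>k<p. (S ^\<^sub>m k) $$ (i, j))" if "i < n" "j < n" for i j
  proof -
    have "x ^\<^sub>m (p - 1) = peval S ([:-1, 1:] ^ (p - 1))" unfolding x_def by (rule peval_power[OF S, symmetric])
    also have "\<dots> = peval S (\<Sum>k<p. Polynomial.monom 1 k)"
      unfolding sum_powers_prime_char(1)[OF p] by (simp add: monom_altdef)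
    finally show ?thesis using peval_index_sum_monom[OF S, of "{..<p}" i j "\<lambda>_. 1"] that by simp
  qed
  have ax: "a * x = x * a" using comm_x_iff[of a] rep_homD(3)[OF ah \<sigma>(1)] by (simp add: S_def)
  obtain q where q[simp]: "dim_row q = n" "dim_col q = n" and xqx: "x * (q * x) = x"
    using ginverse_exists[of x] by auto
  define U where "U = 1\<^sub>m n - q * x"
  have U[simp]: "dim_row U = n" "dim_col U = n" by (simp_all add: U_def)
  have xU: "x * U = 0\<^sub>m n n" unfolding U_def by (simp add: mat_mult_minus xqx mat_eq_iff)
  have UU: "U * U = U"
  proof -
    have "U * U = U - q * (x * U)" by (subst U_def) (simp add: mat_minus_mult mat_mult_assoc)
    then show ?thesis unfolding xU by (simp add: mat_eq_iff)
  qed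
  have "\<exists>V. dim_row V = n \<and> dim_col V = n \<and> a ^\<^sub>m (p - 1) * U = x ^\<^sub>m (p - 1) * V \<and> x ^\<^sub>m Suc (p - 1) * V = 0\<^sub>m n n"
  proof (rule negligible_power_kernel)
    show "mtrace (c * a) = 0" if "dim_row c = n" "dim_col c = n" "c * x = x * c" for c
      using negligible_homD(2)[OF a homI] that comm_x_iff by blast
    \<comment> \<open>The climb stops at p - 1, the last block size that is nonzero in k; blocks of
      size p are the free ones.\<close>
    show "of_nat i \<noteq> (0 :: 'k)" if "0 < i" "i \<le> p - 1" for i
      using that p by (auto simp: of_nat_eq_0_iff_char_dvd dest!: dvd_imp_le)
  qed (simp_all add: ax xU)
  then obtain V where V[simp]: "dim_row V = n" "dim_col V = n" and aU: "a ^\<^sub>m (p - 1) * U = x ^\<^sub>m (p - 1) * V"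
    by blast
  define b where "b = a ^\<^sub>m (p - 1)"
  have b[simp]: "dim_row b = n" "dim_col b = n" by (simp_all add: b_def)
  have bh: "b \<in> rep_hom G M M"
    using rep_hom_peval[OF M ah, of "[:0, 1:] ^ (p - 1)"] by (simp add: b_def peval_power[of a n] peval_X[of a n])
  \<comment> \<open>The columns V with a^(p-1) U = x^(p-1) V are only linear data. Their trace is a
    projective endomorphism, and it agrees with b on the kernel of x.\<close>
  define B where "B = trace_map G (carrier G) M M V"
  have BP: "B \<in> projective_hom G M M" unfolding B_def
    by (rule trace_map_in_projective_hom[OF fin M M]) (simp_all add: n_def[symmetric])
  then have Bh: "B \<in> rep_hom G M M" using projective_hom_subset[OF fin M M] by blast
  have B[simp]: "dim_row B = n" "dim_col B = n" by (simp_all add: B_def n_def)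
  have "B * U = x ^\<^sub>m (p - 1) * V * U"
  proof -
    \<comment> \<open>The group acts trivially on the kernel of x. On U the inner factors of the
      trace therefore disappear, and the outer ones add up to x^(p-1).\<close>
    have hU: "snd M g * U = U" if "g \<in> carrier G" for g
    proof -
      have "g \<in> (\<lambda>i::nat. \<sigma> [^] i) ` {..<p}" using that \<sigma>(2) by (simp add: bij_betw_def)
      then obtain i where i: "g = \<sigma> [^] (i :: nat)" by blast
      have SU: "S * U = U"
      proof -
        have "S * U - U = x * U" unfolding x_eq by (simp add: mat_minus_mult)
        then show ?thesis unfolding xU by (subst (asm) mat_minus_self_eq_0_iff) simp_all
      qed
      have "S ^\<^sub>m i * U = U" for i by (induction i) (simp_all add: mat_mult_assoc SU)
      then show ?thesis using rep_pow[OF M \<sigma>(1)] by (simp add: i S_def)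
    qed
    have "B * U = msum n n (\<lambda>g. snd M g * (V * snd M (inv g)) * U) (carrier G)"
      unfolding B_def trace_map_def n_def[symmetric] using M by (subst msum_mult) (simp_all add: n_def[symmetric])
    also have "\<dots> = msum n n (\<lambda>g. snd M g * (V * U)) (carrier G)"
      by (rule msum_cong[OF refl]) (use M in \<open>simp add: mat_mult_assoc n_def[symmetric] hU\<close>)
    also have "\<dots> = msum n n (snd M) (carrier G) * (V * U)"
      using M by (subst msum_mult) (simp_all add: n_def[symmetric])
    also have "msum n n (snd M) (carrier G) = msum n n (\<lambda>i. snd M (\<sigma> [^] (i :: nat))) {..<p}"
      by (rule msum_reindex[OF \<sigma>(2)])
    also have "\<dots> = x ^\<^sub>m (p - 1)"
      by (rule eq_matI)
        (use mat_pow_dims[of x n "p - 1"] in \<open>auto simp: rep_pow[OF M \<sigma>(1)] xp1[unfolded One_nat_def] S_def[symmetric]\<close>)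
    finally show ?thesis by (simp add: mat_mult_assoc)
  qed
  also have "\<dots> = b * U" unfolding aU[symmetric] b_def by (simp add: mat_mult_assoc UU)
  finally have BU: "B * U = b * U" .
  define c where "c = b - B"
  have ch: "c \<in> rep_hom G M M" unfolding c_def by (rule rep_hom_minus[OF M M bh Bh])
  have c[simp]: "dim_row c = n" "dim_col c = n" by (simp_all add: c_def)
  have "c ^\<^sub>m p = 0\<^sub>m n n"
  proof (rule nilpotent_if_kills_kernel[of x n c q])
    show "c * x = x * c" using comm_x_iff[of c] rep_homD(3)[OF ch \<sigma>(1)] by (simp add: S_def)
    have "c * U = b * U - B * U" by (simp add: c_def mat_minus_mult)
    then show "c * (1\<^sub>m n - q * x) = 0\<^sub>m n n" unfolding BU U_def[symmetric] by (simp add: mat_eq_iff)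
  qed (simp_all add: xp)
  \<comment> \<open>Projective endomorphisms form an ideal, so b and c, which differ by the
    projective B, have stably equal powers.\<close>
  moreover have "b ^\<^sub>m j - c ^\<^sub>m j \<in> projective_hom G M M" for j
  proof (induction j)
    case 0
    have e: "(1\<^sub>m n :: 'k mat) - 1\<^sub>m n = 0\<^sub>m n n" by (simp add: mat_eq_iff)
    show ?case
      using projective_hom_zero[OF fin M M] unfolding n_def[symmetric] pow_mat.simps b(1) c(1) e .
  next
    case (Suc j)
    have bj: "b ^\<^sub>m j \<in> rep_hom G M M"
      using rep_hom_peval[OF M bh, of "[:0, 1:] ^ j"] by (simp add: peval_power[of b n] peval_X[of b n])
    have "b - c = B" by (rule eq_matI) (simp_all add: c_def)
    then have "b ^\<^sub>m Suc j - c ^\<^sub>m Suc j = b ^\<^sub>m j * B + (b ^\<^sub>m j - c ^\<^sub>m j) * c"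
      by (intro eq_matI) (simp_all add: mat_minus_mult mat_mult_minus flip: \<open>b - c = B\<close> del: index_mult_mat(1))
    moreover have "b ^\<^sub>m j * B \<in> projective_hom G M M" by (rule projective_hom_comp_left[OF fin M M M BP bj])
    moreover have "(b ^\<^sub>m j - c ^\<^sub>m j) * c \<in> projective_hom G M M"
      by (rule projective_hom_comp_right[OF fin M M M Suc ch])
    ultimately show ?case using projective_hom_add[OF fin M M] by simp
  qed
  ultimately have "b ^\<^sub>m p - 0\<^sub>m n n \<in> projective_hom G M M" by metis
  moreover have "b ^\<^sub>m p - 0\<^sub>m n n = b ^\<^sub>m p"
    by (rule eq_matI) (use mat_pow_dims[of b n p] in auto)
  moreover have "b ^\<^sub>m p = a ^\<^sub>m ((p - 1) * p)"
    using peval_power[of a n "[:0, 1:]"] peval_power[of a n "[:0, 1:] ^ (p - 1)"] peval_X[of a n]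
    unfolding b_def by (metis power_mult \<open>dim_row a = n\<close> \<open>dim_col a = n\<close>)
  ultimately show ?thesis by simp
qed

text \<open>The index of H, of order p, is invertible in k. For an endomorphism c over H, the
  relative trace of c is one over G, and composed with a it has trace [G:H] tr(c a); so a remains
  negligible over H. The power of a that is projective over H is then brought back by transitivity
  of traces.\<close>

lemma negligible_stably_nilpotent:
  fixes M :: "('a, 'k::field) rep"
  assumes fin: "finite (carrier G)" and p: "prime p" "CHAR('k) = p" and dvd: "p dvd Coset.order G"
    and ndvd: "\<not> p ^ 2 dvd Coset.order G" and M: "is_rep G M" and a: "a \<in> negligible_hom G M M"
  shows "a ^\<^sub>m ((p - 1) * p) \<in> projective_hom G M M"
proof -
  obtain m where "Coset.order G = p ^ 1 * m" using dvd by (auto elim: dvdE)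
  from sylow_thm[OF p(1) is_group this fin] obtain H where H: "subgroup H G" "card H = p" by auto
  define Q where "Q = G\<lparr>carrier := H\<rparr>"
  interpret Q: Group.group Q unfolding Q_def by (rule subgroup_imp_group[OF H(1)])
  have HG: "H \<subseteq> carrier G" by (rule subgroup.subset[OF H(1)])
  have Qs: "carrier Q = H" "\<And>g h. g \<otimes>\<^bsub>Q\<^esub> h = g \<otimes> h" "\<one>\<^bsub>Q\<^esub> = \<one>" by (simp_all add: Q_def)
  have Qinv: "inv\<^bsub>Q\<^esub> g = inv g" if "g \<in> H" for g unfolding Q_def by (rule m_inv_consistent[OF H(1) that])
  have MQ: "is_rep Q M" using M HG by (auto simp: is_rep_def Qs)
  have trQ: "trace_map Q H M M h = trace_map G H M M h" for h
    unfolding trace_map_def by (rule msum_cong) (simp_all add: Qinv)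
  obtain T where T: "T \<subseteq> carrier G" "card T * card H = Coset.order G"
    "bij_betw (\<lambda>(t, h). t \<otimes> h) (T \<times> H) (carrier G)"
    using left_transversal_exists[OF fin H(1)] by blast
  have "\<not> p dvd card T"
  proof
    assume "p dvd card T"
    then have "p * p dvd card T * card H" unfolding H(2) by (rule mult_dvd_mono) simp
    then show False using ndvd T(2) by (simp add: power2_eq_square)
  qed
  then have cT: "of_nat (card T) \<noteq> (0 :: 'k)" using p by (simp add: of_nat_eq_0_iff_char_dvd)
  note ah = negligible_homD(1)[OF a]
  note ad = rep_homD(1,2)[OF ah]
  have "a \<in> negligible_hom Q M M"
    unfolding negligible_hom_def
  proof (intro CollectI conjI ballI)
    show "a \<in> rep_hom Q M M" using ah HG by (auto simp: rep_hom_def Qs)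
    fix c assume "c \<in> rep_hom Q M M"
    note c = rep_homD[OF this, unfolded Qs]
    have "trace_map G T M M c \<in> rep_hom G M M"
      by (rule relative_trace_in_rep_hom[OF fin H(1) T(1,3) M M]) (use c in auto)
    then have "0 = mtrace (trace_map G T M M c * a)" using negligible_homD(2)[OF a] by simp
    also have "trace_map G T M M c * a = trace_map G T M M (c * a)"
      by (rule trace_map_mult_rep_hom) (use M T ah c in auto)
    also have "mtrace \<dots> = of_nat (card T) * mtrace (c * a)"
      by (rule mtrace_trace_map) (use M T ad c in auto)
    finally show "mtrace (c * a) = 0" using cT by simp
  qed
  then have "a ^\<^sub>m ((p - 1) * p) \<in> projective_hom Q M M"
    by (intro Q.prime_order_negligible_nilpotent p MQ) (simp_all add: Coset.order_def Qs H)
  moreover have "finite (carrier Q)" using HG fin by (auto simp: Qs intro: finite_subset)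
  ultimately obtain h where h: "dim_row h = fst M" "dim_col h = fst M"
    and ah': "a ^\<^sub>m ((p - 1) * p) = trace_map G H M M h"
    using Q.projective_homE[OF _ _ MQ MQ] by (metis Qs(1) trQ)
  let ?b = "a ^\<^sub>m ((p - 1) * p)"
  have b: "?b \<in> rep_hom G M M"
    using rep_hom_peval[OF M ah, of "[:0, 1:] ^ ((p - 1) * p)"] by (simp add: peval_power[OF ad] peval_X[OF ad])
  \<comment> \<open>The relative trace of a homomorphism over G is [G:H] times it, while the
    relative trace of a trace over H is a trace over G.\<close>
  have "of_nat (card T) \<cdot>\<^sub>m ?b = trace_map G T M M ?b"
    by (rule trace_map_rep_hom[symmetric]) (use M T b in auto)
  also have "\<dots> = trace_map G (carrier G) M M h"
    unfolding ah' by (rule trace_map_transitive) (use fin HG T M h in auto)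
  finally have "of_nat (card T) \<cdot>\<^sub>m ?b \<in> projective_hom G M M"
    using trace_map_in_projective_hom[OF fin M M h] by simp
  then have "inverse (of_nat (card T)) \<cdot>\<^sub>m (of_nat (card T) \<cdot>\<^sub>m ?b) \<in> projective_hom G M M"
    by (rule projective_hom_smult[OF fin M M])
  moreover have "inverse (of_nat (card T)) \<cdot>\<^sub>m (of_nat (card T) \<cdot>\<^sub>m ?b) = ?b"
    by (rule eq_matI) (use cT in simp_all)
  ultimately show ?thesis by simp
qed

text \<open>A power of g f is stably zero, so the finite geometric series in g f is a two-sided
  stable inverse of 1 - g f.\<close>

lemma negligible_imp_radical:
  fixes M N :: "('a, 'k::field) rep"
  assumes fin: "finite (carrier G)" and p: "prime p" "CHAR('k) = p" and dvd: "p dvd Coset.order G"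
    and ndvd: "\<not> p ^ 2 dvd Coset.order G" and M: "is_rep G M" and N: "is_rep G N"
    and f: "f \<in> negligible_hom G M N" and g: "g \<in> rep_hom G N M"
  shows "\<exists>v\<in>rep_hom G M M. (1\<^sub>m (fst M) - g * f) * v - 1\<^sub>m (fst M) \<in> projective_hom G M M \<and>
    v * (1\<^sub>m (fst M) - g * f) - 1\<^sub>m (fst M) \<in> projective_hom G M M"
proof -
  define n where "n = fst M"
  define a where "a = g * f"
  note fh = negligible_homD(1)[OF f]
  have a: "a \<in> rep_hom G M M" unfolding a_def by (rule rep_hom_comp[OF M N M fh g])
  then have d: "dim_row a = n" "dim_col a = n" using rep_homD(1,2)[OF a] by (auto simp: n_def)
  have "mtrace (c * a) = 0" if c: "c \<in> rep_hom G M M" for c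
  proof -
    have "c * a = (c * g) * f"
      unfolding a_def using rep_homD(1,2)[OF c] rep_homD(1,2)[OF fh] rep_homD(1,2)[OF g] by (simp add: mat_mult_assoc)
    then show ?thesis using negligible_homD(2)[OF f rep_hom_comp[OF N M M g c]] by simp
  qed
  then have "a \<in> negligible_hom G M M" using a by (simp add: negligible_hom_def)
  define K where "K = (p - 1) * p"
  have aK: "a ^\<^sub>m K \<in> projective_hom G M M"
    unfolding K_def by (rule negligible_stably_nilpotent[OF fin p dvd ndvd M]) fact
  let ?X = "[:0, 1:] :: 'k poly"
  define v where "v = peval a (\<Sum>i<K. ?X ^ (K - Suc i))"
  have u: "1\<^sub>m n - g * f = peval a (1 - ?X)"
    by (simp only: peval_diff[OF d] peval_1[OF d] peval_X[OF d]) (simp only: a_def)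
  have "peval a ((1 - ?X) * (\<Sum>i<K. ?X ^ (K - Suc i))) = 1\<^sub>m n - a ^\<^sub>m K"
    unfolding one_diff_power_eq'[symmetric] by (simp add: peval_diff[OF d] peval_1[OF d] peval_power[OF d] peval_X[OF d])
  then have "peval a (1 - ?X) * v = 1\<^sub>m n - a ^\<^sub>m K" "v * peval a (1 - ?X) = 1\<^sub>m n - a ^\<^sub>m K"
    unfolding v_def by (metis peval_mult[OF d], metis peval_mult[OF d] mult.commute)
  moreover have "1\<^sub>m n - a ^\<^sub>m K - 1\<^sub>m n = - (a ^\<^sub>m K)"
    by (rule eq_matI) (use mat_pow_dims[OF d, of K] in auto)
  moreover have "- (a ^\<^sub>m K) \<in> projective_hom G M M" by (rule projective_hom_uminus[OF fin M M aK])
  moreover have "v \<in> rep_hom G M M" unfolding v_def by (rule rep_hom_peval[OF M a])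
  ultimately show ?thesis unfolding n_def[symmetric] u by (intro bexI[of _ v]) simp_all
qed

end

section \<open>Self-duality of permutation modules\<close>

lemma kronecker_assoc:
  fixes A B C :: "'k::comm_ring_1 mat"
  shows "kronecker (kronecker A B) C = kronecker A (kronecker B C)"
proof -
  have index: "i div c div b = i div (b * c)" "i div c mod b = i mod (b * c) div c" "i mod c = i mod (b * c) mod c"
    "i mod (b * c) < b * c" "i div c < a * b" "i mod c < c" "i div c div b < a"
    "i div c mod b < b"
    if "i < a * b * c" for i a b c :: nat
  proof -
    have c: "c > 0" and b: "b > 0" using that by (auto intro!: gr0I)
    show "i div c div b = i div (b * c)" by (metis div_mult2_eq mult.commute)
    show "i mod c = i mod (b * c) mod c" by (simp add: mod_mod_cancel)
    show "i div c mod b = i mod (b * c) div c" using c by (subst mult.commute, subst mod_mult2_eq) simp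
    show "i mod (b * c) < b * c" "i mod c < c" "i div c mod b < b" using b c by simp_all
    show "i div c < a * b" using that by (simp add: less_mult_imp_div_less)
    then show "i div c div b < a" by (simp add: less_mult_imp_div_less)
  qed
  show ?thesis
  proof (rule eq_matI)
    fix i j assume "i < dim_row (kronecker A (kronecker B C))" "j < dim_col (kronecker A (kronecker B C))"
    then have ij: "i < dim_row A * dim_row B * dim_row C" "j < dim_col A * dim_col B * dim_col C"
      by (simp_all add: mult.assoc)
    then show "kronecker (kronecker A B) C $$ (i, j) = kronecker A (kronecker B C) $$ (i, j)"
      using index[OF ij(1)] index[OF ij(2)] by (simp add: kronecker_def mult.assoc)
  qed simp_all
qed

text \<open>Associativity is an equality in the chosen bases. The composite of coevaluation and
  evaluation can thus be formed on M \<otimes> M \<otimes> M without an associator.\<close>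

lemma rep_tensor_assoc: "rep_tensor (rep_tensor M N) K = rep_tensor M (rep_tensor N K)"
  by (simp add: rep_tensor_def kronecker_assoc mult.assoc)

lemma kronecker_one_right: "kronecker A (1\<^sub>m (Suc 0)) = (A :: 'k::comm_ring_1 mat)"
  by (rule eq_matI) (auto simp: kronecker_def)

lemma rep_tensor_trivial: "rep_tensor M trivial_rep = M"
  by (cases M) (simp add: rep_tensor_def trivial_rep_def kronecker_one_right)

text \<open>The vector \<open>\<Sum>\<^sub>i e\<^sub>i \<otimes> e\<^sub>i\<close>, which is invariant because permutation matrices are orthogonal.\<close>

definition diagonal_vector :: "nat \<Rightarrow> 'k::field mat" where
  "diagonal_vector n = mat (n * n) 1 (\<lambda>(l, _). if l div n = l mod n then 1 else 0)"

lemma diagonal_vector_dims[simp]: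
  "dim_row (diagonal_vector n) = n * n" "dim_col (diagonal_vector n) = 1"
  by (simp_all add: diagonal_vector_def)

lemma diagonal_vector_index:
  "i < n \<Longrightarrow> j < n \<Longrightarrow> diagonal_vector n $$ (i * n + j, 0) = (if i = j then 1 else 0)"
  by (simp add: diagonal_vector_def block_index_less)

lemma kronecker_mult_diagonal_vector:
  fixes A :: "'k::field mat"
  assumes A: "dim_row A = n" "dim_col A = n" and orth: "A * transpose_mat A = 1\<^sub>m n"
  shows "kronecker A A * diagonal_vector n = diagonal_vector n"
proof (rule eq_blockI[of _ n n _ 1 1])
  fix i j k l :: nat assume ij: "i < n" "j < 1" "k < n" "l < 1"
  have "(kronecker A A * diagonal_vector n) $$ (i * n + k, 0)
      = (\<Sum>t<n * n. kronecker A A $$ (i * n + k, t) * diagonal_vector n $$ (t, 0))"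
    using ij A by (subst mat_mult_index) (auto simp: block_index_less)
  also have "\<dots> = (\<Sum>s<n. \<Sum>t<n. if t = s then A $$ (i, s) * A $$ (k, s) else 0)"
    unfolding sum_lessThan_times
  proof (intro sum.cong refl)
    fix s t assume "s \<in> {..<n}" "t \<in> {..<n}"
    then show "kronecker A A $$ (i * n + k, s * n + t) * diagonal_vector n $$ (s * n + t, 0)
        = (if t = s then A $$ (i, s) * A $$ (k, s) else 0)"
      using ij A kronecker_index[of i A s k A t] by (simp add: diagonal_vector_index)
  qed
  also have "\<dots> = (A * transpose_mat A) $$ (i, k)"
    using ij A by (subst mat_mult_index) auto
  also have "\<dots> = diagonal_vector n $$ (i * n + k, 0)"
    unfolding orth using ij by (simp add: diagonal_vector_index)
  finally show "(kronecker A A * diagonal_vector n) $$ (i * n + k, j * 1 + l) = diagonal_vector n $$ (i * n + k, j * 1 + l)"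
    using ij by simp
qed (simp_all add: A)

lemma kronecker_transpose:
  "transpose_mat (kronecker A B) = kronecker (transpose_mat A) (transpose_mat (B :: 'k::comm_ring_1 mat))"
proof (rule eq_matI)
  fix i j assume "i < dim_row (kronecker (transpose_mat A) (transpose_mat B))"
    "j < dim_col (kronecker (transpose_mat A) (transpose_mat B))"
  then have ij: "i < dim_col A * dim_col B" "j < dim_row A * dim_row B" by auto
  then have "dim_col B > 0" "dim_row B > 0" by (auto intro!: gr0I)
  then show "transpose_mat (kronecker A B) $$ (i, j) = kronecker (transpose_mat A) (transpose_mat B) $$ (i, j)"
    using ij by (simp add: kronecker_def less_mult_imp_div_less)
qed auto

text \<open>The triangle identity for a self-dual object, with \<open>diagonal_vector\<close> as
  coevaluation and its transpose as evaluation. It is what makes the coevaluation tensored with the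
  module a split monomorphism.\<close>

lemma zigzag:
  "kronecker (1\<^sub>m n) (transpose_mat (diagonal_vector n)) * kronecker (diagonal_vector n) (1\<^sub>m n) = (1\<^sub>m n :: 'k::field mat)"
proof (rule eq_matI)
  let ?E = "transpose_mat (diagonal_vector n) :: 'k mat" and ?D = "diagonal_vector n :: 'k mat"
  fix i k assume "i < dim_row (1\<^sub>m n :: 'k mat)" "k < dim_col (1\<^sub>m n :: 'k mat)"
  then have ik: "i < n" "k < n" by auto
  have "(kronecker (1\<^sub>m n) ?E * kronecker ?D (1\<^sub>m n)) $$ (i, k)
      = (\<Sum>t<n * (n * n). kronecker (1\<^sub>m n) ?E $$ (i, t) * kronecker ?D (1\<^sub>m n) $$ (t, k))"
    using ik by (subst mat_mult_index) (auto simp: mult.assoc)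
  also have "\<dots> = (\<Sum>a<n. \<Sum>b<n. \<Sum>c<n. if c = k then if b = i then if a = i then if i = k then 1 else 0 else 0 else 0 else 0)"
    unfolding sum_lessThan_times
  proof (intro sum.cong refl)
    fix a b c assume "a \<in> {..<n}" "b \<in> {..<n}" "c \<in> {..<n}"
    then have abc: "a < n" "b < n" "c < n" by auto
    have 1: "kronecker (1\<^sub>m n) ?E $$ (i, a * (n * n) + (b * n + c)) = (if i = a \<and> b = c then 1 else 0)"
      using kronecker_index[of i "1\<^sub>m n" a 0 ?E "b * n + c"] ik abc
      by (simp add: block_index_less diagonal_vector_index)
    have 2: "kronecker ?D (1\<^sub>m n) $$ (a * (n * n) + (b * n + c), k) = (if a = b \<and> c = k then 1 else 0)"
    proof -
      have e: "a * (n * n) + (b * n + c) = (a * n + b) * n + c" by (simp add: algebra_simps)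
      show ?thesis
        unfolding e using kronecker_index[of "a * n + b" ?D 0 c "1\<^sub>m n" k] ik abc block_index_less[OF abc(1,2)]
        by (simp add: diagonal_vector_index del: add_mult_distrib)
    qed
    show "kronecker (1\<^sub>m n) ?E $$ (i, a * (n * n) + (b * n + c)) * kronecker ?D (1\<^sub>m n) $$ (a * (n * n) + (b * n + c), k)
      = (if c = k then if b = i then if a = i then if i = k then 1 else 0 else 0 else 0 else 0)"
      unfolding 1 2 by auto
  qed
  also have "\<dots> = (1\<^sub>m n :: 'k mat) $$ (i, k)" using ik by simp
  finally show "(kronecker (1\<^sub>m n) ?E * kronecker ?D (1\<^sub>m n)) $$ (i, k) = (1\<^sub>m n :: 'k mat) $$ (i, k)" .
qed simp_all

lemma perm_rep_orthogonal:
  assumes bij: "bij_betw xs {..<n} X" and act: "bij_betw (act g) X X"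
  shows "snd (perm_rep n xs act) g * transpose_mat (snd (perm_rep n xs act) g) = (1\<^sub>m n :: 'k::field mat)"
    "transpose_mat (snd (perm_rep n xs act) g) * snd (perm_rep n xs act) g = (1\<^sub>m n :: 'k::field mat)"
proof -
  let ?A = "snd (perm_rep n xs act) g :: 'k mat"
  have inj: "inj_on xs {..<n}" and im: "xs ` {..<n} = X" using bij by (auto simp: bij_betw_def)
  have ex: "\<exists>k<n. xs k = x" if "x \<in> X" for x using that im by blast
  show "?A * transpose_mat ?A = 1\<^sub>m n"
  proof (rule eq_matI)
    fix i j assume "i < dim_row (1\<^sub>m n :: 'k mat)" "j < dim_col (1\<^sub>m n :: 'k mat)"
    then have ij: "i < n" "j < n" by auto
    then have "xs i \<in> act g ` X" using act im by (auto simp: bij_betw_def)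
    then obtain k where k: "k < n" "xs i = act g (xs k)" using im by blast
    have "(?A * transpose_mat ?A) $$ (i, j) = transpose_mat ?A $$ (k, j)"
      by (rule perm_rep_mult_index[OF inj]) (use ij k act im in \<open>auto simp: bij_betw_def\<close>)
    also have "\<dots> = (1\<^sub>m n :: 'k mat) $$ (i, j)"
      using ij k inj by (auto simp: perm_rep_def inj_on_def)
    finally show "(?A * transpose_mat ?A) $$ (i, j) = (1\<^sub>m n :: 'k mat) $$ (i, j)" .
  qed auto
  show "transpose_mat ?A * ?A = 1\<^sub>m n"
  proof (rule eq_matI)
    fix i j assume "i < dim_row (1\<^sub>m n :: 'k mat)" "j < dim_col (1\<^sub>m n :: 'k mat)"
    then have ij: "i < n" "j < n" by auto
    then have X: "xs i \<in> X" "xs j \<in> X" using im by auto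
    then have "act g (xs j) \<in> X" using act by (auto simp: bij_betw_def)
    then obtain k where k: "k < n" "xs k = act g (xs j)" using ex by blast
    have "(transpose_mat ?A * ?A) $$ (i, j) = transpose_mat ?A $$ (i, k)"
      by (rule mult_perm_rep_index[OF inj]) (use ij k in auto)
    also have "\<dots> = (if act g (xs j) = act g (xs i) then 1 else 0)" using ij k by (simp add: perm_rep_def)
    also have "act g (xs j) = act g (xs i) \<longleftrightarrow> i = j"
      using X act inj ij by (auto simp: bij_betw_def inj_on_def)
    finally show "(transpose_mat ?A * ?A) $$ (i, j) = (1\<^sub>m n :: 'k mat) $$ (i, j)" using ij by simp
  qed auto
qed

section \<open>The radical as the ideal of negligible homomorphisms\<close>

context group
begin

lemma kelly_radical_eq_negligible:
  fixes M N :: "('a, 'k::field) rep"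
  assumes fin: "finite (carrier G)" and p: "prime p" "CHAR('k) = p" and dvd: "p dvd Coset.order G"
    and ndvd: "\<not> p ^ 2 dvd Coset.order G" and M: "is_rep G M" and N: "is_rep G N" and f: "f \<in> rep_hom G M N"
  shows "stable_rel G M N `` {f} \<in> kelly_radical (stmod G TYPE('k)) M N \<longleftrightarrow> f \<in> negligible_hom G M N"
  unfolding kelly_radical_stmod_iff[OF fin M N f]
proof
  assume "f \<in> negligible_hom G M N"
  from negligible_imp_radical[OF fin p dvd ndvd M N this]
  show "\<forall>g\<in>rep_hom G N M. \<exists>v\<in>rep_hom G M M.
      (1\<^sub>m (fst M) - g * f) * v - 1\<^sub>m (fst M) \<in> projective_hom G M M \<and>
      v * (1\<^sub>m (fst M) - g * f) - 1\<^sub>m (fst M) \<in> projective_hom G M M" by blast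
qed (rule radical_imp_negligible[OF fin M N _ f], use p dvd in auto)

text \<open>Absorbing g into the test map h reduces the claim to f \<otimes> 1. Adjointness then
  replaces the test map by its partial trace, which is again equivariant, so that the negligibility
  of f applies.\<close>

lemma negligible_hom_kronecker:
  assumes M: "is_rep G M" and N: "is_rep G N" and K: "is_rep G K" and L: "is_rep G L"
    and f: "f \<in> negligible_hom G M N" and g: "g \<in> rep_hom G K L"
  shows "kronecker f g \<in> negligible_hom G (rep_tensor M K) (rep_tensor N L)"
  unfolding negligible_hom_def
proof (intro CollectI conjI ballI)
  note fh = negligible_homD(1)[OF f]
  note fd = rep_homD(1,2)[OF fh] and gd = rep_homD(1,2)[OF g]
  show "kronecker f g \<in> rep_hom G (rep_tensor M K) (rep_tensor N L)"
    by (rule kronecker_hom[OF is_group M N K L fh g])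
  fix h assume h: "h \<in> rep_hom G (rep_tensor N L) (rep_tensor M K)"
  define m n k where "m = fst M" "n = fst N" "k = fst K"
  \<comment> \<open>Possible because f \<otimes> g is 1 \<otimes> g after f \<otimes> 1.\<close>
  define Y where "Y = h * kronecker (1\<^sub>m n) g"
  have "kronecker (1\<^sub>m n) g \<in> rep_hom G (rep_tensor N K) (rep_tensor N L)"
    unfolding m_n_k_def by (rule kronecker_hom[OF is_group N N K L rep_hom_one[OF N] g])
  then have Y: "Y \<in> rep_hom G (rep_tensor N K) (rep_tensor M K)"
    unfolding Y_def by (rule rep_hom_comp[OF is_rep_tensor[OF N K] is_rep_tensor[OF N L] is_rep_tensor[OF M K] _ h])
  have Yd: "dim_row Y = m * k" "dim_col Y = n * k"
    using rep_homD(1,2)[OF Y] by (simp_all add: rep_tensor_def m_n_k_def)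
  have "partial_trace m n k Y \<in> rep_hom G N M"
  proof (rule rep_homI)
    fix x assume x: "x \<in> carrier G"
    note xi = inv_closed[OF x]
    have "partial_trace m n k (kronecker (snd M x) (snd K x) * (Y * kronecker (snd N (inv x)) (snd K (inv x))))
        = snd M x * (partial_trace m n k Y * snd N (inv x))"
      by (rule partial_trace_conj) (use x xi M N K Yd in \<open>simp_all add: m_n_k_def rep_inv\<close>)
    moreover have "kronecker (snd M x) (snd K x) * (Y * kronecker (snd N (inv x)) (snd K (inv x))) = Y"
    proof -
      have "Y * kronecker (snd N (inv x)) (snd K (inv x)) = kronecker (snd M (inv x)) (snd K (inv x)) * Y"
        using rep_homD(3)[OF Y xi] by (simp add: rep_tensor_def)
      then have "kronecker (snd M x) (snd K x) * (Y * kronecker (snd N (inv x)) (snd K (inv x)))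
          = kronecker (snd M x) (snd K x) * kronecker (snd M (inv x)) (snd K (inv x)) * Y"
        using x xi M N K Yd by (simp add: mat_mult_assoc m_n_k_def)
      also have "\<dots> = Y"
        using x xi M N K Yd by (simp add: kronecker_mult rep_inv kronecker_one m_n_k_def)
      finally show ?thesis .
    qed
    ultimately have "partial_trace m n k Y * snd N x = snd M x * (partial_trace m n k Y * snd N (inv x)) * snd N x"
      by simp
    also have "\<dots> = snd M x * (partial_trace m n k Y * (snd N (inv x) * snd N x))"
      using x xi M N by (simp add: mat_mult_assoc m_n_k_def)
    also have "\<dots> = snd M x * partial_trace m n k Y"
      using x N by (simp add: rep_inv m_n_k_def)
    finally show "partial_trace m n k Y * snd N x = snd M x * partial_trace m n k Y" .
  qed (simp_all add: m_n_k_def)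
  then have "0 = mtrace (partial_trace m n k Y * f)" using negligible_homD(2)[OF f] by simp
  also have "\<dots> = mtrace (Y * kronecker f (1\<^sub>m k))"
    by (rule mtrace_partial_trace) (use Yd fd in \<open>simp_all add: m_n_k_def\<close>)
  also have "Y * kronecker f (1\<^sub>m k) = h * (kronecker (1\<^sub>m n) g * kronecker f (1\<^sub>m k))"
    unfolding Y_def using rep_homD(1,2)[OF h] fd gd by (simp add: mat_mult_assoc m_n_k_def rep_tensor_def)
  also have "kronecker (1\<^sub>m n) g * kronecker f (1\<^sub>m k) = kronecker f g"
    using fd gd by (simp add: kronecker_mult m_n_k_def)
  finally show "mtrace (h * kronecker f g) = 0" by simp
qed

lemma negligible_zero:
  assumes M: "is_rep G M" and N: "is_rep G N"
  shows "0\<^sub>m (fst N) (fst M) \<in> negligible_hom G M N"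
  unfolding negligible_hom_def using rep_hom_zero[OF M N] rep_homD(1,2)[of _ G N M] by auto

lemma negligible_uminus:
  assumes M: "is_rep G M" and N: "is_rep G N" and f: "f \<in> negligible_hom G M N"
  shows "- f \<in> negligible_hom G M N"
  unfolding negligible_hom_def
proof (intro CollectI conjI ballI)
  show "- f \<in> rep_hom G M N" by (rule rep_hom_uminus[OF M N negligible_homD(1)[OF f]])
  fix g assume g: "g \<in> rep_hom G N M"
  note d = rep_homD(1,2)[OF g] rep_homD(1,2)[OF negligible_homD(1)[OF f]]
  have "g * - f = - (g * f)" using d by simp
  then show "mtrace (g * - f) = 0" using negligible_homD(2)[OF f g] d by (simp add: mtrace_uminus)
qed

lemma negligible_add:
  assumes M: "is_rep G M" and N: "is_rep G N" and f: "f \<in> negligible_hom G M N" and f': "f' \<in> negligible_hom G M N"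
  shows "f + f' \<in> negligible_hom G M N"
  unfolding negligible_hom_def
proof (intro CollectI conjI ballI)
  show "f + f' \<in> rep_hom G M N" by (rule rep_hom_add[OF M N negligible_homD(1)[OF f] negligible_homD(1)[OF f']])
  fix g assume g: "g \<in> rep_hom G N M"
  note d = rep_homD(1,2)[OF g] rep_homD(1,2)[OF negligible_homD(1)[OF f]] rep_homD(1,2)[OF negligible_homD(1)[OF f']]
  have "mtrace (g * (f + f')) = mtrace (g * f) + mtrace (g * f')"
    using d by (simp add: mat_mult_add mtrace_add[of _ "fst M"])
  then show "mtrace (g * (f + f')) = 0" using negligible_homD(2)[OF f g] negligible_homD(2)[OF f' g] by simp
qed

lemma negligible_comp_left:
  assumes M: "is_rep G M" and N: "is_rep G N" and L: "is_rep G L"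
    and f: "f \<in> negligible_hom G M N" and h: "h \<in> rep_hom G N L"
  shows "h * f \<in> negligible_hom G M L"
  unfolding negligible_hom_def
proof (intro CollectI conjI ballI)
  note fh = negligible_homD(1)[OF f]
  show "h * f \<in> rep_hom G M L" by (rule rep_hom_comp[OF M N L fh h])
  fix g assume g: "g \<in> rep_hom G L M"
  have "g * (h * f) = (g * h) * f"
    using rep_homD(1,2)[OF g] rep_homD(1,2)[OF fh] rep_homD(1,2)[OF h] by (simp add: mat_mult_assoc)
  then show "mtrace (g * (h * f)) = 0" using negligible_homD(2)[OF f rep_hom_comp[OF N L M h g]] by simp
qed

lemma negligible_comp_right:
  assumes K: "is_rep G K" and M: "is_rep G M" and N: "is_rep G N"
    and f: "f \<in> negligible_hom G M N" and h: "h \<in> rep_hom G K M"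
  shows "f * h \<in> negligible_hom G K N"
  unfolding negligible_hom_def
proof (intro CollectI conjI ballI)
  note fh = negligible_homD(1)[OF f]
  show "f * h \<in> rep_hom G K N" by (rule rep_hom_comp[OF K M N h fh])
  fix g assume g: "g \<in> rep_hom G N K"
  note d = rep_homD(1,2)[OF g] rep_homD(1,2)[OF fh] rep_homD(1,2)[OF h]
  have "mtrace (g * (f * h)) = mtrace ((g * f) * h)" using d by (simp add: mat_mult_assoc)
  also have "\<dots> = mtrace (h * (g * f))" by (rule mtrace_comm) (use d in simp_all)
  also have "h * (g * f) = (h * g) * f" using d by (simp add: mat_mult_assoc)
  finally show "mtrace (g * (f * h)) = 0" using negligible_homD(2)[OF f rep_hom_comp[OF N K M g h]] by simp
qed

lemma kelly_radical_stmodE: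
  assumes "finite (carrier G)" "X \<in> kelly_radical (stmod G TYPE('k::field)) M N"
  obtains f where "f \<in> rep_hom G M N" "X = stable_rel G M N `` {f}"
  using assms stmod_MorE[OF assms(1), of X M N] unfolding kelly_radical_def by blast

theorem tensor_ideal_if_not_square_dvd:
  assumes fin: "finite (carrier G)" and p: "prime p" "CHAR('k::field) = p" and dvd: "p dvd Coset.order G"
    and ndvd: "\<not> p ^ 2 dvd Coset.order G"
  shows "tensor_ideal (stmod G TYPE('k)) (kelly_radical (stmod G TYPE('k)))"
proof -
  let ?C = "stmod G TYPE('k)"
  let ?c = "\<lambda>M N f. stable_rel G M N `` {f}"
  note iff = kelly_radical_eq_negligible[OF fin p dvd ndvd]
  have E: "\<exists>f\<in>negligible_hom G M N. X = ?c M N f"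
    if "X \<in> kelly_radical ?C M N" "is_rep G M" "is_rep G N" for X M N
    using that by (metis kelly_radical_stmodE[OF fin] iff)
  have I: "?c M N f \<in> kelly_radical ?C M N" if "f \<in> negligible_hom G M N" "is_rep G M" "is_rep G N" for f M N
    using that iff negligible_homD(1) by blast
  show ?thesis
    unfolding tensor_ideal_def morphism_ideal_def stmod_Obj[OF fin, symmetric] Ball_def
  proof (intro conjI allI impI)
    fix M N assume "M \<in> Obj ?C" "N \<in> Obj ?C"
    then have M: "is_rep G M" and N: "is_rep G N" by (simp_all add: stmod_Obj[OF fin])
    show "kelly_radical ?C M N \<subseteq> Mor ?C M N" by (auto simp: kelly_radical_def)
    show "Zero ?C M N \<in> kelly_radical ?C M N"
      unfolding stmod_Zero[OF fin] by (rule I[OF negligible_zero[OF M N] M N])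
    fix X assume "X \<in> kelly_radical ?C M N"
    then obtain f where f: "f \<in> negligible_hom G M N" "X = ?c M N f" using E M N by blast
    note fh = negligible_homD(1)[OF f(1)]
    show "Neg ?C M N X \<in> kelly_radical ?C M N"
      unfolding f(2) stmod_Neg[OF fin M N fh] by (rule I[OF negligible_uminus[OF M N f(1)] M N])
    fix X' assume "X' \<in> kelly_radical ?C M N"
    then obtain f' where f': "f' \<in> negligible_hom G M N" "X' = ?c M N f'" using E M N by blast
    show "Add ?C M N X X' \<in> kelly_radical ?C M N"
      unfolding f(2) f'(2) stmod_Add[OF fin M N fh negligible_homD(1)[OF f'(1)]]
      by (rule I[OF negligible_add[OF M N f(1) f'(1)] M N])
  next
    fix K M N L H X Y
    assume "K \<in> Obj ?C" "M \<in> Obj ?C" "N \<in> Obj ?C" "L \<in> Obj ?C"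
    then have K: "is_rep G K" and M: "is_rep G M" and N: "is_rep G N" and L: "is_rep G L"
      by (simp_all add: stmod_Obj[OF fin])
    assume "H \<in> Mor ?C K M" "X \<in> kelly_radical ?C M N" "Y \<in> Mor ?C N L"
    then obtain h f g where h: "h \<in> rep_hom G K M" "H = ?c K M h" and f: "f \<in> negligible_hom G M N" "X = ?c M N f"
      and g: "g \<in> rep_hom G N L" "Y = ?c N L g"
      using E[OF _ M N] by (metis stmod_MorE[OF fin])
    note fh = negligible_homD(1)[OF f(1)]
    show "Comp ?C K M N X H \<in> kelly_radical ?C K N"
      unfolding h f g stmod_Comp[OF fin K M N h(1) fh]
      by (rule I[OF negligible_comp_right[OF K M N f(1) h(1)] K N])
    show "Comp ?C M N L Y X \<in> kelly_radical ?C M L"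
      unfolding h f g stmod_Comp[OF fin M N L fh g(1)]
      by (rule I[OF negligible_comp_left[OF M N L f(1) g(1)] M L])
  next
    fix M N K L X Y
    assume "M \<in> Obj ?C" "N \<in> Obj ?C" "K \<in> Obj ?C" "L \<in> Obj ?C"
    then have K: "is_rep G K" and M: "is_rep G M" and N: "is_rep G N" and L: "is_rep G L"
      by (simp_all add: stmod_Obj[OF fin])
    assume "X \<in> kelly_radical ?C M N" "Y \<in> Mor ?C K L"
    then obtain f g where f: "f \<in> negligible_hom G M N" "X = ?c M N f"
      and g: "g \<in> rep_hom G K L" "Y = ?c K L g"
      using E[OF _ M N] by (metis stmod_MorE[OF fin])
    show "TMor ?C M N K L X Y \<in> kelly_radical ?C (TObj ?C M K) (TObj ?C N L)"
      unfolding f g stmod_TMor[OF fin M N K L negligible_homD(1)[OF f(1)] g(1)] stmod_TObj[OF fin]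
      by (rule I[OF negligible_hom_kronecker[OF M N K L f(1) g(1)] is_rep_tensor[OF M K] is_rep_tensor[OF N L]])
  qed
qed

end

section \<open>The permutation module on the cosets of a subgroup of order p\<close>

context group
begin

text \<open>Right multiplication by inverses turns the right cosets of H into a left G-set, a copy
  of G/H.\<close>

lemma coset_action:
  assumes "subgroup H G"
  shows "\<And>g C. g \<in> carrier G \<Longrightarrow> C \<in> rcosets H \<Longrightarrow> C #> inv g \<in> rcosets H"
    and "\<And>C. C \<in> rcosets H \<Longrightarrow> C #> inv \<one> = C"
    and "\<And>g h C. g \<in> carrier G \<Longrightarrow> h \<in> carrier G \<Longrightarrow> C \<in> rcosets H \<Longrightarrow> C #> inv (g \<otimes> h) = (C #> inv h) #> inv g"
proof -
  have sub: "H \<subseteq> carrier G" by (rule subgroup.subset[OF assms])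
  have C: "C \<subseteq> carrier G" if "C \<in> rcosets H" for C by (rule subgroup.rcosets_carrier[OF assms is_group that])
  show "C #> inv g \<in> rcosets H" if "g \<in> carrier G" and CH: "C \<in> rcosets H" for g C
  proof -
    obtain x where "x \<in> carrier G" "C = H #> x" using CH by (auto simp: RCOSETS_def)
    then have "C #> inv g = H #> (x \<otimes> inv g)" using sub that by (simp add: coset_mult_assoc)
    then show ?thesis using \<open>x \<in> carrier G\<close> that sub by (simp add: rcosetsI)
  qed
  show "C #> inv \<one> = C" if "C \<in> rcosets H" for C using C[OF that] by (simp add: coset_mult_one)
  show "C #> inv (g \<otimes> h) = (C #> inv h) #> inv g" if "g \<in> carrier G" "h \<in> carrier G" "C \<in> rcosets H" for g h C
    using that C[OF that(3)] by (simp add: coset_mult_assoc inv_mult_group)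
qed

lemma coset_action_bij:
  assumes H: "subgroup H G" and g: "g \<in> carrier G"
  shows "bij_betw (\<lambda>C. C #> inv g) (rcosets H) (rcosets H)"
proof (rule bij_betwI[where g = "\<lambda>C. C #> inv (inv g)"])
  show "(\<lambda>C. C #> inv g) \<in> rcosets H \<rightarrow> rcosets H" "(\<lambda>C. C #> inv (inv g)) \<in> rcosets H \<rightarrow> rcosets H"
    using coset_action(1)[OF H] g inv_closed[OF g] by blast+
  show "C #> inv g #> inv (inv g) = C" if "C \<in> rcosets H" for C
    using coset_action(3)[OF H inv_closed[OF g] g that] coset_action(2)[OF H that] g by simp
  show "C #> inv (inv g) #> inv g = C" if "C \<in> rcosets H" for C
    using coset_action(3)[OF H g inv_closed[OF g] that] coset_action(2)[OF H that] g by simp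
qed

text \<open>The fibres of g \<mapsto> H g are the cosets themselves. With |H| equal to the
  characteristic the sum vanishes, which will keep the identity of k[G/H] from being a
  trace.\<close>

lemma sum_over_rcosets:
  fixes f :: "'a set \<Rightarrow> 'c::comm_semiring_1"
  assumes fin: "finite (carrier G)" and H: "subgroup H G"
  shows "(\<Sum>g\<in>carrier G. f (H #> g)) = of_nat (card H) * (\<Sum>C\<in>rcosets H. f C)"
proof -
  have sub: "H \<subseteq> carrier G" by (rule subgroup.subset[OF H])
  have finR: "finite (rcosets H)" using fin by (auto simp: RCOSETS_def)
  have "(\<Sum>g\<in>carrier G. f (H #> g)) = (\<Sum>C\<in>rcosets H. of_nat (card {g \<in> carrier G. H #> g = C}) * f C)"
    by (rule sum_fun_comp[OF fin finR]) (use sub in \<open>auto intro: rcosetsI\<close>)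
  also have "\<dots> = (\<Sum>C\<in>rcosets H. of_nat (card H) * f C)"
  proof (rule sum.cong[OF refl])
    fix C assume C: "C \<in> rcosets H"
    then obtain x where x: "x \<in> carrier G" "C = H #> x" by (auto simp: RCOSETS_def)
    have "{g \<in> carrier G. H #> g = C} = C"
    proof
      show "{g \<in> carrier G. H #> g = C} \<subseteq> C" using rcos_self[OF _ H] by blast
      show "C \<subseteq> {g \<in> carrier G. H #> g = C}"
      proof
        fix g assume g: "g \<in> C"
        then have "g \<in> carrier G" using subgroup.rcosets_carrier[OF H is_group C] by blast
        moreover have "H #> g = C" using repr_independence[of g H x] g x H by simp
        ultimately show "g \<in> {g \<in> carrier G. H #> g = C}" by simp
      qed
    qed
    then show "of_nat (card {g \<in> carrier G. H #> g = C}) * f C = of_nat (card H) * f C"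
      using card_rcosets_equal[OF C sub] by simp
  qed
  finally show ?thesis by (simp add: sum_distrib_left)
qed

text \<open>
  The permutation module on \<open>G/H\<close> with \<open>|H| = p\<close>: the invariant vector \<open>\<Sum>\<^sub>i e\<^sub>i \<otimes> e\<^sub>i\<close> lies in the radical, because
  an invariant functional is constant on the \<open>[G:H]\<close> vectors \<open>e\<^sub>i \<otimes> e\<^sub>i\<close>; but tensored with the module it
  becomes a split monomorphism.
\<close>

theorem not_tensor_ideal_if_square_dvd:
  assumes fin: "finite (carrier G)" and p: "prime p" "CHAR('k::field) = p" and dvd: "p ^ 2 dvd Coset.order G"
  shows "\<not> tensor_ideal (stmod G TYPE('k)) (kelly_radical (stmod G TYPE('k)))"
proof
  let ?C = "stmod G TYPE('k)"
  assume ideal: "tensor_ideal ?C (kelly_radical ?C)"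
  have "p dvd Coset.order G" using dvd by (rule dvd_trans[rotated]) simp
  \<comment> \<open>The exponent 1 asks for a subgroup of order p and not for a full Sylow subgroup;
    its index n is still divisible by p.\<close>
  then obtain m where "Coset.order G = p ^ 1 * m" by (auto elim: dvdE)
  from sylow_thm[OF p(1) is_group this fin] obtain H where H: "subgroup H G" "card H = p" by auto
  have sub: "H \<subseteq> carrier G" by (rule subgroup.subset[OF H(1)])
  define n where "n = card (rcosets H)"
  have np: "n * p = Coset.order G" using lagrange[OF H(1)] H(2) by (simp add: n_def)
  have "p * p dvd n * p" using dvd unfolding np by (simp add: power2_eq_square)
  then have "p dvd n" using prime_gt_0_nat[OF p(1)] by simp
  then have n0: "of_nat n = (0 :: 'k)" using p by (simp add: of_nat_eq_0_iff_char_dvd)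
  have finR: "finite (rcosets H)" using fin by (auto simp: RCOSETS_def)
  obtain xs where bij: "bij_betw xs {..<n} (rcosets H)"
    using ex_bij_betw_nat_finite[OF finR] unfolding n_def lessThan_atLeast0 by blast
  then have inj: "inj_on xs {..<n}" and im: "xs ` {..<n} = rcosets H" by (auto simp: bij_betw_def)
  have xsR: "xs i \<in> rcosets H" if "i < n" for i using that im by blast
  have ex: "\<exists>k<n. xs k = C" if "C \<in> rcosets H" for C
    using that unfolding im[symmetric] by auto
  define act where "act = (\<lambda>g C. C #> inv g)"
  define M :: "('a, 'k) rep" where "M = perm_rep n xs act"
  have M: "is_rep G M"
    unfolding M_def act_def by (rule is_rep_perm_rep[OF bij]) (rule coset_action[OF H(1)]; assumption)+
  have Md[simp]: "fst M = n" "dim_row (snd M g) = n" "dim_col (snd M g) = n" for g by (simp_all add: M_def)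
  have orth: "snd M g * transpose_mat (snd M g) = 1\<^sub>m n" "transpose_mat (snd M g) * snd M g = 1\<^sub>m n"
    if "g \<in> carrier G" for g
    unfolding M_def
    by (rule perm_rep_orthogonal[where act = act, OF bij], simp add: act_def coset_action_bij[OF H(1) that])+
  define MM where "MM = rep_tensor M M"
  have MM: "is_rep G MM" unfolding MM_def by (rule is_rep_tensor[OF M M])
  have MMd: "fst MM = n * n" "snd MM g = kronecker (snd M g) (snd M g)" for g by (simp_all add: MM_def rep_tensor_def)
  define f :: "'k mat" where "f = diagonal_vector n"
  have triv: "is_rep G (trivial_rep :: ('a, 'k) rep)" by (rule is_rep_trivial)
  have f: "f \<in> rep_hom G trivial_rep MM"
  proof (rule rep_homI)
    fix g assume "g \<in> carrier G"
    then have "snd MM g * f = f" unfolding f_def MMd by (intro kronecker_mult_diagonal_vector orth) simp_all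
    then show "f * snd trivial_rep g = snd MM g * f" by (simp add: trivial_rep_def f_def)
  qed (simp_all add: MMd f_def trivial_rep_def)
  \<comment> \<open>The transposed matrices are orthogonal too and fix f. Transposing that equation
    makes the transpose of f an invariant functional.\<close>
  have ev: "transpose_mat f \<in> rep_hom G MM trivial_rep"
  proof (rule rep_homI)
    fix g assume g: "g \<in> carrier G"
    have "kronecker (transpose_mat (snd M g)) (transpose_mat (snd M g)) * f = f"
      unfolding f_def by (rule kronecker_mult_diagonal_vector) (use orth[OF g] in simp_all)
    then have "transpose_mat (transpose_mat (kronecker (snd M g) (snd M g)) * f) = transpose_mat f"
      by (simp add: kronecker_transpose)
    moreover have "transpose_mat (transpose_mat (kronecker (snd M g) (snd M g)) * f)
        = transpose_mat f * kronecker (snd M g) (snd M g)"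
      by (subst transpose_mult[of _ "n * n" "n * n" _ 1]) (auto simp: f_def intro!: carrier_matI)
    ultimately show "transpose_mat f * snd MM g = snd trivial_rep g * transpose_mat f"
      by (simp add: MMd trivial_rep_def f_def)
  qed (simp_all add: MMd f_def trivial_rep_def)
  have "stable_rel G trivial_rep MM `` {f} \<in> kelly_radical ?C trivial_rep MM"
    unfolding kelly_radical_stmod_iff[OF fin triv MM f]
  proof
    fix g assume g: "g \<in> rep_hom G MM trivial_rep"
    have gd: "dim_row g = 1" "dim_col g = n * n" using rep_homD(1,2)[OF g] by (simp_all add: MMd trivial_rep_def)
    have const: "g $$ (0, i * n + i) = g $$ (0, i' * n + i')"
      if ii: "i < n" "i' < n" for i i'
    proof -
      obtain y y' where y: "y \<in> carrier G" "xs i = H #> y" "y' \<in> carrier G" "xs i' = H #> y'"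
        using xsR[OF ii(1)] xsR[OF ii(2)] by (auto simp: RCOSETS_def)
      \<comment> \<open>Chosen so that H y times the inverse of z is \<open>H #> y'\<close>:
        transitivity of the action forces g to agree on any two diagonal basis vectors.\<close>
      define z where "z = inv y' \<otimes> y"
      have z: "z \<in> carrier G" using y by (simp add: z_def)
      have "act z (xs i) = H #> (y \<otimes> inv z)" using y z sub by (simp add: act_def coset_mult_assoc)
      also have "y \<otimes> inv z = y'" using y by (simp add: z_def inv_mult_group m_assoc[symmetric])
      finally have zi: "xs i' = act z (xs i)" using y by simp
      have R: "snd M z $$ (k, i) = (if k = i' then 1 else 0)" if "k < n" for k
        using that ii zi inj by (auto simp: M_def perm_rep_def inj_on_def)
      have "g * snd MM z = g"
        using rep_homD(3)[OF g z] gd by (simp add: trivial_rep_def)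
      then have "g $$ (0, i * n + i) = (g * kronecker (snd M z) (snd M z)) $$ (0, i * n + i)" by (simp add: MMd)
      also have "\<dots> = (\<Sum>t<n * n. g $$ (0, t) * kronecker (snd M z) (snd M z) $$ (t, i * n + i))"
        using gd ii by (subst mat_mult_index) (auto simp: block_index_less)
      also have "\<dots> = (\<Sum>a<n. \<Sum>b<n. if b = i' then if a = i' then g $$ (0, i' * n + i') else 0 else 0)"
        unfolding sum_lessThan_times
      proof (intro sum.cong refl)
        fix a b assume "a \<in> {..<n}" "b \<in> {..<n}"
        then show "g $$ (0, a * n + b) * kronecker (snd M z) (snd M z) $$ (a * n + b, i * n + i)
            = (if b = i' then if a = i' then g $$ (0, i' * n + i') else 0 else 0)"
          using kronecker_index[of a "snd M z" i b "snd M z" i] ii R by simp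
      qed
      also have "\<dots> = g $$ (0, i' * n + i')" using ii by simp
      finally show ?thesis .
    qed
    have "(g * f) $$ (0, 0) = 0"
    proof -
      have "(g * f) $$ (0, 0) = (\<Sum>t<n * n. g $$ (0, t) * f $$ (t, 0))"
        using gd by (subst mat_mult_index) (auto simp: f_def)
      also have "\<dots> = (\<Sum>a<n. \<Sum>b<n. if b = a then g $$ (0, a * n + a) else 0)"
        unfolding sum_lessThan_times f_def by (intro sum.cong refl) (auto simp: diagonal_vector_index)
      also have "\<dots> = (\<Sum>a<n. g $$ (0, a * n + a))" by simp
      \<comment> \<open>All n summands are equal, and n = [G:H] is zero in k. The index 0 is
        legitimate as soon as there is a summand.\<close>
      also have "\<dots> = (\<Sum>a<n. g $$ (0, 0 * n + 0))" by (intro sum.cong refl const) auto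
      also have "\<dots> = 0" using n0 by simp
      finally show ?thesis .
    qed
    then have gf: "g * f = 0\<^sub>m 1 1" using gd by (intro eq_matI) (auto simp: f_def)
    have "(1\<^sub>m 1 - g * f) * 1\<^sub>m 1 - 1\<^sub>m 1 = 0\<^sub>m 1 1" "1\<^sub>m 1 * (1\<^sub>m 1 - g * f) - 1\<^sub>m 1 = 0\<^sub>m 1 1"
      unfolding gf by (simp_all add: mat_eq_iff)
    then show "\<exists>v\<in>rep_hom G trivial_rep trivial_rep.
        (1\<^sub>m (fst trivial_rep) - g * f) * v - 1\<^sub>m (fst trivial_rep) \<in> projective_hom G trivial_rep trivial_rep \<and>
        v * (1\<^sub>m (fst trivial_rep) - g * f) - 1\<^sub>m (fst trivial_rep) \<in> projective_hom G trivial_rep trivial_rep"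
      using rep_hom_one[OF triv] projective_hom_zero[OF fin triv triv]
      by (intro bexI[of _ "1\<^sub>m 1"]) (simp_all add: trivial_rep_def)
  qed
  moreover have "\<And>M N K L X Y. M \<in> Obj ?C \<Longrightarrow> N \<in> Obj ?C \<Longrightarrow> K \<in> Obj ?C \<Longrightarrow> L \<in> Obj ?C \<Longrightarrow>
      X \<in> kelly_radical ?C M N \<Longrightarrow> Y \<in> Mor ?C K L \<Longrightarrow>
      TMor ?C M N K L X Y \<in> kelly_radical ?C (TObj ?C M K) (TObj ?C N L)"
    using ideal unfolding tensor_ideal_def by blast
  ultimately have "TMor ?C trivial_rep MM M M (stable_rel G trivial_rep MM `` {f}) (stable_rel G M M `` {1\<^sub>m n})
      \<in> kelly_radical ?C (TObj ?C trivial_rep M) (TObj ?C MM M)"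
    using triv MM M stmod_MorI[OF fin rep_hom_one[OF M]] by (simp add: stmod_Obj[OF fin])
  then have rad: "stable_rel G M (rep_tensor MM M) `` {kronecker f (1\<^sub>m n)} \<in> kelly_radical ?C M (rep_tensor MM M)"
    using stmod_TMor[OF fin triv MM M M f rep_hom_one[OF M]]
    by (simp add: stmod_TObj[OF fin] trivial_rep_tensor)
  have f1: "kronecker f (1\<^sub>m n) \<in> rep_hom G M (rep_tensor MM M)"
    using kronecker_hom[OF is_group triv MM M M f rep_hom_one[OF M]] by (simp add: trivial_rep_tensor)
  \<comment> \<open>The left inverse of f \<otimes> 1 from the triangle identity. Used as the test
    map, it makes the radical condition assert that 0 is stably invertible on M, hence that the
    identity of M is projective.\<close>
  have g1: "kronecker (1\<^sub>m n) (transpose_mat f) \<in> rep_hom G (rep_tensor MM M) M"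
    using kronecker_hom[OF is_group M M MM triv rep_hom_one[OF M] ev]
    by (simp add: rep_tensor_trivial MM_def rep_tensor_assoc)
  obtain v where v: "v \<in> rep_hom G M M"
    "(1\<^sub>m n - kronecker (1\<^sub>m n) (transpose_mat f) * kronecker f (1\<^sub>m n)) * v - 1\<^sub>m n \<in> projective_hom G M M"
    using rad g1 unfolding kelly_radical_stmod_iff[OF fin M is_rep_tensor[OF MM M] f1] Md by blast
  have "(1\<^sub>m n - kronecker (1\<^sub>m n) (transpose_mat f) * kronecker f (1\<^sub>m n)) * v - 1\<^sub>m n = - 1\<^sub>m n"
  proof -
    have "(1\<^sub>m n - 1\<^sub>m n :: 'k mat) = 0\<^sub>m n n" by (simp add: mat_eq_iff)
    moreover have "0\<^sub>m n n * v = 0\<^sub>m n n" using rep_homD(1,2)[OF v(1)] by simp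
    ultimately show ?thesis unfolding f_def zigzag by (simp only:) (rule eq_matI, auto)
  qed
  with v(2) have "- 1\<^sub>m n \<in> projective_hom G M M" by simp
  from projective_hom_uminus[OF fin M M this] have "1\<^sub>m n \<in> projective_hom G M M" by simp
  then obtain h where h: "dim_row h = n" "dim_col h = n" and id: "1\<^sub>m n = trace_map G (carrier G) M M h"
    using projective_homE[OF fin _ M M] by (metis Md(1))
  \<comment> \<open>The contradiction is read off at the diagonal entry of the trivial coset. The
    inverse of g sends H to H g, so the summand of g is the diagonal entry of h at H g, and each
    coset is counted |H| = p times.\<close>
  obtain c where c: "c < n" "xs c = H" using ex subgroup.subgroup_in_rcosets[OF H(1) is_group] by blast
  define idx where "idx = the_inv_into {..<n} xs"
  have idx: "idx C < n" "xs (idx C) = C" if "C \<in> rcosets H" for C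
    using the_inv_into_into[OF inj] f_the_inv_into_f[OF inj] that im unfolding idx_def by auto
  have "(snd M g * (h * snd M (inv g))) $$ (c, c) = h $$ (idx (H #> g), idx (H #> g))" if g: "g \<in> carrier G" for g
  proof -
    let ?k = "idx (H #> g)"
    have Hg: "H #> g \<in> rcosets H" using g sub by (rule rcosetsI[rotated])
    note k = idx[OF Hg]
    have ak: "xs c = act g (xs ?k)" using k c g sub by (simp add: act_def coset_mult_assoc coset_mult_one)
    have "(snd M g * (h * snd M (inv g))) $$ (c, c) = (h * snd M (inv g)) $$ (?k, c)"
      unfolding M_def
      by (rule perm_rep_mult_index[OF inj])
        (use h c k ak coset_action_bij[OF H(1) g] im in \<open>auto simp: act_def bij_betw_def\<close>)
    also have "\<dots> = h $$ (?k, ?k)"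
      unfolding M_def by (rule mult_perm_rep_index[OF inj]) (use h c k g in \<open>auto simp: act_def\<close>)
    finally show ?thesis .
  qed
  then have "trace_map G (carrier G) M M h $$ (c, c) = (\<Sum>g\<in>carrier G. h $$ (idx (H #> g), idx (H #> g)))"
    using c by (simp add: trace_map_def del: index_mult_mat(1))
  also have "\<dots> = of_nat (card H) * (\<Sum>C\<in>rcosets H. h $$ (idx C, idx C))"
    by (rule sum_over_rcosets[OF fin H(1)])
  also have "\<dots> = 0" using p H(2) by (simp add: of_nat_eq_0_iff_char_dvd)
  finally have "(1\<^sub>m n :: 'k mat) $$ (c, c) = 0" by (simp only: id)
  then show False using c by simp
qed

end

theorem theorem2p25:
  fixes G :: "('g, 'z) monoid_scheme" and p :: nat
  assumes "Group.group G" and "finite (carrier G)"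
    and "CHAR('k::field) = p" and "p > 0"
    and "p dvd Coset.order G"
  shows "tensor_ideal (stmod G TYPE('k)) (kelly_radical (stmod G TYPE('k)))
           \<longleftrightarrow> \<not> p ^ 2 dvd Coset.order G"
proof -
  interpret Group.group G by fact
  have "prime p" using prime_CHAR_semidom[where ?'a = 'k] assms(3,4) by simp
  then show ?thesis
    using tensor_ideal_if_not_square_dvd[where ?'k = 'k] not_tensor_ideal_if_square_dvd[where ?'k = 'k] assms by blast
qed

end
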